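(* Let $G_1,\ldots,G_m \in \mathrm{M}_n(\mathbb{R}[\underline{x}])$ and let $J$ be the left ideal of $\mathrm{M}_n(\mathbb{R}[\underline{x}])$ generated by them. Then for every $F \in \mathrm{S}_n(\mathbb{R}[\underline{x}])$ the following are equivalent: (1) For every $a \in \mathbb{R}^d$ and every nonzero $v \in \mathbb{R}^n$ such that $G_1(a)v = \ldots = G_m(a)v = 0$ we have $v^T F(a) v > 0$. (2) There exists $s \in \sum \mathbb{R}[\underline{x}]^2$ such that $(1+s)F \in I_n + \sum \mathrm{M}_n(\mathbb{R}[\underline{x}])^2 + J + J^T$.
   Context: $\mathbb{R}[\underline{x}] = \mathbb{R}[x_1,\ldots,x_d]$; $\sum \mathbb{R}[\underline{x}]^2$ is the set of all finite sums of squares of polynomials in $\mathbb{R}[\underline{x}]$. $\mathrm{M}_n(\mathbb{R}[\underline{x}])$ is the algebra of $n\times n$ matrices over $\mathbb{R}[\underline{x}]$, $\mathrm{S}_n(\mathbb{R}[\underline{x}])$ is its subspace of symmetric matrices, and $\sum \mathrm{M}_n(\mathbb{R}[\underline{x}])^2$ is the set of all finite sums of matrices of the form $H^T H$ with $H \in \mathrm{M}_n(\mathbb{R}[\underline{x}])$. $J^T = \{A^T : A \in J\}$, $I_n$ is the identity matrix, and sums of sets are elementwise (Minkowski) sums. *)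

theory Defs
  imports
    "HOL-Analysis.Analysis"
    "HOL-Library.Poly_Mapping"
    "HOL-Library.Set_Algebras"
begin

text \<open>
  \<open>'d rpoly\<close> is the polynomial ring over the reals in \<open>CARD('d)\<close> commuting variables: a
  polynomial is the finitely supported map from exponent vectors to coefficients, with the
  convolution product of \<^theory>\<open>HOL-Library.Poly_Mapping\<close>.
\<close>

type_synonym 'd rpoly = "('d \<Rightarrow>\<^sub>0 nat) \<Rightarrow>\<^sub>0 real"

definition poly_eval :: "'d::finite rpoly \<Rightarrow> real ^ 'd \<Rightarrow> real" where
  "poly_eval p a =
     (\<Sum>\<alpha>\<in>Poly_Mapping.keys p.
        Poly_Mapping.lookup p \<alpha> * (\<Prod>i\<in>UNIV. (a $ i) ^ Poly_Mapping.lookup \<alpha> i))"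

definition mat_eval :: "'d::finite rpoly ^ 'n ^ 'm \<Rightarrow> real ^ 'd \<Rightarrow> real ^ 'n ^ 'm" where
  "mat_eval A a = (\<chi> i j. poly_eval (A $ i $ j) a)"

text \<open>
  The product \<open>*\<close> and the scaling \<open>*s\<close> of the library act componentwise on the rows of a matrix
  over a ring, so scaling by a ring element has to be written out; the matrix product is \<open>**\<close>.
\<close>

definition mat_smult :: "'a::times \<Rightarrow> 'a ^ 'n ^ 'm \<Rightarrow> 'a ^ 'n ^ 'm" where
  "mat_smult c A = (\<chi> i j. c * A $ i $ j)"

definition sum_squares :: "'a::comm_ring_1 set" where
  "sum_squares = {s. \<exists>(k::nat) f. s = (\<Sum>i<k. (f i)\<^sup>2)}"

definition mat_sum_squares :: "('a::comm_ring_1 ^ 'n ^ 'n) set" where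
  "mat_sum_squares = {S. \<exists>(k::nat) (H :: nat \<Rightarrow> 'a ^ 'n ^ 'n). S = (\<Sum>i<k. transpose (H i) ** H i)}"

text \<open>Closure under negation follows by multiplying with \<open>- mat 1\<close>.\<close>

definition mat_left_ideal :: "('a::comm_ring_1 ^ 'n ^ 'n) set \<Rightarrow> bool" where
  "mat_left_ideal J \<longleftrightarrow>
     0 \<in> J \<and> (\<forall>A\<in>J. \<forall>B\<in>J. A + B \<in> J) \<and> (\<forall>C. \<forall>A\<in>J. C ** A \<in> J)"

end

theory Submission
  imports Defs "HOL-Algebra.Algebraic_Closure_Type"
begin

text \<open>
  With \<open>Q = \<Sum>i. G\<^sub>i\<^sup>T G\<^sub>i\<close> and \<open>w = 1 + \<bar>x\<bar>\<^sup>2\<close>, condition (1) yields an \<open>N\<close> such that \<open>F + N w\<^sup>N Q\<close> is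
  positive definite at every real point (a polynomial version of Finsler's lemma). Since \<open>Q\<close> lies in \<open>J\<close>,
  only positive definite matrix polynomials remain, and Gaussian elimination reduces these to scalars:
  a polynomial \<open>f\<close> that is positive on \<open>\<real>\<^sup>d\<close> satisfies \<open>(1 + s) f = 1 + t\<close> with sums of squares \<open>s\<close>, \<open>t\<close>.

  Both the scalar statement and Finsler's lemma rest on one fact: finitely many members of a
  maximal preordering of a real polynomial ring are simultaneously nonnegative at some real point.
  The preordering makes the residue ring modulo its support an ordered domain, which embeds into a real
  closed field \<open>L\<close>. The images of the variables form a point over \<open>L\<close>, and it is transferred to a real point
  with the same signs, one variable at a time. For that step, Cohen and Hoermander: in a finite family of
  univariate polynomials closed under derivatives and remainders, the arrangement of all roots and the
  signs between them are determined by the signs of the leading coefficients.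
\<close>

unbundle no Formal_Power_Series.fps_syntax
hide_const (open) module.smult Polynomials.degree Poly_Mapping.degree Polynomials.lead_coeff up_ring.monom up_ring.coeff

subsection \<open>Matching the roots of polynomials over two real closed fields\<close>

text \<open>No constant multiple of \<open>Q\<close> need suffice, since the set of pairs of a point
  and a unit vector is not compact: \<open>Q\<close> may decay polynomially while \<open>F\<close>
  grows polynomially. The factor \<open>N w^N\<close> absorbs both rates, as in an inequality of
  Lojasiewicz type. Usually such an inequality is read off from curve selection or quantifier
  elimination; here a hypothetical sequence of counterexamples generates a preordering, and
  maximality supplies the polynomial bound.

  The transfer to a real point has to preserve all signs and not merely nonnegativity, because the
  induction over the variables compares degrees and root orders, and both depend on the signs of
  coefficients.

  Elimination alone yields a certificate up to congruence and denominators. To reach the form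
  \<open>I_n\<close> plus squares with a multiplier \<open>1 + s\<close>, every scalar identity is
  itself kept in the form \<open>(1 + s) f = 1 + t\<close>, and the cross terms of the pivot column
  are paid for by an explicit Cauchy-Schwarz identity.\<close>

class real_closed_field = linordered_field +
  assumes poly_sum_ivt: "a < b \<Longrightarrow> (\<Sum>k\<le>n. f k * a ^ k) < 0 \<Longrightarrow> 0 < (\<Sum>k\<le>n. f k * b ^ k) \<Longrightarrow>
    \<exists>c. a < c \<and> c < b \<and> (\<Sum>k\<le>n. f k * c ^ k) = 0"

lemma poly_ivt:
  fixes p :: "'a::real_closed_field poly"
  shows "a < b \<Longrightarrow> poly p a < 0 \<Longrightarrow> 0 < poly p b \<Longrightarrow> \<exists>c. a < c \<and> c < b \<and> poly p c = 0"
  unfolding poly_altdef by (rule poly_sum_ivt)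

lemma poly_sum_monom:
  fixes x :: "'a::comm_semiring_1"
  shows "poly (\<Sum>k\<le>n. monom (f k) k) x = (\<Sum>k\<le>n. f k * x ^ k)"
  by (simp add: Polynomial.poly_sum Polynomial.poly_monom)

instance real :: real_closed_field
proof
  fix a b :: real and n :: nat and f :: "nat \<Rightarrow> real"
  assume "a < b" "(\<Sum>k\<le>n. f k * a ^ k) < 0" "0 < (\<Sum>k\<le>n. f k * b ^ k)"
  then show "\<exists>c. a < c \<and> c < b \<and> (\<Sum>k\<le>n. f k * c ^ k) = 0"
    using poly_IVT_pos[of a b "\<Sum>k\<le>n. monom (f k) k"] by (auto simp: poly_sum_monom)
qed

lemma poly_sign_change_root:
  fixes p :: "'a::real_closed_field poly"
  assumes "a < b" "poly p a * poly p b < 0"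
  shows "\<exists>c. a < c \<and> c < b \<and> poly p c = 0"
proof (cases "poly p a < 0")
  case True
  then show ?thesis
    using assms poly_ivt[of a b p] by (auto simp: mult_less_0_iff)
next
  case False
  then show ?thesis
    using assms poly_ivt[of a b "- p"] by (auto simp: mult_less_0_iff)
qed

lemma smult_conv_mult: "smult c p = [:c:] * p"
  by simp

lemma poly_rolle:
  fixes p :: "'a::real_closed_field poly"
  assumes "a < b" "poly p a = 0" "poly p b = 0"
  shows "\<exists>c. a < c \<and> c < b \<and> poly (pderiv p) c = 0"
proof (cases "p = 0")
  case True
  obtain c where "a < c" "c < b" using dense[OF assms(1)] by blast
  then show ?thesis using True by auto
next
  case False
  define R where "R = {r. a < r \<and> r \<le> b \<and> poly p r = 0}"
  have "finite R" unfolding R_def using poly_roots_finite[OF False] by (auto intro: finite_subset)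
  moreover have "b \<in> R" unfolding R_def using assms by auto
  ultimately have min: "Min R \<in> R" "\<And>r. r \<in> R \<Longrightarrow> Min R \<le> r"
    using Min_in[of R] Min_le[of R] by blast+
  define u where "u = Min R"
  have u: "a < u" "u \<le> b" "poly p u = 0" using min(1) by (auto simp: R_def u_def)
  have noroot: "poly p z \<noteq> 0" if "a < z" "z < u" for z
    using min(2)[of z] that u by (auto simp: R_def u_def)
  obtain q1 where q1: "p = [:- a, 1:] ^ Polynomial.order a p * q1" "\<not> [:- a, 1:] dvd q1"
    using order_decomp[OF False] by blast
  have "q1 \<noteq> 0" using q1 False by auto
  then obtain q where q: "q1 = [:- u, 1:] ^ Polynomial.order u q1 * q" "\<not> [:- u, 1:] dvd q"
    using order_decomp by blast
  have "Polynomial.order a p \<noteq> 0" using False assms(2) by (simp add: order_root)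
  then obtain m where m: "Polynomial.order a p = Suc m" using not0_implies_Suc by blast
  have "poly p u = (u - a) ^ Polynomial.order a p * poly q1 u" by (subst q1(1)) simp
  then have "poly q1 u = 0" using u by simp
  then have "Polynomial.order u q1 \<noteq> 0" using \<open>q1 \<noteq> 0\<close> by (simp add: order_root)
  then obtain n where n: "Polynomial.order u q1 = Suc n" using not0_implies_Suc by blast
  have p: "p = [:- a, 1:] ^ Suc m * ([:- u, 1:] ^ Suc n * q)"
    using q1(1) q(1) m n by simp
  have qa: "poly q a \<noteq> 0" using q1(2) q(1) by (metis dvd_mult poly_eq_0_iff_dvd)
  have qu: "poly q u \<noteq> 0" using q(2) by (simp add: poly_eq_0_iff_dvd)
  have "poly q a * poly q u > 0"
  proof (rule ccontr)
    assume "\<not> ?thesis"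
    then have "poly q a * poly q u < 0" using qa qu by (simp add: not_less le_less)
    then obtain c where "a < c" "c < u" "poly q c = 0" using poly_sign_change_root u(1) by blast
    then show False using noroot[of c] p by simp
  qed
  define A B where "A = [:- a, 1:]" and "B = [:- u, 1:]"
  \<comment> \<open>What is left of the derivative after removing \<open>A ^ m * B ^ n\<close>. At
    \<open>a\<close> only the first summand survives, with the factor \<open>a - u\<close>; at
    \<open>u\<close> only the second, with the factor \<open>u - a\<close>.\<close>
  define g where "g = [:of_nat (Suc m):] * (B * q) + [:of_nat (Suc n):] * (A * q) + A * B * pderiv q"
  have "pderiv A = 1" "pderiv B = 1" by (simp_all add: A_def B_def pderiv_pCons)
  then have "pderiv (A ^ Suc m * (B ^ Suc n * q)) = A ^ m * B ^ n * g"
    unfolding pderiv_mult pderiv_power_Suc g_def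
    by (simp only: smult_conv_mult power_Suc) (simp only: algebra_simps mult_1_left mult_1_right)
  then have "pderiv p = A ^ m * B ^ n * g"
    unfolding p A_def B_def .
  moreover have "poly g a * poly g u < 0"
  proof -
    have "poly g a = of_nat (Suc m) * ((a - u) * poly q a)" "poly g u = of_nat (Suc n) * ((u - a) * poly q u)"
      by (simp_all add: g_def A_def B_def algebra_simps)
    then have "poly g a * poly g u = - (of_nat (Suc m) * of_nat (Suc n) * ((u - a)\<^sup>2 * (poly q a * poly q u)))"
      by (simp only:) (simp add: algebra_simps power2_eq_square)
    then show ?thesis using \<open>poly q a * poly q u > 0\<close> u(1)
      by (simp del: of_nat_Suc)
  qed
  ultimately show ?thesis using poly_sign_change_root[OF u(1)] u(2) by fastforce
qed

text \<open>Existence of a root becomes a sign condition at the ends, which two different fields can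
  share. A root \<open>z\<close> in the gap is simple, and by Rolle it is the only root in the
  closed interval, so the cofactor of \<open>x - z\<close> has constant sign there.\<close>

lemma root_in_gap_iff:
  fixes p :: "'a::real_closed_field poly"
  assumes "l < u" and der: "\<And>z. l < z \<Longrightarrow> z < u \<Longrightarrow> poly (pderiv p) z \<noteq> 0"
  shows "(\<exists>z. l < z \<and> z < u \<and> poly p z = 0) \<longleftrightarrow> poly p l * poly p u < 0"
proof
  assume "\<exists>z. l < z \<and> z < u \<and> poly p z = 0"
  then obtain z where z: "l < z" "z < u" "poly p z = 0" by blast
  then obtain q where q: "p = [:- z, 1:] * q" by (auto simp: poly_eq_0_iff_dvd)
  have "poly (pderiv p) z = poly q z"
    unfolding q pderiv_mult by (simp add: pderiv_pCons)
  then have qz: "poly q z \<noteq> 0" using der[of z] z by simp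
  have noroot: "poly q r \<noteq> 0" if "l \<le> r" "r \<le> u" for r
  proof
    assume "poly q r = 0"
    then have "r \<noteq> z" "poly p r = 0" using qz q by auto
    then consider "r < z" | "z < r" by fastforce
    then show False
      by (cases; use poly_rolle[of r z p] poly_rolle[of z r p] der z that \<open>poly p r = 0\<close> in force)
  qed
  have "\<not> poly q l * poly q u < 0" using poly_sign_change_root[OF assms(1)] noroot by force
  then have "poly q l * poly q u > 0" using noroot[of l] noroot[of u] assms(1)
    by (simp add: not_less le_less)
  moreover have "poly p l * poly p u = - ((z - l) * (u - z) * (poly q l * poly q u))"
    unfolding q by (simp add: algebra_simps)
  ultimately show "poly p l * poly p u < 0" using z by simp
qed (use poly_sign_change_root[OF assms(1)] in blast)

text \<open>The two arguments live in different ordered rings, so their \<open>sgn\<close> values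
  cannot be equated.\<close>

definition same_sign :: "'a::linordered_idom \<Rightarrow> 'b::linordered_idom \<Rightarrow> bool" where
  "same_sign x y \<longleftrightarrow> (0 < x \<longleftrightarrow> 0 < y) \<and> (x < 0 \<longleftrightarrow> y < 0)"

lemma same_sign_zero_iff: "same_sign x y \<Longrightarrow> x = 0 \<longleftrightarrow> y = 0"
  unfolding same_sign_def by (metis less_irrefl linorder_neqE_linordered_idom)

lemma same_sign_zero: "same_sign 0 0"
  by (simp add: same_sign_def)

lemma same_sign_sym: "same_sign x y \<Longrightarrow> same_sign y x"
  by (simp add: same_sign_def)

lemma same_sign_trans: "same_sign x y \<Longrightarrow> same_sign y z \<Longrightarrow> same_sign x z"
  by (simp add: same_sign_def)

lemma same_sign_mult: "same_sign x y \<Longrightarrow> same_sign x' y' \<Longrightarrow> same_sign (x * x') (y * y')"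
  by (auto simp: same_sign_def zero_less_mult_iff mult_less_0_iff)

lemma same_sign_mult_cancel: "same_sign c c' \<Longrightarrow> c \<noteq> 0 \<Longrightarrow> same_sign (c * x) (c' * y) \<Longrightarrow> same_sign x y"
  unfolding same_sign_def zero_less_mult_iff mult_less_0_iff by (metis linorder_neqE_linordered_idom order_less_asym)

lemma same_sign_power: "same_sign x y \<Longrightarrow> same_sign (x ^ n) (y ^ n)"
proof (induction n)
  case 0
  show ?case by (simp add: same_sign_def)
next
  case (Suc n)
  then show ?case using same_sign_mult by simp
qed

lemma sign_in_gap:
  fixes p :: "'a::real_closed_field poly"
  assumes y: "l < y" "y < u" and noroot: "\<And>z. l < z \<Longrightarrow> z < u \<Longrightarrow> poly p z \<noteq> 0"
  shows "poly p l \<noteq> 0 \<Longrightarrow> same_sign (poly p l) (poly p y)"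
    and "poly p u \<noteq> 0 \<Longrightarrow> same_sign (poly p u) (poly p y)"
proof -
  have *: "same_sign s (poly p y)" if "\<not> s * poly p y < 0" "s \<noteq> 0" for s
    using that noroot[OF y] by (auto simp: same_sign_def mult_less_0_iff not_less)
  show "same_sign (poly p l) (poly p y)" if "poly p l \<noteq> 0"
    using * that poly_sign_change_root[OF y(1), of p] noroot y(2) by force
  show "same_sign (poly p u) (poly p y)" if "poly p u \<noteq> 0"
    using * that poly_sign_change_root[OF y(2), of p] noroot y(1) by (force simp: mult.commute)
qed

text \<open>The positive lower bound \<open>e\<close> is carried along to make Horner's recursion
  work: once \<open>x\<close> is at least \<open>1 + \<bar>a\<bar> / e\<close>, the product of
  \<open>x\<close> with a value at least \<open>e\<close> exceeds the next constant term by
  \<open>e\<close>.\<close>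

lemma poly_pos_at_top:
  fixes p :: "'a::linordered_field poly"
  assumes "0 < lead_coeff p"
  shows "\<exists>M e. 0 < e \<and> (\<forall>x\<ge>M. e \<le> poly p x)"
  using assms
proof (induction p)
  case (pCons a p)
  show ?case
  proof (cases "p = 0")
    case True
    then show ?thesis using pCons by (auto intro!: exI[of _ a])
  next
    case False
    then obtain M e where e: "0 < e" "\<And>x. x \<ge> M \<Longrightarrow> e \<le> poly p x"
      using pCons by auto
    have "e \<le> poly (pCons a p) x" if x: "x \<ge> max M (1 + \<bar>a\<bar> / e)" for x
    proof -
      have x0: "0 \<le> 1 + \<bar>a\<bar> / e" "0 \<le> x" using x e(1) order_trans[of 0 "1 + \<bar>a\<bar> / e" x] by auto
      have "e + \<bar>a\<bar> = (1 + \<bar>a\<bar> / e) * e" using e(1) by (simp add: field_simps)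
      also have "\<dots> \<le> x * poly p x"
        using x e x0 by (intro mult_mono) (auto intro: order_trans[OF less_imp_le])
      finally show ?thesis using abs_ge_minus_self[of a] unfolding poly_pCons by linarith
    qed
    then show ?thesis using e(1) by blast
  qed
qed simp

lemma poly_sign_at_top:
  fixes p :: "'a::linordered_field poly"
  shows "\<exists>M. \<forall>x\<ge>M. same_sign (lead_coeff p) (poly p x)"
proof -
  consider "p = 0" | "0 < lead_coeff p" | "0 < lead_coeff (- p)"
    using linorder_less_linear[of 0 "lead_coeff p"] by auto
  then show ?thesis
  proof cases
    case 2
    then obtain M e where "0 < e" "\<forall>x\<ge>M. e \<le> poly p x" using poly_pos_at_top by blast
    then show ?thesis using 2 by (intro exI[of _ M]) (fastforce simp: same_sign_def)
  next
    case 3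
    then obtain M e where "0 < e" "\<forall>x\<ge>M. e \<le> poly (- p) x" using poly_pos_at_top by blast
    then show ?thesis using 3 by (intro exI[of _ M]) (fastforce simp: same_sign_def)
  qed (auto simp: same_sign_def)
qed

lemma poly_sign_at_bot:
  fixes p :: "'a::linordered_field poly"
  shows "\<exists>M. \<forall>x\<le>M. same_sign ((- 1) ^ degree p * lead_coeff p) (poly p x)"
proof -
  obtain M where M: "\<And>x. x \<ge> M \<Longrightarrow> same_sign (lead_coeff (p \<circ>\<^sub>p [:0, -1:])) (poly (p \<circ>\<^sub>p [:0, -1:]) x)"
    using poly_sign_at_top by blast
  have "lead_coeff (p \<circ>\<^sub>p [:0, -1:]) = (- 1) ^ degree p * lead_coeff p"
    by (subst lead_coeff_comp) auto
  then have "same_sign ((- 1) ^ degree p * lead_coeff p) (poly p x)" if "x \<le> - M" for x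
    using M[of "- x"] that by (simp add: poly_pcompose)
  then show ?thesis by blast
qed

lemma neighbours_ex:
  fixes Z :: "'a::linorder set"
  assumes "finite Z" "lo \<in> Z" "hi \<in> Z" "lo < z" "z < hi" "z \<notin> Z"
  obtains l u where "l \<in> Z" "u \<in> Z" "l < z" "z < u" "\<forall>w\<in>Z. w \<le> l \<or> u \<le> w"
proof
  let ?L = "{w \<in> Z. w < z}" and ?U = "{w \<in> Z. z < w}"
  have fin: "finite ?L" "finite ?U" and ne: "?L \<noteq> {}" "?U \<noteq> {}" using assms by auto
  show "Max ?L \<in> Z" "Min ?U \<in> Z" "Max ?L < z" "z < Min ?U"
    using Max_in[OF fin(1) ne(1)] Min_in[OF fin(2) ne(2)] by auto
  have "w \<le> Max ?L \<or> Min ?U \<le> w" if "w \<in> Z" for w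
  proof (cases "w < z")
    case True
    then show ?thesis using that fin by (auto intro: Max_ge)
  next
    case False
    then have "z < w" using that assms(6) by (metis linorder_neqE)
    then show ?thesis using that fin by (auto intro: Min_le)
  qed
  then show "\<forall>w\<in>Z. w \<le> Max ?L \<or> Min ?U \<le> w" by blast
qed

section \<open>Order-preserving matching of the roots of two parallel families\<close>

lemma poly_nonzero_const: "degree p = 0 \<Longrightarrow> p \<noteq> 0 \<Longrightarrow> poly p z \<noteq> 0"
  by (auto elim: degree_eq_zeroE)

text \<open>One index stands for two specialisations of the same polynomial. The factors
  \<open>c\<close>, \<open>c'\<close> in \<open>remainder\<close> are there because division without
  inverting leading coefficients first multiplies the dividend; since they are nonzero and agree in
  sign, they can be cancelled when signs are compared.\<close>

locale parallel_families =
  fixes I :: "'i set"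
    and p :: "'i \<Rightarrow> 'a::real_closed_field poly" and q :: "'i \<Rightarrow> 'b::real_closed_field poly"
  assumes fin: "finite I"
    and deg: "\<And>i. i \<in> I \<Longrightarrow> degree (q i) = degree (p i)"
    and lead: "\<And>i. i \<in> I \<Longrightarrow> same_sign (lead_coeff (p i)) (lead_coeff (q i))"
    and deriv: "\<And>i. i \<in> I \<Longrightarrow> 0 < degree (p i) \<Longrightarrow>
      \<exists>j\<in>I. p j = pderiv (p i) \<and> q j = pderiv (q i)"
    and remainder: "\<And>i l. i \<in> I \<Longrightarrow> l \<in> I \<Longrightarrow> 0 < degree (p l) \<Longrightarrow> degree (p l) \<le> degree (p i) \<Longrightarrow>
      \<exists>j\<in>I. degree (p j) < degree (p l) \<and> (\<exists>c c' Q Q'. same_sign c c' \<and> c \<noteq> 0 \<and>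
         smult c (p i) = Q * p l + p j \<and> smult c' (q i) = Q' * q l + q j)"
begin

definition same_signs_on :: "'i set \<Rightarrow> 'a \<Rightarrow> 'b \<Rightarrow> bool" where
  "same_signs_on S z z' \<longleftrightarrow> (\<forall>i\<in>S. same_sign (poly (p i) z) (poly (q i) z'))"

text \<open>The points of \<open>Z\<close> other than the sentinels \<open>lo\<close>, \<open>hi\<close> are exactly the roots of the nonzero \<open>p i\<close> with
  \<open>i \<in> S\<close>, which suffices to control the signs of every \<open>p i\<close> there through remainders.\<close>

definition partial_match :: "'a \<Rightarrow> 'a \<Rightarrow> 'b \<Rightarrow> 'b \<Rightarrow> 'i set \<Rightarrow> 'a set \<Rightarrow> ('a \<Rightarrow> 'b) \<Rightarrow> bool" where
  "partial_match lo hi lo' hi' S Z h \<longleftrightarrow> finite Z \<and> lo \<in> Z \<and> hi \<in> Z \<and> h lo = lo' \<and> h hi = hi' \<and> strict_mono_on Z h \<and>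
     (\<forall>z\<in>Z. same_signs_on S z (h z)) \<and>
     (\<forall>z\<in>Z - {lo, hi}. \<exists>l\<in>S. p l \<noteq> 0 \<and> poly (p l) z = 0) \<and>
     (\<forall>i\<in>S. p i \<noteq> 0 \<longrightarrow> (\<forall>z. poly (p i) z = 0 \<longrightarrow> z \<in> Z) \<and> (\<forall>z'. poly (q i) z' = 0 \<longrightarrow> z' \<in> h ` Z))"

lemma zero_iff: "i \<in> I \<Longrightarrow> p i = 0 \<longleftrightarrow> q i = 0"
  using same_sign_zero_iff[OF lead] by simp

lemma same_sign_const:
  assumes "i \<in> I" "degree (p i) = 0"
  shows "same_sign (poly (p i) z) (poly (q i) z')"
proof -
  obtain a b where "p i = [:a:]" "q i = [:b:]"
    using assms deg degree_eq_zeroE by metis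
  then show ?thesis using lead[OF assms(1)] by simp
qed

text \<open>At roots of the divisors \<open>p l\<close> and \<open>q l\<close>, the dividends equal
  their remainders up to the factors \<open>c\<close>, \<open>c'\<close>, and the remainders have
  degree below that of \<open>p l\<close>, where signs are already known to agree.\<close>

lemma same_sign_at_root:
  assumes "i \<in> I" "l \<in> I" "p l \<noteq> 0" "poly (p l) z = 0" "poly (q l) z' = 0" "degree (p l) \<le> degree (p i)"
    and lower: "\<And>j. j \<in> I \<Longrightarrow> degree (p j) < degree (p l) \<Longrightarrow> same_sign (poly (p j) z) (poly (q j) z')"
  shows "same_sign (poly (p i) z) (poly (q i) z')"
proof -
  have "0 < degree (p l)"
    using assms(3,4) poly_nonzero_const by blast
  then obtain j c c' Q Q' where j: "j \<in> I" "degree (p j) < degree (p l)" "same_sign c c'" "c \<noteq> 0"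
    and eq: "smult c (p i) = Q * p l + p j" "smult c' (q i) = Q' * q l + q j"
    using remainder[OF assms(1,2) _ assms(6)] by metis
  have "c * poly (p i) z = poly (p j) z" "c' * poly (q i) z' = poly (q j) z'"
    using arg_cong[OF eq(1), of "\<lambda>f. poly f z"] arg_cong[OF eq(2), of "\<lambda>f. poly f z'"] assms(4,5) by simp_all
  then show ?thesis
    using lower[OF j(1,2)] same_sign_mult_cancel[OF j(3,4), of "poly (p i) z" "poly (q i) z'"] by simp
qed

text \<open>Between two neighbouring points of \<open>Z\<close> a polynomial whose derivative is already processed has
  at most one root, and it has one iff it changes sign between them.\<close>

lemma gap_image:
  fixes Z :: "'a set" and h :: "'a \<Rightarrow> 'b"
  assumes mono: "strict_mono_on Z h" and lu: "l \<in> Z" "u \<in> Z" "\<And>w. w \<in> Z \<Longrightarrow> w \<le> l \<or> u \<le> w"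
    and z': "h l < z'" "z' < h u"
  shows "z' \<notin> h ` Z"
proof
  assume "z' \<in> h ` Z"
  then obtain w where w: "w \<in> Z" "z' = h w" by blast
  have "w \<le> l \<or> u \<le> w" using lu(3) w by blast
  then have "h w \<le> h l \<or> h u \<le> h w" using mono lu w
    by (metis strict_mono_on_leD)
  then show False using z' w by auto
qed

text \<open>All roots of \<open>p i\<close> lie in \<open>Z\<close>, so its sign in the gap is its
  sign at any end where it does not vanish. It cannot vanish at both ends: Rolle would put a root of
  its derivative, which also belongs to \<open>S\<close>, inside the gap.\<close>

lemma same_sign_in_gap:
  assumes S: "S \<subseteq> I" "i \<in> S"
    and closed: "\<And>j. j \<in> I \<Longrightarrow> degree (p j) < degree (p i) \<Longrightarrow> j \<in> S"
    and m: "partial_match lo hi lo' hi' S Z h"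
    and lu: "l \<in> Z" "u \<in> Z" "\<And>w. w \<in> Z \<Longrightarrow> w \<le> l \<or> u \<le> w"
    and y: "l < y" "y < u" and y': "h l < y'" "y' < h u"
  shows "same_sign (poly (p i) y) (poly (q i) y')"
proof (cases "degree (p i) = 0")
  case True
  then show ?thesis using same_sign_const S by blast
next
  case False
  have i: "i \<in> I" "p i \<noteq> 0" "degree (p i) > 0" using S False by auto
  have mono: "strict_mono_on Z h" using m by (simp add: partial_match_def)
  have notin: "z \<notin> Z" if "l < z" "z < u" for z using lu(3)[of z] that by auto
  have notin': "z' \<notin> h ` Z" if "h l < z'" "z' < h u" for z'
    using gap_image[OF mono lu that] .
  have complete: "\<forall>j\<in>S. p j \<noteq> 0 \<longrightarrow> (\<forall>z. poly (p j) z = 0 \<longrightarrow> z \<in> Z) \<and> (\<forall>z'. poly (q j) z' = 0 \<longrightarrow> z' \<in> h ` Z)"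
    using m by (simp add: partial_match_def)
  have roots: "poly (p j) z \<noteq> 0" if "j \<in> S" "p j \<noteq> 0" "l < z" "z < u" for j z
    using complete that notin[of z] by blast
  have roots': "poly (q j) z \<noteq> 0" if "j \<in> S" "p j \<noteq> 0" "h l < z" "z < h u" for j z
    using complete that notin'[of z] by blast
  have ends: "same_sign (poly (p i) l) (poly (q i) (h l))" "same_sign (poly (p i) u) (poly (q i) (h u))"
    using m lu S by (auto simp: partial_match_def same_signs_on_def)
  have "poly (p i) l \<noteq> 0 \<or> poly (p i) u \<noteq> 0"
  proof (rule ccontr)
    assume "\<not> ?thesis"
    then obtain c where c: "l < c" "c < u" "poly (pderiv (p i)) c = 0"
      using poly_rolle[of l u "p i"] y by auto
    obtain j where "j \<in> I" "p j = pderiv (p i)" using deriv i by blast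
    moreover then have "j \<in> S" "p j \<noteq> 0" using closed i by (auto simp: degree_pderiv pderiv_eq_0_iff)
    ultimately show False using roots[of j c] c by simp
  qed
  then show ?thesis
  proof
    assume "poly (p i) l \<noteq> 0"
    moreover then have "poly (q i) (h l) \<noteq> 0" using same_sign_zero_iff[OF ends(1)] by simp
    ultimately have s: "same_sign (poly (p i) l) (poly (p i) y)" "same_sign (poly (q i) (h l)) (poly (q i) y')"
      using sign_in_gap(1)[OF y roots[OF S(2) i(2)]] sign_in_gap(1)[OF y' roots'[OF S(2) i(2)]] by simp_all
    show ?thesis
      by (rule same_sign_trans[OF same_sign_sym[OF s(1)] same_sign_trans[OF ends(1) s(2)]])
  next
    assume "poly (p i) u \<noteq> 0"
    moreover then have "poly (q i) (h u) \<noteq> 0" using same_sign_zero_iff[OF ends(2)] by simp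
    ultimately have s: "same_sign (poly (p i) u) (poly (p i) y)" "same_sign (poly (q i) (h u)) (poly (q i) y')"
      using sign_in_gap(2)[OF y roots[OF S(2) i(2)]] sign_in_gap(2)[OF y' roots'[OF S(2) i(2)]] by simp_all
    show ?thesis
      by (rule same_sign_trans[OF same_sign_sym[OF s(1)] same_sign_trans[OF ends(2) s(2)]])
  qed
qed

lemma gap_roots_match:
  assumes S: "S \<subseteq> I" "i \<in> I" "0 < degree (p i)"
    and closed: "\<And>j. j \<in> I \<Longrightarrow> degree (p j) < degree (p i) \<Longrightarrow> j \<in> S"
    and m: "partial_match lo hi lo' hi' S Z h"
    and lu: "l \<in> Z" "u \<in> Z" "\<And>w. w \<in> Z \<Longrightarrow> w \<le> l \<or> u \<le> w" "l < u"
    and signs: "\<And>z. z \<in> Z \<Longrightarrow> same_sign (poly (p i) z) (poly (q i) (h z))"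
  shows "(\<exists>z. l < z \<and> z < u \<and> poly (p i) z = 0) \<longleftrightarrow> (\<exists>z'. h l < z' \<and> z' < h u \<and> poly (q i) z' = 0)"
    and "h l < z\<^sub>1 \<Longrightarrow> z\<^sub>1 < z\<^sub>2 \<Longrightarrow> z\<^sub>2 < h u \<Longrightarrow> poly (q i) z\<^sub>1 = 0 \<Longrightarrow> poly (q i) z\<^sub>2 \<noteq> 0"
    and "l < x\<^sub>1 \<Longrightarrow> x\<^sub>1 < x\<^sub>2 \<Longrightarrow> x\<^sub>2 < u \<Longrightarrow> poly (p i) x\<^sub>1 = 0 \<Longrightarrow> poly (p i) x\<^sub>2 \<noteq> 0"
proof -
  have mono: "strict_mono_on Z h" using m by (simp add: partial_match_def)
  then have hlu: "h l < h u" using lu by (auto simp: strict_mono_on_def)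
  obtain j where j: "j \<in> I" "p j = pderiv (p i)" "q j = pderiv (q i)" using deriv S by blast
  then have jS: "j \<in> S" "p j \<noteq> 0" using closed S by (auto simp: degree_pderiv pderiv_eq_0_iff)
  have complete: "\<forall>z. poly (p j) z = 0 \<longrightarrow> z \<in> Z" "\<forall>z'. poly (q j) z' = 0 \<longrightarrow> z' \<in> h ` Z"
    using m jS by (simp_all add: partial_match_def)
  have der: "poly (pderiv (p i)) z \<noteq> 0" if "l < z" "z < u" for z
    using complete(1) lu(3)[of z] that j(2) by force
  have der': "poly (pderiv (q i)) z \<noteq> 0" if "h l < z" "z < h u" for z
    using complete(2) gap_image[OF mono lu(1-3) that] j(3) by force
  have "same_sign (poly (p i) l * poly (p i) u) (poly (q i) (h l) * poly (q i) (h u))"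
    using signs lu by (intro same_sign_mult) auto
  then show "(\<exists>z. l < z \<and> z < u \<and> poly (p i) z = 0) \<longleftrightarrow> (\<exists>z'. h l < z' \<and> z' < h u \<and> poly (q i) z' = 0)"
    using root_in_gap_iff[OF lu(4) der] root_in_gap_iff[OF hlu der'] by (simp add: same_sign_def)
  show "h l < z\<^sub>1 \<Longrightarrow> z\<^sub>1 < z\<^sub>2 \<Longrightarrow> z\<^sub>2 < h u \<Longrightarrow> poly (q i) z\<^sub>1 = 0 \<Longrightarrow> poly (q i) z\<^sub>2 \<noteq> 0"
    using poly_rolle[of z\<^sub>1 z\<^sub>2 "q i"] der' by (meson order.strict_trans)
  show "l < x\<^sub>1 \<Longrightarrow> x\<^sub>1 < x\<^sub>2 \<Longrightarrow> x\<^sub>2 < u \<Longrightarrow> poly (p i) x\<^sub>1 = 0 \<Longrightarrow> poly (p i) x\<^sub>2 \<noteq> 0"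
    using poly_rolle[of x\<^sub>1 x\<^sub>2 "p i"] der by (meson order.strict_trans)
qed

text \<open>Members are added in order of nondecreasing degree, so the derivative of
  \<open>p i\<close> and its remainders modulo members of \<open>S\<close> are already present.
  Remainders give the signs at the old points, the derivative separates the new roots, and each new
  root is sent to the root of \<open>q i\<close> in the corresponding gap.\<close>

lemma extend_match:
  assumes S: "S \<subseteq> I" "i \<in> I" "i \<notin> S"
    and closed: "\<And>j. j \<in> I \<Longrightarrow> degree (p j) < degree (p i) \<Longrightarrow> j \<in> S"
    and top: "\<And>j. j \<in> S \<Longrightarrow> degree (p j) \<le> degree (p i)"
    and closedS: "\<And>j k. k \<in> S \<Longrightarrow> j \<in> I \<Longrightarrow> degree (p j) < degree (p k) \<Longrightarrow> j \<in> S"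
    and m: "partial_match lo hi lo' hi' S Z h"
    and bounds: "\<And>z. p i \<noteq> 0 \<Longrightarrow> poly (p i) z = 0 \<Longrightarrow> lo < z \<and> z < hi"
      "\<And>z. p i \<noteq> 0 \<Longrightarrow> poly (q i) z = 0 \<Longrightarrow> lo' < z \<and> z < hi'"
    and ends: "same_signs_on I lo lo'" "same_signs_on I hi hi'"
  shows "\<exists>Z' h'. partial_match lo hi lo' hi' (insert i S) Z' h'"
proof (cases "degree (p i) = 0")
  case True
  then have "poly (p i) z \<noteq> 0" "poly (q i) z' \<noteq> 0" if "p i \<noteq> 0" for z z'
    using S(2) deg zero_iff that True by (simp_all add: poly_nonzero_const)
  then have "partial_match lo hi lo' hi' (insert i S) Z h"
    using m same_sign_const[OF S(2) True] by (auto simp: partial_match_def same_signs_on_def)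
  then show ?thesis by blast
next
  case False
  then have pos: "0 < degree (p i)" and "p i \<noteq> 0" by auto
  then have nz: "p i \<noteq> 0" "q i \<noteq> 0" using zero_iff[OF S(2)] by auto
  have Z: "finite Z" "lo \<in> Z" "hi \<in> Z" "h lo = lo'" "h hi = hi'" and mono: "strict_mono_on Z h"
    and sgZ: "\<And>z. z \<in> Z \<Longrightarrow> same_signs_on S z (h z)"
    and rootZ: "\<And>z. z \<in> Z - {lo, hi} \<Longrightarrow> \<exists>l\<in>S. p l \<noteq> 0 \<and> poly (p l) z = 0"
    using m by (simp_all add: partial_match_def)
  have hle: "h v \<le> h w \<longleftrightarrow> v \<le> w" "h v < h w \<longleftrightarrow> v < w" if "v \<in> Z" "w \<in> Z" for v w
    using mono that by (simp_all add: strict_mono_on_less_eq strict_mono_on_less)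
  have signs: "same_sign (poly (p i) z) (poly (q i) (h z))" if "z \<in> Z" for z
  proof (cases "z = lo \<or> z = hi")
    case True
    then show ?thesis using ends Z S by (auto simp: same_signs_on_def)
  next
    case False
    then obtain l where l: "l \<in> S" "p l \<noteq> 0" "poly (p l) z = 0" using rootZ \<open>z \<in> Z\<close> by blast
    have l': "l \<in> I" using l(1) S(1) by blast
    have "same_sign (poly (p l) z) (poly (q l) (h z))"
      using sgZ[OF \<open>z \<in> Z\<close>] l(1) by (simp add: same_signs_on_def)
    from same_sign_zero_iff[OF this] have ql: "poly (q l) (h z) = 0" using l(3) by simp
    have lower: "same_sign (poly (p j) z) (poly (q j) (h z))" if "j \<in> I" "degree (p j) < degree (p l)" for j
      using sgZ[OF \<open>z \<in> Z\<close>] closedS[OF l(1) that] by (simp add: same_signs_on_def)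
    show ?thesis
      by (rule same_sign_at_root[OF S(2) l' l(2,3) ql top[OF l(1)] lower])
  qed
  define N where "N = {z. poly (p i) z = 0} - Z"
  have bracket: "\<exists>l\<in>Z. \<exists>u\<in>Z. l < z \<and> z < u \<and> (\<forall>w\<in>Z. w \<le> l \<or> u \<le> w)" if "z \<in> N" for z
  proof -
    have z: "lo < z" "z < hi" "z \<notin> Z" using that bounds(1)[OF nz(1)] by (auto simp: N_def)
    from neighbours_ex[OF Z(1-3) z] obtain l u
      where "l \<in> Z" "u \<in> Z" "l < z" "z < u" "\<forall>w\<in>Z. w \<le> l \<or> u \<le> w" .
    then show ?thesis by (intro bexI[of _ l] bexI[of _ u]) auto
  qed
  have bracket': "\<exists>l\<in>Z. \<exists>u\<in>Z. h l < z' \<and> z' < h u \<and> (\<forall>w\<in>Z. w \<le> l \<or> u \<le> w)"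
    if z': "poly (q i) z' = 0" "z' \<notin> h ` Z" for z'
  proof -
    have "finite (h ` Z)" "h lo \<in> h ` Z" "h hi \<in> h ` Z" "h lo < z'" "z' < h hi"
      using Z bounds(2) nz z' by auto
    from neighbours_ex[OF this z'(2)] obtain l' u' where
      lu': "l' \<in> h ` Z" "u' \<in> h ` Z" "l' < z'" "z' < u'" "\<forall>w\<in>h ` Z. w \<le> l' \<or> u' \<le> w" .
    then obtain l u where lu: "l' = h l" "u' = h u" "l \<in> Z" "u \<in> Z" by auto
    have "w \<le> l \<or> u \<le> w" if "w \<in> Z" for w
      using bspec[OF lu'(5), of "h w"] that lu hle(1) by auto
    then show ?thesis using lu' lu by (intro bexI[of _ l] bexI[of _ u]) auto
  qed
  \<comment> \<open>Position is recorded against all of \<open>Z\<close> and not against a chosen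
    pair of neighbours, so that monotonicity between old and new points is immediate.\<close>
  define gap where "gap z z' \<longleftrightarrow> poly (q i) z' = 0 \<and> (\<forall>w\<in>Z. (w < z \<longrightarrow> h w < z') \<and> (z < w \<longrightarrow> z' < h w))" for z z'
  have gap_ex: "\<exists>z'. gap z z'" if z: "z \<in> N" for z
  proof -
    obtain l u where lu: "l \<in> Z" "u \<in> Z" "l < z" "z < u" "\<And>w. w \<in> Z \<Longrightarrow> w \<le> l \<or> u \<le> w"
      using bracket[OF z] by blast
    have "poly (p i) z = 0" using z by (simp add: N_def)
    then obtain z' where z': "h l < z'" "z' < h u" "poly (q i) z' = 0"
      using gap_roots_match(1)[OF S(1,2) pos closed m lu(1,2,5) _ signs] lu(3,4) by force
    have "(w < z \<longrightarrow> h w < z') \<and> (z < w \<longrightarrow> z' < h w)" if "w \<in> Z" for w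
    proof (cases "w \<le> l")
      case True
      then have "h w \<le> h l" using hle(1)[OF that lu(1)] by simp
      then show ?thesis using True lu(3) z'(1) by auto
    next
      case False
      then have "u \<le> w" using lu(5)[OF that] by simp
      then have "h u \<le> h w" using hle(1)[OF lu(2) that] by simp
      then show ?thesis using \<open>u \<le> w\<close> lu(4) z'(2) by auto
    qed
    then show ?thesis using z'(3) unfolding gap_def by blast
  qed
  define h' where "h' z = (if z \<in> Z then h z else SOME z'. gap z z')" for z
  have h'Z: "h' z = h z" if "z \<in> Z" for z using that by (simp add: h'_def)
  have h'N: "gap z (h' z)" if "z \<in> N" for z
    using that someI_ex[OF gap_ex[OF that]] by (simp add: h'_def N_def)
  have mono': "strict_mono_on (Z \<union> N) h'"
  proof (rule strict_mono_onI)
    fix v w assume vw: "v \<in> Z \<union> N" "w \<in> Z \<union> N" "v < w"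
    consider "v \<in> Z" "w \<in> Z" | "v \<in> N" "w \<in> Z" | "v \<in> Z" "w \<in> N" | "v \<in> N" "w \<in> N" using vw by blast
    then show "h' v < h' w"
    proof cases
      case 1
      then show ?thesis using vw hle h'Z by simp
    next
      case 2
      then show ?thesis using vw h'N[of v] h'Z by (simp add: gap_def)
    next
      case 3
      then show ?thesis using vw h'N[of w] h'Z by (simp add: gap_def)
    next
      case 4
      obtain l u where lu: "l \<in> Z" "u \<in> Z" "l < v" "v < u" "\<And>w. w \<in> Z \<Longrightarrow> w \<le> l \<or> u \<le> w"
        using bracket[OF 4(1)] by blast
      have roots: "poly (p i) v = 0" "poly (p i) w = 0" "w \<notin> Z" using 4 by (simp_all add: N_def)
      \<comment> \<open>Two roots of \<open>p i\<close> cannot lie in one gap, so the point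
        \<open>u\<close> of \<open>Z\<close> separates \<open>v\<close> from \<open>w\<close>, and
        \<open>h u\<close> separates their images.\<close>
      have "\<not> w < u"
        using gap_roots_match(3)[OF S(1,2) pos closed m lu(1,2,5) _ signs lu(3) vw(3)] roots lu(3,4) by force
      then have "u < w" using lu(2) roots(3) by (metis linorder_neqE)
      then show ?thesis using h'N[OF 4(1)] h'N[OF 4(2)] lu by (force simp: gap_def)
    qed
  qed
  have signsN: "same_signs_on (insert i S) z (h' z)" if z: "z \<in> N" for z
    unfolding same_signs_on_def
  proof
    fix k assume "k \<in> insert i S"
    then consider "k = i" | "k \<in> S" by blast
    then show "same_sign (poly (p k) z) (poly (q k) (h' z))"
    proof cases
      case 1
      then show ?thesis using z h'N[OF z] by (simp add: N_def gap_def same_sign_def)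
    next
      case 2
      obtain l u where lu: "l \<in> Z" "u \<in> Z" "l < z" "z < u" "\<And>w. w \<in> Z \<Longrightarrow> w \<le> l \<or> u \<le> w"
        using bracket[OF z] by blast
      show ?thesis
        by (rule same_sign_in_gap[OF S(1) 2 closedS[OF 2] m lu(1,2,5) lu(3,4)])
          (use h'N[OF z] lu in \<open>auto simp: gap_def\<close>)
    qed
  qed
  have onto: "z' \<in> h' ` (Z \<union> N)" if z': "poly (q i) z' = 0" for z'
  proof (cases "z' \<in> h ` Z")
    case True
    then show ?thesis using h'Z by force
  next
    case False
    then obtain l u where lu: "l \<in> Z" "u \<in> Z" "h l < z'" "z' < h u" "\<And>w. w \<in> Z \<Longrightarrow> w \<le> l \<or> u \<le> w"
      using bracket'[OF z'] by blast
    then have "l < u" using hle(2) by (meson order.strict_trans)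
    then obtain z where z: "l < z" "z < u" "poly (p i) z = 0"
      using gap_roots_match(1)[OF S(1,2) pos closed m lu(1,2,5) _ signs] lu(3,4) z' by blast
    then have "z \<in> N" using lu(5)[of z] by (auto simp: N_def)
    then have h'z: "h l < h' z" "h' z < h u" "poly (q i) (h' z) = 0"
      using h'N z lu by (auto simp: gap_def)
    have "h' z = z'"
      using gap_roots_match(2)[OF S(1,2) pos closed m lu(1,2,5) \<open>l < u\<close> signs, of "h' z" z']
        gap_roots_match(2)[OF S(1,2) pos closed m lu(1,2,5) \<open>l < u\<close> signs, of z' "h' z"] h'z lu(3,4) z'
      by (metis linorder_neqE)
    then show ?thesis using \<open>z \<in> N\<close> by blast
  qed
  have "finite N" using poly_roots_finite[OF nz(1)] by (simp add: N_def)
  moreover have "same_signs_on (insert i S) z (h' z)" if "z \<in> Z \<union> N" for z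
    using that signsN h'Z sgZ signs by (auto simp: same_signs_on_def)
  moreover have "\<exists>l\<in>insert i S. p l \<noteq> 0 \<and> poly (p l) z = 0" if "z \<in> (Z \<union> N) - {lo, hi}" for z
    using that rootZ nz by (auto simp: N_def)
  moreover have "z' \<in> h' ` (Z \<union> N)" if "k \<in> S" "p k \<noteq> 0" "poly (q k) z' = 0" for k z'
  proof -
    have "z' \<in> h ` Z" using m that by (simp add: partial_match_def)
    then show ?thesis using h'Z by force
  qed
  moreover have "z \<in> Z" if "k \<in> S" "p k \<noteq> 0" "poly (p k) z = 0" for k z
    using m that by (simp add: partial_match_def)
  ultimately have "partial_match lo hi lo' hi' (insert i S) (Z \<union> N) h'"
    using Z h'Z mono' onto unfolding partial_match_def
    by (intro conjI ballI allI impI) (auto simp: N_def)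
  then show ?thesis by blast
qed

text \<open>Induction needs \<open>S\<close> to contain every member of smaller degree than one of
  its own; discarding a member of largest degree preserves this.\<close>

lemma match_ex:
  assumes "S \<subseteq> I" "\<And>j k. k \<in> S \<Longrightarrow> j \<in> I \<Longrightarrow> degree (p j) < degree (p k) \<Longrightarrow> j \<in> S"
    and "lo < hi" "lo' < hi'"
    and bounds: "\<And>i z. i \<in> I \<Longrightarrow> p i \<noteq> 0 \<Longrightarrow> poly (p i) z = 0 \<Longrightarrow> lo < z \<and> z < hi"
      "\<And>i z. i \<in> I \<Longrightarrow> p i \<noteq> 0 \<Longrightarrow> poly (q i) z = 0 \<Longrightarrow> lo' < z \<and> z < hi'"
    and ends: "same_signs_on I lo lo'" "same_signs_on I hi hi'"
  shows "\<exists>Z h. partial_match lo hi lo' hi' S Z h"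
  using assms(1,2)
proof (induction "card S" arbitrary: S)
  case 0
  then have "S = {}" using fin by (metis card_0_eq finite_subset)
  then have "partial_match lo hi lo' hi' S {lo, hi} (\<lambda>z. if z = lo then lo' else hi')"
    using \<open>lo < hi\<close> \<open>lo' < hi'\<close> by (auto simp: partial_match_def same_signs_on_def strict_mono_on_def)
  then show ?case by blast
next
  case (Suc n)
  have finS: "finite S" "S \<noteq> {}" using Suc fin by (auto intro: finite_subset)
  obtain i where i: "i \<in> S" "\<And>j. j \<in> S \<Longrightarrow> degree (p j) \<le> degree (p i)"
  proof -
    have "Max ((\<lambda>j. degree (p j)) ` S) \<in> (\<lambda>j. degree (p j)) ` S" using finS by simp
    then obtain i where "i \<in> S" "degree (p i) = Max ((\<lambda>j. degree (p j)) ` S)" by force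
    then show ?thesis using that finS by simp
  qed
  have S: "S = insert i (S - {i})" using i by blast
  have dc: "j \<in> S - {i}" if "k \<in> S - {i}" "j \<in> I" "degree (p j) < degree (p k)" for j k
    using Suc.prems(2)[of k j] that i(2)[of k] by auto
  have "card (S - {i}) = n" using Suc i finS by simp
  moreover have "S - {i} \<subseteq> I" using Suc.prems(1) by blast
  ultimately obtain Z h where m: "partial_match lo hi lo' hi' (S - {i}) Z h"
    using Suc.hyps(1)[of "S - {i}"] dc by blast
  have iI: "i \<in> I" using i Suc.prems by blast
  have cl: "j \<in> S - {i}" if "j \<in> I" "degree (p j) < degree (p i)" for j
    using Suc.prems(2)[OF i(1) that] that(2) by auto
  have "\<exists>Z' h'. partial_match lo hi lo' hi' (insert i (S - {i})) Z' h'"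
  proof (rule extend_match[OF \<open>S - {i} \<subseteq> I\<close> iI _ _ _ _ m _ _ ends])
    show "j \<in> S - {i}" if "j \<in> I" "degree (p j) < degree (p i)" for j
      using cl[OF that] .
    show "degree (p j) \<le> degree (p i)" if "j \<in> S - {i}" for j
      using i(2) that by simp
    show "j \<in> S - {i}" if "k \<in> S - {i}" "j \<in> I" "degree (p j) < degree (p k)" for j k
      using dc[OF that] .
    show "lo < z \<and> z < hi" if "p i \<noteq> 0" "poly (p i) z = 0" for z
      using bounds(1)[OF iI that] .
    show "lo' < z \<and> z < hi'" if "p i \<noteq> 0" "poly (q i) z = 0" for z
      using bounds(2)[OF iI that] .
  qed simp
  then show ?case using S by simp
qed

text \<open>The sentinels lie beyond all roots, where signs are determined by leading coefficients
  and parity of degrees. If \<open>y\<close> is a matched point its image serves as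
  \<open>y'\<close>; otherwise any point of the corresponding gap does.\<close>

theorem same_signs_transfer: "\<exists>y'. same_signs_on I y y'"
proof -
  define T where "T i = (SOME M. \<forall>x\<ge>M. same_sign (lead_coeff (p i)) (poly (p i) x))" for i
  define T' where "T' i = (SOME M. \<forall>x\<ge>M. same_sign (lead_coeff (q i)) (poly (q i) x))" for i
  define B where "B i = (SOME M. \<forall>x\<le>M. same_sign ((- 1) ^ degree (p i) * lead_coeff (p i)) (poly (p i) x))" for i
  define B' where "B' i = (SOME M. \<forall>x\<le>M. same_sign ((- 1) ^ degree (q i) * lead_coeff (q i)) (poly (q i) x))" for i
  have T: "same_sign (lead_coeff (p i)) (poly (p i) x)" if "T i \<le> x" for i x
    using someI_ex[OF poly_sign_at_top[of "p i"]] that by (simp add: T_def)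
  have T': "same_sign (lead_coeff (q i)) (poly (q i) x)" if "T' i \<le> x" for i x
    using someI_ex[OF poly_sign_at_top[of "q i"]] that by (simp add: T'_def)
  have B: "same_sign ((- 1) ^ degree (p i) * lead_coeff (p i)) (poly (p i) x)" if "x \<le> B i" for i x
    using someI_ex[OF poly_sign_at_bot[of "p i"]] that by (simp add: B_def)
  have B': "same_sign ((- 1) ^ degree (q i) * lead_coeff (q i)) (poly (q i) x)" if "x \<le> B' i" for i x
    using someI_ex[OF poly_sign_at_bot[of "q i"]] that by (simp add: B'_def)
  \<comment> \<open>The entries \<open>y + 1\<close> and \<open>y - 1\<close> keep \<open>y\<close>
    strictly between the sentinels; the entries \<open>1\<close> and \<open>- 1\<close> on the other
    side ensure \<open>lo' < hi'\<close>.\<close>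
  define hi where "hi = Max (insert (y + 1) (T ` I))"
  define lo where "lo = Min (insert (y - 1) (B ` I))"
  define hi' where "hi' = Max (insert 1 (T' ` I))"
  define lo' where "lo' = Min (insert (- 1) (B' ` I))"
  have hi: "y + 1 \<le> hi" "1 \<le> hi'" "\<And>i. i \<in> I \<Longrightarrow> T i \<le> hi" "\<And>i. i \<in> I \<Longrightarrow> T' i \<le> hi'"
    unfolding hi_def hi'_def using fin by (auto intro: Max_ge)
  have lo: "lo \<le> y - 1" "lo' \<le> - 1" "\<And>i. i \<in> I \<Longrightarrow> lo \<le> B i" "\<And>i. i \<in> I \<Longrightarrow> lo' \<le> B' i"
    unfolding lo_def lo'_def using fin by (auto intro: Min_le)
  have "same_sign (poly (p i) hi) (poly (q i) hi')" if "i \<in> I" for i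
    by (rule same_sign_trans[OF same_sign_sym[OF T[OF hi(3)[OF that]]] same_sign_trans[OF lead[OF that] T'[OF hi(4)[OF that]]]])
  then have top: "same_signs_on I hi hi'" by (simp add: same_signs_on_def)
  have "same_sign (poly (p i) lo) (poly (q i) lo')" if "i \<in> I" for i
  proof -
    have "same_sign ((- 1) ^ degree (p i) * lead_coeff (p i)) ((- 1) ^ degree (q i) * lead_coeff (q i))"
      unfolding deg[OF that] using lead[OF that]
      by (intro same_sign_mult same_sign_power) (auto simp: same_sign_def deg[OF that])
    from same_sign_trans[OF same_sign_sym[OF B[OF lo(3)[OF that]]] same_sign_trans[OF this B'[OF lo(4)[OF that]]]]
    show ?thesis .
  qed
  then have bot: "same_signs_on I lo lo'" by (simp add: same_signs_on_def)
  have b1: "lo < z \<and> z < hi" if "i \<in> I" "p i \<noteq> 0" "poly (p i) z = 0" for i z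
  proof -
    have "\<not> T i \<le> z" using same_sign_zero_iff[OF T[of i z]] that by auto
    moreover have "\<not> z \<le> B i" using same_sign_zero_iff[OF B[of z i]] that by auto
    ultimately show ?thesis using hi(3) lo(3) that(1) by (meson le_less_trans less_le_trans not_le)
  qed
  have b2: "lo' < z \<and> z < hi'" if "i \<in> I" "p i \<noteq> 0" "poly (q i) z = 0" for i z
  proof -
    have "q i \<noteq> 0" using zero_iff that by blast
    then have "\<not> T' i \<le> z" using same_sign_zero_iff[OF T'[of i z]] that by auto
    moreover have "\<not> z \<le> B' i" using same_sign_zero_iff[OF B'[of z i]] that \<open>q i \<noteq> 0\<close> by auto
    ultimately show ?thesis using hi(4) lo(4) that(1) by (meson le_less_trans less_le_trans not_le)
  qed
  have lohi: "lo < y" "y < hi" "lo' < hi'" using lo(1,2) hi(1,2) by linarith+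
  obtain Z h where m: "partial_match lo hi lo' hi' I Z h"
    using match_ex[of I lo hi lo' hi'] b1 b2 top bot lohi by fastforce
  then have Z: "finite Z" "lo \<in> Z" "hi \<in> Z" and mono: "strict_mono_on Z h"
    by (simp_all add: partial_match_def)
  show ?thesis
  proof (cases "y \<in> Z")
    case True
    then show ?thesis using m by (auto simp: partial_match_def)
  next
    case False
    from neighbours_ex[OF Z lohi(1,2) False] obtain l u
      where lu: "l \<in> Z" "u \<in> Z" "l < y" "y < u" and "\<forall>w\<in>Z. w \<le> l \<or> u \<le> w" .
    then have consec: "w \<le> l \<or> u \<le> w" if "w \<in> Z" for w using that by blast
    have "h l < h u" using mono lu by (auto simp: strict_mono_on_def)
    then obtain y' where "h l < y'" "y' < h u" using dense by blast
    then have "same_signs_on I y y'"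
      using same_sign_in_gap[OF subset_refl _ _ m lu(1,2) consec lu(3,4)] by (auto simp: same_signs_on_def)
    then show ?thesis by blast
  qed
qed

end

subsection \<open>The real closure of an ordered field\<close>

locale comm_ring_hom =
  fixes f :: "'a::comm_ring_1 \<Rightarrow> 'b::comm_ring_1"
  assumes hom_add: "f (x + y) = f x + f y" and hom_mult: "f (x * y) = f x * f y" and hom_one: "f 1 = 1"
begin

lemma hom_zero: "f 0 = 0"
  using hom_add[of 0 0] by simp

lemma hom_minus: "f (- x) = - f x"
  using hom_add[of x "- x"] by (simp add: hom_zero eq_neg_iff_add_eq_0 add.commute)

lemma hom_diff: "f (x - y) = f x - f y"
  using hom_add[of x "- y"] by (simp add: hom_minus)

lemma hom_power: "f (x ^ n) = f x ^ n"
  by (induction n) (simp_all add: hom_one hom_mult)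

lemma map_poly_hom_add: "map_poly f (p + q) = map_poly f p + map_poly f q"
  by (intro poly_eqI) (simp add: coeff_map_poly hom_zero hom_add)

lemma map_poly_hom_smult: "map_poly f (smult c p) = smult (f c) (map_poly f p)"
  by (intro poly_eqI) (simp add: coeff_map_poly hom_zero hom_mult)

lemma map_poly_hom_pCons: "map_poly f (pCons c p) = pCons (f c) (map_poly f p)"
  by (simp add: map_poly_pCons hom_zero)

lemma map_poly_hom_mult: "map_poly f (p * q) = map_poly f p * map_poly f q"
  by (induction p) (simp_all add: mult_pCons_left map_poly_hom_add map_poly_hom_smult map_poly_hom_pCons hom_zero)

lemma poly_map_poly_hom: "poly (map_poly f p) (f x) = f (poly p x)"
  by (induction p) (simp_all add: map_poly_hom_pCons hom_zero hom_add hom_mult)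

lemma poly_map_poly_comm_ring_hom: "comm_ring_hom (\<lambda>p. poly (map_poly f p) a)"
  by unfold_locales (simp_all add: map_poly_hom_add map_poly_hom_mult hom_one)

end

section \<open>Weighted sums of squares modulo an irreducible polynomial\<close>

lemma irreducible_bezout:
  fixes p :: "'a::field poly"
  assumes irred: "\<And>g h. p = g * h \<Longrightarrow> degree g < degree p \<Longrightarrow> degree h < degree p \<Longrightarrow> False"
    and "p \<noteq> 0" "\<not> p dvd g"
  shows "\<exists>u v. u * g + v * p = 1"
proof -
  \<comment> \<open>The nonzero elements of the ideal generated by \<open>g\<close> and
    \<open>p\<close>. One of least degree divides both generators, and by irreducibility it is a
    nonzero constant.\<close>
  define S where "S = {f. f \<noteq> 0 \<and> (\<exists>u v. f = u * g + v * p)}"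
  have "p = 0 * g + 1 * p" by simp
  then have "p \<in> S" using \<open>p \<noteq> 0\<close> unfolding S_def by blast
  then obtain d where d: "d \<in> S" "\<And>f. f \<in> S \<Longrightarrow> degree d \<le> degree f"
    using arg_min_nat_lemma[of "\<lambda>f. f \<in> S" p degree] by metis
  have dS: "d \<noteq> 0" using d(1) by (simp add: S_def)
  obtain u v where uv: "d = u * g + v * p" using d(1) by (auto simp: S_def)
  have div: "d dvd f" if f: "f = r * g + s * p" for f r s
  proof (rule ccontr)
    assume n: "\<not> d dvd f"
    have "f mod d = (r - f div d * u) * g + (s - f div d * v) * p"
      using minus_div_mult_eq_mod[of f d] f uv by (simp add: algebra_simps)
    moreover have "f mod d \<noteq> 0" using n by (simp add: dvd_eq_mod_eq_0)
    ultimately have "f mod d \<in> S" unfolding S_def by blast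
    then show False using d(2) degree_mod_less_degree[OF dS n] by (meson not_le)
  qed
  have "d dvd p" using div[of p 0 1] by simp
  then obtain k where k: "p = d * k" by blast
  have "d dvd g" using div[of g 1 0] by simp
  have kn: "k \<noteq> 0" using k assms(2) by auto
  have degs: "degree p = degree d + degree k" using k dS kn by (simp add: degree_mult_eq)
  have "degree d = 0"
  proof (rule ccontr)
    assume "degree d \<noteq> 0"
    then have "degree k < degree p" using degs by simp
    then have "degree k = 0" using irred[OF k] degs by fastforce
    then obtain c where "k = [:c:]" by (rule degree_eq_zeroE)
    then have "p = smult c d" "c \<noteq> 0" using k kn by auto
    then have "p dvd d" by (simp add: smult_dvd_iff)
    then show False using \<open>d dvd g\<close> assms(3) dvd_trans by blast
  qed
  then obtain c where c: "d = [:c:]" by (rule degree_eq_zeroE)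
  then have "c \<noteq> 0" using dS by auto
  then have "smult (1 / c) u * g + smult (1 / c) v * p = smult (1 / c) d"
    unfolding uv by (simp add: smult_add_right)
  also have "\<dots> = 1" using c \<open>c \<noteq> 0\<close> by (simp add: one_pCons)
  finally show ?thesis by blast
qed

text \<open>Nonnegative constants appear as weights because they are not yet known to be squares.
  Evaluated at a root of \<open>p\<close>, these sums form the candidate for an ordering of the
  extended field.\<close>

inductive_set weighted_squares :: "'a::linordered_field poly set" where
  zero: "0 \<in> weighted_squares"
| step: "w \<in> weighted_squares \<Longrightarrow> 0 \<le> c \<Longrightarrow> w + smult c (g\<^sup>2) \<in> weighted_squares"

lemma weighted_squares_single: "0 \<le> c \<Longrightarrow> smult c (g\<^sup>2) \<in> weighted_squares"
  using weighted_squares.step[OF weighted_squares.zero, of c g] by simp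

lemma weighted_squares_add:
  assumes "v \<in> weighted_squares" "w \<in> weighted_squares"
  shows "v + w \<in> weighted_squares"
  using assms(2)
proof (induction rule: weighted_squares.induct)
  case (step w c g)
  then show ?case using weighted_squares.step[of "v + w" c g] by (simp add: add.assoc)
qed (use assms in simp)

lemma weighted_squares_scale:
  assumes "w \<in> weighted_squares" "0 \<le> c"
  shows "smult c (g\<^sup>2) * w \<in> weighted_squares"
  using assms(1)
proof (induction rule: weighted_squares.induct)
  case zero
  then show ?case by (simp add: weighted_squares.zero)
next
  case (step w d h)
  have "smult c (g\<^sup>2) * (w + smult d (h\<^sup>2)) = smult c (g\<^sup>2) * w + smult (c * d) ((g * h)\<^sup>2)"
    by (simp add: distrib_left power_mult_distrib ac_simps)
  then show ?case using weighted_squares.step[OF step.IH, of "c * d" "g * h"] step(2) assms(2) by simp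
qed

lemma weighted_squares_mult:
  assumes "v \<in> weighted_squares" "w \<in> weighted_squares"
  shows "v * w \<in> weighted_squares"
  using assms(1)
proof (induction rule: weighted_squares.induct)
  case zero
  then show ?case by (simp add: weighted_squares.zero)
next
  case (step v c g)
  then show ?case
    using weighted_squares_add[OF step.IH weighted_squares_scale[OF assms(2) step(2), of g]]
    by (simp only: distrib_right)
qed

lemma weighted_squares_nonneg: "w \<in> weighted_squares \<Longrightarrow> 0 \<le> poly w x"
  by (induction rule: weighted_squares.induct) simp_all

text \<open>Replacing each \<open>g\<close> by \<open>g mod p\<close> changes the sum by a multiple
  of \<open>p\<close>, because the difference of the two squares has the factor
  \<open>g - g mod p\<close>; the weights stay as they are.\<close>

lemma weighted_squares_reduce:
  assumes "w \<in> weighted_squares" "0 < degree p"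
  shows "\<exists>w'\<in>weighted_squares. p dvd w - w' \<and> degree w' \<le> 2 * (degree p - 1)"
  using assms(1)
proof (induction rule: weighted_squares.induct)
  case zero
  show ?case by (rule bexI[of _ 0]) (auto intro: weighted_squares.zero)
next
  case (step w c g)
  then obtain w' where w': "w' \<in> weighted_squares" "p dvd w - w'" "degree w' \<le> 2 * (degree p - 1)" by blast
  have "degree (g mod p) \<le> degree p - 1"
  proof (cases "p dvd g")
    case False
    moreover have "p \<noteq> 0" using assms(2) by auto
    ultimately show ?thesis using degree_mod_less_degree[of p g] by linarith
  qed (simp add: dvd_eq_mod_eq_0)
  then have "degree (smult c ((g mod p)\<^sup>2)) \<le> 2 * (degree p - 1)"
    by (intro order_trans[OF degree_smult_le] order_trans[OF degree_power_le]) simp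
  moreover have "p dvd w + smult c (g\<^sup>2) - (w' + smult c ((g mod p)\<^sup>2))"
  proof -
    have "w + smult c (g\<^sup>2) - (w' + smult c ((g mod p)\<^sup>2)) = (w - w') + smult c ((g - g mod p) * (g + g mod p))"
      by (simp add: algebra_simps power2_eq_square smult_diff_right)
    moreover have "p dvd smult c ((g - g mod p) * (g + g mod p))"
      by (intro dvd_smult dvd_mult2 dvd_minus_mod)
    ultimately show ?thesis using w'(2) by (simp only: dvd_add)
  qed
  ultimately show ?case
    using w' weighted_squares.step[OF w'(1) step(2), of "g mod p"]
    by (intro bexI[of _ "w' + smult c ((g mod p)\<^sup>2)"]) (auto intro!: degree_add_le)
qed

text \<open>Isolates a term whose base \<open>g\<close> is invertible modulo \<open>p\<close> when
  \<open>p\<close> is irreducible, so that the term can be normalised to 1.\<close>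

lemma weighted_squares_nonzero_term:
  assumes "w \<in> weighted_squares" "\<not> p dvd w"
  shows "\<exists>c g w'. 0 < c \<and> \<not> p dvd g \<and> w' \<in> weighted_squares \<and> w = smult c (g\<^sup>2) + w'"
  using assms
proof (induction rule: weighted_squares.induct)
  case (step w c g)
  show ?case
  proof (cases "p dvd smult c (g\<^sup>2)")
    case True
    then have "\<not> p dvd w" using dvd_add[OF _ True, of w] step.prems by blast
    then obtain d h w' where "0 < d" "\<not> p dvd h" "w' \<in> weighted_squares" "w = smult d (h\<^sup>2) + w'"
      using step.IH by blast
    then show ?thesis using weighted_squares.step[of w' c g] step(2) by (metis add.assoc)
  next
    case False
    then have "c \<noteq> 0" "\<not> p dvd g" by (auto simp: power2_eq_square dvd_smult)
    then show ?thesis using step by (metis add.commute order_less_le)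
  qed
qed simp

text \<open>The degree descent behind the extension of an ordering by a root: a cofactor of a polynomial that
  changes sign must change sign as well.\<close>

lemma sign_change_not_dvd:
  fixes p :: "'a::linordered_field poly"
  assumes "poly p a * poly p b < 0" "w \<in> weighted_squares"
  shows "\<not> p dvd 1 + w"
  using assms
proof (induction "degree p" arbitrary: p w rule: less_induct)
  case less
  show ?case
  proof
    assume dvd: "p dvd 1 + w"
    have pos: "0 < degree p"
    proof (rule ccontr)
      assume "\<not> 0 < degree p"
      then obtain c where "p = [:c:]" by (auto elim: degree_eq_zeroE)
      then show False using less.prems(1) by (simp add: mult_less_0_iff)
    qed
    obtain w' where w': "w' \<in> weighted_squares" "p dvd w - w'" "degree w' \<le> 2 * (degree p - 1)"
      using weighted_squares_reduce[OF less.prems(2) pos] by blast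
    have "p dvd 1 + w'"
      using dvd_diff[OF dvd w'(2)] by simp
    then obtain h where h: "1 + w' = p * h" by blast
    have val: "0 < poly p x * poly h x" for x
      using arg_cong[OF h, of "\<lambda>f. poly f x"] weighted_squares_nonneg[OF w'(1), of x] by simp
    then have "h \<noteq> 0" by (metis less_irrefl mult_zero_right poly_0)
    then have "degree p + degree h = degree (1 + w')" using h pos by (subst h, subst degree_mult_eq) auto
    also have "\<dots> \<le> 2 * (degree p - 1)" using w'(3) by (intro degree_add_le) auto
    finally have "degree h < degree p" using pos by linarith
    moreover have "poly h a * poly h b < 0"
      using val[of a] val[of b] less.prems(1) by (auto simp: mult_less_0_iff zero_less_mult_iff)
    moreover have "h dvd 1 + w'" using h by simp
    ultimately show False using less.hyps w'(1) by blast
  qed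
qed

section \<open>Maximal ordered cones in the algebraic closure\<close>

text \<open>Squares of differences are required so that a maximal cone is total on the field it spans.\<close>

definition ordered_cone :: "'c::field set \<Rightarrow> bool" where
  "ordered_cone Q \<longleftrightarrow> (\<forall>x\<in>Q. \<forall>y\<in>Q. x + y \<in> Q \<and> x * y \<in> Q \<and> (x - y)\<^sup>2 \<in> Q) \<and> (\<forall>x\<in>Q. - x \<in> Q \<longrightarrow> x = 0)"

lemma ordered_coneD:
  assumes "ordered_cone Q" "x \<in> Q" "y \<in> Q"
  shows "x + y \<in> Q" "x * y \<in> Q" "(x - y)\<^sup>2 \<in> Q" "- x \<in> Q \<Longrightarrow> x = 0"
  using assms by (auto simp: ordered_cone_def)

definition maximal_real_cone :: "'a::linordered_field alg_closure set \<Rightarrow> bool" where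
  "maximal_real_cone Q \<longleftrightarrow> ordered_cone Q \<and> to_ac ` {0..} \<subseteq> Q \<and> (\<forall>Q'. ordered_cone Q' \<longrightarrow> Q \<subseteq> Q' \<longrightarrow> Q' = Q)"

lemma maximal_real_cone_ex: "\<exists>Q :: 'a::linordered_field alg_closure set. maximal_real_cone Q"
proof -
  let ?A = "{Q :: 'a alg_closure set. ordered_cone Q \<and> to_ac ` {0..} \<subseteq> Q}"
  have "ordered_cone (to_ac ` {0::'a..})"
    unfolding ordered_cone_def
  proof (intro conjI ballI impI)
    fix x y :: "'a alg_closure" assume "x \<in> to_ac ` {0..}" "y \<in> to_ac ` {0..}"
    then obtain a b where "x = to_ac a" "y = to_ac b" "0 \<le> a" "0 \<le> b" by auto
    then show "x + y \<in> to_ac ` {0..}" "x * y \<in> to_ac ` {0..}" "(x - y)\<^sup>2 \<in> to_ac ` {0..}"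
      by (auto intro: image_eqI[of _ _ "a + b"] image_eqI[of _ _ "a * b"] image_eqI[of _ _ "(a - b)\<^sup>2"])
  next
    fix x :: "'a alg_closure" assume "x \<in> to_ac ` {0..}" "- x \<in> to_ac ` {0..}"
    then obtain a b where ab: "x = to_ac a" "- x = to_ac b" "0 \<le> a" "0 \<le> b" by auto
    then have "to_ac (- a) = to_ac b" by simp
    then have "- a = b" by (simp only: to_ac_eq_iff)
    then show "x = 0" using ab by simp
  qed
  then have "?A \<noteq> {}" by blast
  moreover have "\<Union>C \<in> ?A" if "C \<noteq> {}" and chain: "subset.chain ?A C" for C
  proof -
    have cone: "ordered_cone A" "to_ac ` {0..} \<subseteq> A" if "A \<in> C" for A
      using chain that by (auto simp: subset.chain_def)
    have common: "\<exists>A\<in>C. x \<in> A \<and> y \<in> A" if "x \<in> \<Union>C" "y \<in> \<Union>C" for x y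
      using that chain unfolding subset_chain_def by blast
    have "x + y \<in> \<Union>C" "x * y \<in> \<Union>C" "(x - y)\<^sup>2 \<in> \<Union>C" "- x \<in> \<Union>C \<Longrightarrow> x = 0"
      if xy: "x \<in> \<Union>C" "y \<in> \<Union>C" for x y
    proof -
      obtain A where "A \<in> C" "x \<in> A" "y \<in> A" using common[OF xy] by blast
      then show "x + y \<in> \<Union>C" "x * y \<in> \<Union>C" "(x - y)\<^sup>2 \<in> \<Union>C"
        using ordered_coneD(1-3)[OF cone(1)] by blast+
      assume "- x \<in> \<Union>C"
      then obtain B where "B \<in> C" "x \<in> B" "- x \<in> B" using common[OF xy(1)] by blast
      then show "x = 0" using ordered_coneD(4)[OF cone(1), of B x x] by blast
    qed
    then have "ordered_cone (\<Union>C)" unfolding ordered_cone_def by blast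
    moreover have "to_ac ` {0..} \<subseteq> \<Union>C" using cone(2) \<open>C \<noteq> {}\<close> by blast
    ultimately show ?thesis by blast
  qed
  ultimately obtain Q where "Q \<in> ?A" "\<forall>A\<in>?A. Q \<subseteq> A \<longrightarrow> A = Q"
    using subset_Zorn_nonempty[of ?A] by blast
  then have "maximal_real_cone Q" unfolding maximal_real_cone_def by blast
  then show ?thesis by blast
qed

definition real_cone :: "'a::linordered_field alg_closure set" where
  "real_cone = (SOME Q. maximal_real_cone Q)"

lemma maximal_real_cone: "maximal_real_cone real_cone"
  unfolding real_cone_def by (rule someI_ex[OF maximal_real_cone_ex])

lemma real_cone_ordered: "ordered_cone real_cone"
  and to_ac_real_cone: "0 \<le> a \<Longrightarrow> to_ac a \<in> real_cone"
  and real_cone_maximal: "ordered_cone Q \<Longrightarrow> real_cone \<subseteq> Q \<Longrightarrow> Q = real_cone"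
  using maximal_real_cone unfolding maximal_real_cone_def by blast+

lemmas real_coneD = ordered_coneD[OF real_cone_ordered]

lemma real_cone_0: "0 \<in> real_cone" and real_cone_1: "1 \<in> real_cone"
  using to_ac_real_cone[of 0] to_ac_real_cone[of 1] by simp_all

text \<open>Fractions of cone elements again form an ordered cone, so maximality makes the cone
  closed under division.\<close>

lemma real_cone_inverse:
  assumes "x \<in> real_cone"
  shows "inverse x \<in> real_cone"
proof (cases "x = 0")
  case False
  define Q where "Q = {a / b |a b. a \<in> real_cone \<and> b \<in> real_cone \<and> b \<noteq> (0 :: 'a alg_closure)}"
  have "ordered_cone Q"
    unfolding ordered_cone_def
  proof (intro conjI ballI impI)
    fix x y assume "x \<in> Q" "y \<in> Q"
    then obtain a b c d where xy: "x = a / b" "y = c / d" "b \<noteq> 0" "d \<noteq> 0"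
      and abcd: "a \<in> real_cone" "b \<in> real_cone" "c \<in> real_cone" "d \<in> real_cone"
      unfolding Q_def by blast
    have "x + y = (a * d + c * b) / (b * d)" "x * y = (a * c) / (b * d)" "x - y = (a * d - c * b) / (b * d - 0)"
      using xy by (simp_all add: field_simps)
    moreover from this(3) have "(x - y)\<^sup>2 = (a * d - c * b)\<^sup>2 / (b * d - 0)\<^sup>2"
      by (simp only: power_divide)
    moreover have "(b * d - 0)\<^sup>2 \<noteq> 0" "b * d \<noteq> 0" using xy by simp_all
    moreover have "a * d + c * b \<in> real_cone" "a * c \<in> real_cone" "(a * d - c * b)\<^sup>2 \<in> real_cone"
      "b * d \<in> real_cone" "(b * d - 0)\<^sup>2 \<in> real_cone"
      using abcd real_coneD(3)[OF real_coneD(2)[OF abcd(2,4)] real_cone_0] by (auto intro!: real_coneD(1-3))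
    ultimately show "x + y \<in> Q" "x * y \<in> Q" "(x - y)\<^sup>2 \<in> Q" unfolding Q_def by blast+
  next
    fix x assume "x \<in> Q" "- x \<in> Q"
    then obtain a b c d where xy: "x = a / b" "- x = c / d" "b \<noteq> 0" "d \<noteq> 0"
      and abcd: "a \<in> real_cone" "b \<in> real_cone" "c \<in> real_cone" "d \<in> real_cone"
      unfolding Q_def by blast
    have "- (a / b) = c / d" using xy by simp
    then have "- (a * d) = c * b" using xy(3,4) by (simp add: field_simps)
    then have "a * d = 0" using real_coneD(2)[OF abcd(1,4)] real_coneD(2)[OF abcd(3,2)] real_coneD(4)
      by metis
    then show "x = 0" using xy by simp
  qed
  moreover have "y \<in> Q" if "y \<in> real_cone" for y
  proof -
    have "y = y / 1" by simp
    then show ?thesis using that real_cone_1 one_neq_zero unfolding Q_def by blast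
  qed
  ultimately have "Q = real_cone" using real_cone_maximal by blast
  moreover have "inverse x = 1 / x" by (simp add: divide_inverse)
  then have "inverse x \<in> Q" using assms False real_cone_1 unfolding Q_def by blast
  ultimately show ?thesis by simp
qed (simp add: real_cone_0)

text \<open>If neither \<open>t = a - b\<close> nor \<open>- t\<close> belonged to the cone,
  adjoining \<open>t\<close> would give a larger ordered cone. A nonzero element lying there with
  its negative would express \<open>- t\<close> as a quotient of cone elements.\<close>

lemma real_cone_total:
  assumes "a \<in> real_cone" "b \<in> real_cone"
  shows "a - b \<in> real_cone \<or> b - a \<in> real_cone"
proof (rule ccontr)
  assume n: "\<not> ?thesis"
  define t where "t = a - b"
  have nt: "t \<notin> real_cone" "- t \<notin> real_cone" using n by (simp_all add: t_def)
  have tt: "t * t \<in> real_cone" using real_coneD(3)[OF assms] by (simp add: t_def power2_eq_square)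
  define Q where "Q = {x + t * y |x y. x \<in> real_cone \<and> y \<in> real_cone}"
  have "ordered_cone Q"
    unfolding ordered_cone_def
  proof (intro conjI ballI impI)
    fix x y assume "x \<in> Q" "y \<in> Q"
    then obtain u v u' v' where xy: "x = u + t * v" "y = u' + t * v'"
      and uv: "u \<in> real_cone" "v \<in> real_cone" "u' \<in> real_cone" "v' \<in> real_cone"
      unfolding Q_def by blast
    have "x + y = (u + u') + t * (v + v')" "x * y = (u * u' + (t * t) * (v * v')) + t * (u * v' + v * u')"
      \<comment> \<open>Substituting \<open>a - b\<close> for \<open>t\<close> and moving the
        negative terms to the other side exhibits \<open>x - y\<close> as a difference of two
        elements of the original cone, so its square lies in that cone.\<close>
      "(x - y)\<^sup>2 = ((u + a * v + b * v') - (u' + b * v + a * v'))\<^sup>2 + t * 0"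
      unfolding xy by (simp_all only: mult_zero_right add_0_right) (simp_all add: algebra_simps t_def)
    moreover have "u + u' \<in> real_cone" "v + v' \<in> real_cone" "u * u' + (t * t) * (v * v') \<in> real_cone"
      "u * v' + v * u' \<in> real_cone" "((u + a * v + b * v') - (u' + b * v + a * v'))\<^sup>2 \<in> real_cone"
      using uv assms tt by (auto intro!: real_coneD(1-3))
    ultimately show "x + y \<in> Q" "x * y \<in> Q" "(x - y)\<^sup>2 \<in> Q" using real_cone_0 unfolding Q_def by blast+
  next
    fix x assume "x \<in> Q" "- x \<in> Q"
    then obtain u v u' v' where xy: "x = u + t * v" "- x = u' + t * v'"
      and uv: "u \<in> real_cone" "v \<in> real_cone" "u' \<in> real_cone" "v' \<in> real_cone"
      unfolding Q_def by blast
    have "(u + t * v) + (u' + t * v') = 0" by (simp only: xy[symmetric]) simp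
    then have "u + u' = - (t * (v + v'))" unfolding eq_neg_iff_add_eq_0 by (simp add: algebra_simps)
    then have eq: "- t * (v + v') = u + u'" by simp
    have "v + v' = 0"
    proof (rule ccontr)
      assume "v + v' \<noteq> 0"
      then have "- t = (u + u') * inverse (v + v')" using eq by (simp add: field_simps)
      then show False using nt uv by (auto intro!: real_coneD(1,2) real_cone_inverse)
    qed
    then have "v' = - v" "u' = - u" using eq by (auto simp: eq_neg_iff_add_eq_0 add.commute)
    then have "v = 0" "u = 0" using uv real_coneD(4) by blast+
    then show "x = 0" using xy by simp
  qed
  moreover have "x \<in> Q" if "x \<in> real_cone" for x
    using that real_cone_0 unfolding Q_def by (intro CollectI exI[of _ x] exI[of _ 0]) simp
  ultimately have "Q = real_cone" using real_cone_maximal by blast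
  moreover have "t \<in> Q" using real_cone_0 real_cone_1 unfolding Q_def by (intro CollectI exI[of _ 0] exI[of _ 1]) simp
  ultimately show False using nt by simp
qed

text \<open>By \<open>real_cone_total\<close> the cone and its negatives already contain all
  differences of cone elements. They form a subfield of the algebraic closure whose nonnegative part
  is the cone.\<close>

typedef (overloaded) ('a::linordered_field) real_closure =
  "{x :: 'a alg_closure. x \<in> real_cone \<or> - x \<in> real_cone}"
  morphisms rep_rc abs_rc
  using real_cone_0 by blast

setup_lifting type_definition_real_closure

lemma rc_carrier_add:
  assumes "x \<in> real_cone \<or> - x \<in> real_cone" "y \<in> real_cone \<or> - y \<in> real_cone"
  shows "x + y \<in> real_cone \<or> - (x + y) \<in> real_cone"
proof -
  consider "x \<in> real_cone" "y \<in> real_cone" | "x \<in> real_cone" "- y \<in> real_cone"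
    | "- x \<in> real_cone" "y \<in> real_cone" | "- x \<in> real_cone" "- y \<in> real_cone"
    using assms by blast
  moreover have mixed: "x + y \<in> real_cone \<or> - (x + y) \<in> real_cone" if "x \<in> real_cone" "- y \<in> real_cone"
    for x y :: "'a alg_closure"
  proof -
    have "x - - y = x + y" "- y - x = - (x + y)" by simp_all
    then show ?thesis using real_cone_total[OF that] by (simp only:)
  qed
  ultimately show ?thesis
  proof cases
    case 3
    then show ?thesis using mixed[of y x] by (simp only: add.commute)
  next
    case 4
    then show ?thesis using real_coneD(1)[of "- x" "- y"] by simp
  qed (use real_coneD(1) mixed in blast)+
qed

lemma rc_carrier_mult:
  assumes "x \<in> real_cone \<or> - x \<in> real_cone" "y \<in> real_cone \<or> - y \<in> real_cone"
  shows "x * y \<in> real_cone \<or> - (x * y) \<in> real_cone"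
  using assms real_coneD(2)[of x y] real_coneD(2)[of "- x" y] real_coneD(2)[of x "- y"] real_coneD(2)[of "- x" "- y"]
  by auto

instantiation real_closure :: (linordered_field) linordered_field
begin

lift_definition zero_real_closure :: "'a real_closure" is 0
  by (simp add: real_cone_0)
lift_definition one_real_closure :: "'a real_closure" is 1
  by (simp add: real_cone_1)
lift_definition plus_real_closure :: "'a real_closure \<Rightarrow> 'a real_closure \<Rightarrow> 'a real_closure" is "(+)"
  by (rule rc_carrier_add)
lift_definition uminus_real_closure :: "'a real_closure \<Rightarrow> 'a real_closure" is uminus
  by auto
lift_definition minus_real_closure :: "'a real_closure \<Rightarrow> 'a real_closure \<Rightarrow> 'a real_closure" is "(-)"
  subgoal for x y using rc_carrier_add[of x "- y"] by auto
  done
lift_definition times_real_closure :: "'a real_closure \<Rightarrow> 'a real_closure \<Rightarrow> 'a real_closure" is "(*)"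
  by (rule rc_carrier_mult)
lift_definition inverse_real_closure :: "'a real_closure \<Rightarrow> 'a real_closure" is inverse
  by (auto dest: real_cone_inverse)
lift_definition divide_real_closure :: "'a real_closure \<Rightarrow> 'a real_closure \<Rightarrow> 'a real_closure" is "(/)"
  subgoal for x y using rc_carrier_mult[of x "inverse y"] real_cone_inverse[of y] real_cone_inverse[of "- y"]
    by (auto simp: divide_inverse)
  done
lift_definition less_eq_real_closure :: "'a real_closure \<Rightarrow> 'a real_closure \<Rightarrow> bool" is "\<lambda>x y. y - x \<in> real_cone" .
definition "x < y \<longleftrightarrow> x \<le> y \<and> \<not> y \<le> (x :: 'a real_closure)"
definition "abs x = (if x < 0 then - x else x :: 'a real_closure)"
definition "sgn x = (if x = 0 then 0 else if 0 < x then 1 else - 1 :: 'a real_closure)"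

instance
proof
  fix x y z :: "'a real_closure"
  show "x * y * z = x * (y * z)" by transfer (simp add: mult.assoc)
  show "x * y = y * x" by transfer (simp add: mult.commute)
  show "1 * x = x" by transfer simp
  show "x + y + z = x + (y + z)" by transfer (simp add: add.assoc)
  show "x + y = y + x" by transfer (simp add: add.commute)
  show "0 + x = x" by transfer simp
  show "- x + x = 0" by transfer simp
  show "x - y = x + - y" by transfer simp
  show "x + y - x = y" by transfer simp
  show "x - y - z = x - (y + z)" by transfer (simp add: diff_diff_eq)
  show "0 * x = 0" "x * 0 = 0" by (transfer, simp)+
  show "(x + y) * z = x * z + y * z" by transfer (simp add: distrib_right)
  show "0 \<noteq> (1 :: 'a real_closure)" by transfer simp
  show "x \<noteq> 0 \<Longrightarrow> inverse x * x = 1" by transfer simp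
  show "x div y = x * inverse y" by transfer (simp add: divide_inverse)
  show "inverse (0 :: 'a real_closure) = 0" by transfer simp
  show "x < y \<longleftrightarrow> x \<le> y \<and> \<not> y \<le> x" by (rule less_real_closure_def)
  show "x \<le> x" by transfer (simp add: real_cone_0)
  show "x \<le> y \<Longrightarrow> y \<le> z \<Longrightarrow> x \<le> z"
  proof transfer
    fix x y z :: "'a alg_closure"
    assume "y - x \<in> real_cone" "z - y \<in> real_cone"
    then show "z - x \<in> real_cone" using real_coneD(1)[of "y - x" "z - y"] by simp
  qed
  have anti: "x \<le> y \<Longrightarrow> y \<le> x \<Longrightarrow> x = y" for x y :: "'a real_closure"
  proof transfer
    fix x y :: "'a alg_closure"
    assume "y - x \<in> real_cone" "x - y \<in> real_cone"
    then show "x = y" using real_coneD(4)[of "y - x" "y - x"] by simp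
  qed
  show "x \<le> y \<Longrightarrow> y \<le> x \<Longrightarrow> x = y" by (rule anti)
  show "x \<le> y \<or> y \<le> x"
  proof transfer
    fix x y :: "'a alg_closure"
    assume "x \<in> real_cone \<or> - x \<in> real_cone" "y \<in> real_cone \<or> - y \<in> real_cone"
    then show "y - x \<in> real_cone \<or> x - y \<in> real_cone"
      using rc_carrier_add[of y "- x"] by auto
  qed
  show "x \<le> y \<Longrightarrow> z + x \<le> z + y" by transfer (simp add: add_diff_add)
  show "\<bar>x\<bar> = (if x < 0 then - x else x)" by (rule abs_real_closure_def)
  show "sgn x = (if x = 0 then 0 else if 0 < x then 1 else - 1)" by (rule sgn_real_closure_def)
  have mono: "x \<le> y \<Longrightarrow> 0 \<le> z \<Longrightarrow> z * x \<le> z * y" for x y z :: "'a real_closure"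
  proof transfer
    fix x y z :: "'a alg_closure"
    assume "y - x \<in> real_cone" "z - 0 \<in> real_cone"
    then show "z * y - z * x \<in> real_cone" using real_coneD(2)[of "z" "y - x"] by (simp add: right_diff_distrib)
  qed
  show "x < y \<Longrightarrow> 0 < z \<Longrightarrow> z * x < z * y"
  proof -
    assume xy: "x < y" "0 < z"
    then have le: "z * x \<le> z * y" using mono by (simp add: less_real_closure_def)
    have "z * x \<noteq> z * y"
    proof
      assume "z * x = z * y"
      moreover have "z \<noteq> 0" using xy(2) by (auto simp: less_real_closure_def)
      ultimately have "x = y" by transfer simp
      then show False using xy(1) by (simp add: less_real_closure_def)
    qed
    then show "z * x < z * y" using le anti unfolding less_real_closure_def by blast
  qed
qed

end

lemma rep_rc_hom: "comm_ring_hom (rep_rc :: 'a::linordered_field real_closure \<Rightarrow> 'a alg_closure)"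
  by unfold_locales (simp_all add: plus_real_closure.rep_eq times_real_closure.rep_eq one_real_closure.rep_eq)

interpretation rep_rc: comm_ring_hom "rep_rc :: 'a::linordered_field real_closure \<Rightarrow> 'a alg_closure"
  by (rule rep_rc_hom)

lift_definition to_rc :: "'a::linordered_field \<Rightarrow> 'a real_closure" is to_ac
  subgoal for a using to_ac_real_cone[of a] to_ac_real_cone[of "- a"] by (cases "0 \<le> a") auto
  done

lemma to_rc_hom: "comm_ring_hom to_rc"
  by unfold_locales (transfer, simp)+

lemma to_rc_nonneg: "0 \<le> a \<Longrightarrow> 0 \<le> to_rc a"
  by transfer (simp add: to_ac_real_cone)

lemma rep_rc_nonneg_iff: "0 \<le> x \<longleftrightarrow> rep_rc x \<in> real_cone"
  by (simp add: less_eq_real_closure.rep_eq zero_real_closure.rep_eq)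

lemma rep_rc_eq_0_iff: "rep_rc x = 0 \<longleftrightarrow> x = 0"
  by (metis rep_rc_inject zero_real_closure.rep_eq)

lemma rep_rc_surj_on_cone:
  assumes "y \<in> real_cone"
  obtains x where "0 \<le> x" "rep_rc x = y"
  using assms abs_rc_inverse[of y] rep_rc_nonneg_iff[of "abs_rc y"] by auto

text \<open>An irreducible polynomial over the real closure that changes sign has its roots in the real
  closure: adjoining a root would extend the ordering, contradicting maximality.\<close>

lemma irreducible_sign_change_root:
  fixes p :: "'a::linordered_field real_closure poly"
  assumes irred: "\<And>g h. p = g * h \<Longrightarrow> degree g < degree p \<Longrightarrow> degree h < degree p \<Longrightarrow> False"
    and ab: "poly p a * poly p b < 0"
  shows "\<exists>c. poly p c = 0"
proof -
  have "p \<noteq> 0" using ab by auto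
  have "degree p \<noteq> 0"
  proof
    assume "degree p = 0"
    then obtain k where "p = [:k:]" by (rule degree_eq_zeroE)
    then show False using ab by (simp add: mult_less_0_iff)
  qed
  then have "0 < degree (map_poly rep_rc p)"
    by (simp add: degree_map_poly rep_rc_eq_0_iff)
  then obtain \<alpha> where \<alpha>: "poly (map_poly rep_rc p) \<alpha> = 0"
    using alg_closed_imp_poly_has_root by blast
  define \<phi> where "\<phi> w = poly (map_poly rep_rc w) \<alpha>" for w
  interpret \<phi>: comm_ring_hom \<phi>
    unfolding \<phi>_def by (rule rep_rc.poly_map_poly_comm_ring_hom)
  have bezout: "\<exists>u v. u * g + v * p = 1" if "\<not> p dvd g" for g
    by (rule irreducible_bezout[OF irred \<open>p \<noteq> 0\<close> that])
  have \<phi>_const: "\<phi> [:c:] = rep_rc c" for c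
    by (simp add: \<phi>_def rep_rc.map_poly_hom_pCons)
  have \<phi>_smult: "\<phi> (smult c g) = rep_rc c * \<phi> g" for c g
    using \<phi>.hom_mult[of "[:c:]" g] \<phi>_const by simp
  have \<phi>_zero: "\<phi> g = 0 \<longleftrightarrow> p dvd g" for g
  proof
    assume g: "\<phi> g = 0"
    show "p dvd g"
    proof (rule ccontr)
      assume "\<not> p dvd g"
      then obtain u v where "u * g + v * p = 1" using bezout by blast
      then have "\<phi> u * \<phi> g + \<phi> v * \<phi> p = 1" by (metis \<phi>.hom_add \<phi>.hom_mult \<phi>.hom_one)
      then show False using g \<alpha> by (simp add: \<phi>_def)
    qed
  next
    assume "p dvd g"
    then obtain k where "g = p * k" by blast
    then show "\<phi> g = 0" using \<alpha> by (simp add: \<phi>.hom_mult) (simp add: \<phi>_def)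
  qed
  have "ordered_cone (\<phi> ` weighted_squares)"
    unfolding ordered_cone_def
  proof (intro conjI ballI impI)
    fix x y assume "x \<in> \<phi> ` weighted_squares" "y \<in> \<phi> ` weighted_squares"
    then obtain v w where vw: "x = \<phi> v" "y = \<phi> w" "v \<in> weighted_squares" "w \<in> weighted_squares" by blast
    have "x + y = \<phi> (v + w)" "x * y = \<phi> (v * w)" "(x - y)\<^sup>2 = \<phi> (smult 1 ((v - w)\<^sup>2))"
      using vw by (simp_all add: \<phi>.hom_add \<phi>.hom_mult \<phi>.hom_diff \<phi>.hom_power)
    then show "x + y \<in> \<phi> ` weighted_squares" "x * y \<in> \<phi> ` weighted_squares" "(x - y)\<^sup>2 \<in> \<phi> ` weighted_squares"
      using weighted_squares_add[OF vw(3,4)] weighted_squares_mult[OF vw(3,4)] weighted_squares_single[of 1 "v - w"]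
      by (simp_all only: imageI zero_le_one)
  next
    fix x assume "x \<in> \<phi> ` weighted_squares" "- x \<in> \<phi> ` weighted_squares"
    then obtain v w where vw: "x = \<phi> v" "- x = \<phi> w" "v \<in> weighted_squares" "w \<in> weighted_squares" by blast
    then have "\<phi> (v + w) = 0" by (metis \<phi>.hom_add add.right_inverse)
    then have dvd: "p dvd v + w" using \<phi>_zero by blast
    show "x = 0"
    proof (rule ccontr)
      assume "x \<noteq> 0"
      then have "\<not> p dvd v" using vw \<phi>_zero by blast
      then obtain c g v' where v': "0 < c" "\<not> p dvd g" "v' \<in> weighted_squares" "v = smult c (g\<^sup>2) + v'"
        using weighted_squares_nonzero_term[OF vw(3)] by blast
      obtain u s where us: "u * g + s * p = 1"
        using bezout[OF v'(2)] by blast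
      \<comment> \<open>Modulo \<open>p\<close> one has \<open>u * g = 1\<close> and
        \<open>smult c (g\<^sup>2) + v' + w = 0\<close>, hence \<open>w'\<close> is congruent to
        \<open>- 1\<close>.\<close>
      define w' where "w' = smult (1 / c) (u\<^sup>2) * (v' + w)"
      have "w' \<in> weighted_squares" unfolding w'_def
        using weighted_squares_scale[OF weighted_squares_add[OF v'(3) vw(4)]] v'(1) by simp
      moreover have "p dvd 1 + w'"
      proof -
        have "\<phi> u * \<phi> g = 1"
          using arg_cong[OF us, of \<phi>] \<alpha> by (simp add: \<phi>.hom_add \<phi>.hom_mult \<phi>.hom_one) (simp add: \<phi>_def)
        then have "\<phi> u ^ 2 * \<phi> g ^ 2 = 1" by (metis power_mult_distrib power_one)
        moreover have vw': "\<phi> v' + \<phi> w = - (rep_rc c * \<phi> g ^ 2)"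
          using \<open>\<phi> (v + w) = 0\<close> unfolding v'(4)
          by (simp add: \<phi>.hom_add \<phi>_smult \<phi>.hom_power eq_neg_iff_add_eq_0 algebra_simps)
        moreover have "rep_rc (1 / c) * rep_rc c = 1"
          using v'(1) by (simp flip: rep_rc.hom_mult add: rep_rc.hom_one)
        moreover have "\<phi> w' = rep_rc (1 / c) * \<phi> u ^ 2 * (\<phi> v' + \<phi> w)"
          unfolding w'_def by (simp only: \<phi>.hom_mult \<phi>.hom_add \<phi>_smult \<phi>.hom_power)
        then have "\<phi> w' = - (rep_rc (1 / c) * rep_rc c * (\<phi> u ^ 2 * \<phi> g ^ 2))"
          unfolding vw' by (simp only: mult_minus_right ac_simps)
        ultimately have "\<phi> (1 + w') = 0"
          by (simp only: \<phi>.hom_add \<phi>.hom_one) simp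
        then show ?thesis using \<phi>_zero by blast
      qed
      ultimately show False using sign_change_not_dvd[OF ab] by blast
    qed
  qed
  moreover have "x \<in> \<phi> ` weighted_squares" if x: "x \<in> real_cone" for x
  proof -
    obtain c where c: "0 \<le> c" "rep_rc c = x" using rep_rc_surj_on_cone[OF x] .
    then have "x = \<phi> (smult c (1\<^sup>2))" by (simp add: \<phi>_const)
    then show ?thesis using weighted_squares_single[OF c(1)] by blast
  qed
  ultimately have cone: "\<phi> ` weighted_squares = real_cone" using real_cone_maximal by blast
  have "\<phi> [:0, 1:] = \<alpha>" by (simp add: \<phi>_def rep_rc.map_poly_hom_pCons rep_rc.hom_zero rep_rc.hom_one)
  \<comment> \<open>The root is not itself known to be in the cone, but the squares of
    \<open>\<alpha> + 1\<close> and \<open>\<alpha> - 1\<close> are, and their difference is four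
    times \<open>\<alpha>\<close>. So \<open>\<alpha>\<close> lies in the real closure.\<close>
  moreover have "(\<phi> [:0, 1:] + 1)\<^sup>2 = \<phi> (smult 1 (([:0, 1:] + 1)\<^sup>2))" "(\<phi> [:0, 1:] - 1)\<^sup>2 = \<phi> (smult 1 (([:0, 1:] - 1)\<^sup>2))"
    by (simp_all only: smult_1_left \<phi>.hom_power \<phi>.hom_add \<phi>.hom_diff \<phi>.hom_one)
  ultimately have "(\<alpha> + 1)\<^sup>2 \<in> real_cone" "(\<alpha> - 1)\<^sup>2 \<in> real_cone"
    using cone weighted_squares_single[of 1] by auto
  then obtain x y where "rep_rc x = (\<alpha> + 1)\<^sup>2" "rep_rc y = (\<alpha> - 1)\<^sup>2"
    by (metis rep_rc_surj_on_cone)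
  moreover have "rep_rc (4 :: 'a real_closure) = 4" by (metis rep_rc.hom_add rep_rc.hom_one numeral_Bit0 numeral_One)
  moreover have "(\<alpha> + 1)\<^sup>2 - (\<alpha> - 1)\<^sup>2 = 4 * \<alpha>" by (simp add: power2_eq_square algebra_simps)
  ultimately have "rep_rc (x - y) = rep_rc 4 * \<alpha>" by (simp only: rep_rc.hom_diff)
  moreover have "rep_rc (1 / 4) * rep_rc (4 :: 'a real_closure) = 1"
    by (simp flip: rep_rc.hom_mult add: rep_rc.hom_one)
  ultimately have "rep_rc (1 / 4 * (x - y)) = \<alpha>"
    by (simp only: rep_rc.hom_mult mult.assoc[symmetric] mult_1_left)
  then have "rep_rc (poly p (1 / 4 * (x - y))) = 0"
    using rep_rc.poly_map_poly_hom[of p "1 / 4 * (x - y)"] \<alpha> by simp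
  then show ?thesis using rep_rc_eq_0_iff by blast
qed

text \<open>If \<open>p\<close> splits into factors of smaller degree, one of them changes sign as
  well. If it does not split, its root makes it linear, and a linear polynomial has its root where
  it changes sign.\<close>

lemma real_closure_sign_change_root:
  fixes p :: "'a::linordered_field real_closure poly"
  assumes "a < b" "poly p a * poly p b < 0"
  shows "\<exists>c. a < c \<and> c < b \<and> poly p c = 0"
  using assms(2)
proof (induction "degree p" arbitrary: p rule: less_induct)
  case less
  show ?case
  proof (cases "\<exists>g h. p = g * h \<and> degree g < degree p \<and> degree h < degree p")
    case True
    then obtain g h where gh: "p = g * h" "degree g < degree p" "degree h < degree p" by blast
    then have "poly g a * poly g b < 0 \<or> poly h a * poly h b < 0"
      using less.prems by (auto simp: mult_less_0_iff zero_less_mult_iff)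
    then show ?thesis using less.hyps[OF gh(2)] less.hyps[OF gh(3)] gh(1) by auto
  next
    case False
    then obtain c where c: "poly p c = 0" using irreducible_sign_change_root less.prems by blast
    then obtain k where k: "p = [:- c, 1:] * k" by (auto simp: poly_eq_0_iff_dvd)
    have "p \<noteq> 0" using less.prems by auto
    then have "k \<noteq> 0" using k by auto
    then have deg: "degree p = 1 + degree k" by (subst k, subst degree_mult_eq) auto
    have "degree k = 0"
    proof (rule ccontr)
      assume "degree k \<noteq> 0"
      then have "degree [:- c, 1:] < degree p \<and> degree k < degree p" using deg by simp
      then show False using False k by blast
    qed
    then obtain d where "k = [:d:]" by (rule degree_eq_zeroE)
    then have "poly p x = (x - c) * d" for x using k by (simp add: algebra_simps)
    then have "(a - c) * d * ((b - c) * d) < 0" using less.prems by simp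
    then have "(a - c) * (b - c) < 0"
      by (auto simp: mult_less_0_iff zero_less_mult_iff)
    then have "a < c" "c < b" using assms(1) by (auto simp: mult_less_0_iff)
    then show ?thesis using c by blast
  qed
qed

instance real_closure :: (linordered_field) real_closed_field
proof
  fix a b :: "'a real_closure" and n :: nat and f :: "nat \<Rightarrow> 'a real_closure"
  assume "a < b" "(\<Sum>k\<le>n. f k * a ^ k) < 0" "0 < (\<Sum>k\<le>n. f k * b ^ k)"
  then show "\<exists>c. a < c \<and> c < b \<and> (\<Sum>k\<le>n. f k * c ^ k) = 0"
    using real_closure_sign_change_root[of a b "\<Sum>k\<le>n. monom (f k) k"]
    by (simp add: poly_sum_monom mult_neg_pos)
qed

subsection \<open>Elimination of variables\<close>

lemma poly_eval_superset:
  assumes "finite A" "Poly_Mapping.keys p \<subseteq> A"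
  shows "poly_eval p a = (\<Sum>\<alpha>\<in>A. Poly_Mapping.lookup p \<alpha> * (\<Prod>i\<in>UNIV. (a $ i) ^ Poly_Mapping.lookup \<alpha> i))"
  unfolding poly_eval_def
  by (intro sum.mono_neutral_left assms) (auto simp: in_keys_iff)

lemma poly_eval_add: "poly_eval (p + q) a = poly_eval p a + poly_eval q a"
  using poly_eval_superset[of "Poly_Mapping.keys p \<union> Poly_Mapping.keys q" "p + q" a]
    poly_eval_superset[of "Poly_Mapping.keys p \<union> Poly_Mapping.keys q" p a]
    poly_eval_superset[of "Poly_Mapping.keys p \<union> Poly_Mapping.keys q" q a] keys_add[of p q]
  by (simp add: lookup_add distrib_right sum.distrib)

lemma poly_eval_zero: "poly_eval 0 a = 0"
  by (simp add: poly_eval_def)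

lemma poly_eval_sum: "poly_eval (sum f A) a = (\<Sum>x\<in>A. poly_eval (f x) a)"
  by (induction A rule: infinite_finite_induct) (simp_all add: poly_eval_zero poly_eval_add)

lemma poly_eval_single:
  "poly_eval (Poly_Mapping.single \<alpha> c) a = c * (\<Prod>i\<in>UNIV. (a $ i) ^ Poly_Mapping.lookup \<alpha> i)"
  by (subst poly_eval_superset[of "{\<alpha>}"]) auto

lemma sum_of_monomials:
  "p = (\<Sum>\<alpha>\<in>Poly_Mapping.keys p. Poly_Mapping.single \<alpha> (Poly_Mapping.lookup p \<alpha>))"
proof (intro poly_mapping_eqI)
  fix k
  have "(\<Sum>\<alpha>\<in>Poly_Mapping.keys p. Poly_Mapping.lookup (Poly_Mapping.single \<alpha> (Poly_Mapping.lookup p \<alpha>)) k)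
      = (\<Sum>\<alpha>\<in>Poly_Mapping.keys p. if \<alpha> = k then Poly_Mapping.lookup p k else 0)"
    by (intro sum.cong) (auto simp: lookup_single)
  then show "Poly_Mapping.lookup p k = Poly_Mapping.lookup
      (\<Sum>\<alpha>\<in>Poly_Mapping.keys p. Poly_Mapping.single \<alpha> (Poly_Mapping.lookup p \<alpha>)) k"
    by (simp add: lookup_sum sum.delta in_keys_iff)
qed

lemma poly_eval_mult: "poly_eval (p * q) a = poly_eval p a * poly_eval q a"
proof -
  let ?m = "\<lambda>\<alpha>. \<Prod>i\<in>UNIV. (a $ i) ^ Poly_Mapping.lookup \<alpha> i"
  have "p * q = (\<Sum>\<alpha>\<in>Poly_Mapping.keys p. \<Sum>\<beta>\<in>Poly_Mapping.keys q.
      Poly_Mapping.single (\<alpha> + \<beta>) (Poly_Mapping.lookup p \<alpha> * Poly_Mapping.lookup q \<beta>))"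
    by (subst sum_of_monomials[of p], subst sum_of_monomials[of q]) (simp add: sum_product mult_single)
  also have "poly_eval \<dots> a = (\<Sum>\<alpha>\<in>Poly_Mapping.keys p. \<Sum>\<beta>\<in>Poly_Mapping.keys q.
      (Poly_Mapping.lookup p \<alpha> * ?m \<alpha>) * (Poly_Mapping.lookup q \<beta> * ?m \<beta>))"
    by (simp add: poly_eval_sum poly_eval_single lookup_add power_add prod.distrib mult_ac)
  also have "\<dots> = poly_eval p a * poly_eval q a"
    by (simp add: poly_eval_def sum_product)
  finally show ?thesis .
qed

lemma poly_eval_one: "poly_eval 1 a = 1"
  using poly_eval_single[of 0 1 a] by simp

lemma poly_eval_hom: "comm_ring_hom (\<lambda>p. poly_eval p a)"
  by unfold_locales (simp_all add: poly_eval_add poly_eval_mult poly_eval_one)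

interpretation poly_eval: comm_ring_hom "\<lambda>p. poly_eval p a" for a
  by (rule poly_eval_hom)

definition const_poly :: "real \<Rightarrow> 'e rpoly" where
  "const_poly c = Poly_Mapping.single 0 c"

definition var :: "'e \<Rightarrow> 'e rpoly" where
  "var i = Poly_Mapping.single (Poly_Mapping.single i 1) 1"

lemma poly_eval_const: "poly_eval (const_poly c) a = c"
  by (simp add: const_poly_def poly_eval_single)

lemma poly_eval_var: "poly_eval (var i) a = a $ i"
proof -
  have "(\<Prod>j\<in>UNIV. (a $ j) ^ Poly_Mapping.lookup (Poly_Mapping.single i 1) j) = (\<Prod>j\<in>UNIV. if j = i then a $ i else 1)"
    by (intro prod.cong) (auto simp: lookup_single)
  then show ?thesis by (simp add: var_def poly_eval_single)
qed

text \<open>Elimination shrinks the set of variables allowed to occur, while the polynomial ring,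
  and hence the type, stays fixed.\<close>

inductive_set poly_in :: "'e set \<Rightarrow> 'e rpoly set" for S where
  const: "const_poly c \<in> poly_in S"
| var: "i \<in> S \<Longrightarrow> var i \<in> poly_in S"
| add: "p \<in> poly_in S \<Longrightarrow> q \<in> poly_in S \<Longrightarrow> p + q \<in> poly_in S"
| mult: "p \<in> poly_in S \<Longrightarrow> q \<in> poly_in S \<Longrightarrow> p * q \<in> poly_in S"

lemma const_poly_simps: "const_poly 0 = 0" "const_poly 1 = 1"
  "const_poly a + const_poly b = const_poly (a + b)" "const_poly a * const_poly b = const_poly (a * b)"
  "- const_poly a = const_poly (- a)"
  by (simp_all add: const_poly_def single_add mult_single single_uminus)

lemma poly_in_0: "0 \<in> poly_in S" and poly_in_1: "1 \<in> poly_in S"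
  using poly_in.const[of 0 S] poly_in.const[of 1 S] by (simp_all add: const_poly_simps)

lemma poly_in_uminus: "p \<in> poly_in S \<Longrightarrow> - p \<in> poly_in S"
  using poly_in.mult[OF poly_in.const[of "- 1" S], of p] by (simp add: const_poly_def single_uminus)

lemma poly_in_diff: "p \<in> poly_in S \<Longrightarrow> q \<in> poly_in S \<Longrightarrow> p - q \<in> poly_in S"
  using poly_in.add[OF _ poly_in_uminus, of p S q] by simp

lemma poly_in_sum: "(\<And>x. x \<in> A \<Longrightarrow> f x \<in> poly_in S) \<Longrightarrow> sum f A \<in> poly_in S"
  by (induction A rule: infinite_finite_induct) (auto intro: poly_in_0 poly_in.add)

lemma poly_in_of_nat: "of_nat n \<in> poly_in S"
  by (induction n) (auto intro: poly_in_0 poly_in_1 poly_in.add)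

lemma monomial_in_UNIV:
  fixes \<alpha> :: "'e::finite \<Rightarrow>\<^sub>0 nat"
  shows "Poly_Mapping.single \<alpha> c \<in> poly_in UNIV"
proof -
  have power: "Poly_Mapping.single (Poly_Mapping.single i n) 1 \<in> poly_in UNIV" for i :: 'e and n
  proof (induction n)
    case 0
    show ?case using poly_in_1 by simp
  next
    case (Suc n)
    have "Poly_Mapping.single (Poly_Mapping.single i (Suc n)) (1 :: real)
        = var i * Poly_Mapping.single (Poly_Mapping.single i n) 1"
      by (simp add: var_def mult_single flip: single_add)
    then show ?case using Suc by (simp add: poly_in.mult poly_in.var)
  qed
  have "Poly_Mapping.single (\<Sum>i\<in>T. Poly_Mapping.single i (Poly_Mapping.lookup \<alpha> i)) c \<in> poly_in UNIV"
    if "finite T" for T :: "'e set"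
    using that
  proof (induction T)
    case empty
    show ?case using poly_in.const[of c] by (simp add: const_poly_def)
  next
    case (insert i T)
    have "Poly_Mapping.single (\<Sum>i\<in>insert i T. Poly_Mapping.single i (Poly_Mapping.lookup \<alpha> i)) c
      = Poly_Mapping.single (Poly_Mapping.single i (Poly_Mapping.lookup \<alpha> i)) 1
        * Poly_Mapping.single (\<Sum>i\<in>T. Poly_Mapping.single i (Poly_Mapping.lookup \<alpha> i)) c"
      using insert by (simp add: mult_single)
    then show ?case using insert power by (simp add: poly_in.mult)
  qed
  moreover have "(\<Sum>i\<in>UNIV. Poly_Mapping.single i (Poly_Mapping.lookup \<alpha> i)) = \<alpha>"
  proof (intro poly_mapping_eqI)
    fix k
    have "(\<Sum>i\<in>UNIV. Poly_Mapping.lookup (Poly_Mapping.single i (Poly_Mapping.lookup \<alpha> i)) k)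
        = (\<Sum>i\<in>UNIV. if i = k then Poly_Mapping.lookup \<alpha> k else 0)"
      by (intro sum.cong) (auto simp: lookup_single)
    then show "Poly_Mapping.lookup (\<Sum>i\<in>UNIV. Poly_Mapping.single i (Poly_Mapping.lookup \<alpha> i)) k
        = Poly_Mapping.lookup \<alpha> k"
      by (simp add: lookup_sum)
  qed
  ultimately show ?thesis by (metis finite)
qed

lemma poly_in_UNIV: "(p :: 'e::finite rpoly) \<in> poly_in UNIV"
  by (subst sum_of_monomials) (intro poly_in_sum monomial_in_UNIV)

lemma poly_eval_cong_on:
  assumes "p \<in> poly_in S" "\<And>i. i \<in> S \<Longrightarrow> a $ i = b $ i"
  shows "poly_eval p a = poly_eval p b"
  using assms(1)
  by (induction) (simp_all add: poly_eval_const poly_eval_var assms(2) poly_eval_add poly_eval_mult)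

lemma poly_in_insert_expand:
  fixes p :: "'e::finite rpoly"
  assumes "p \<in> poly_in (insert k S)"
  shows "\<exists>P. (\<forall>n. coeff P n \<in> poly_in S) \<and> poly P (var k) = p"
  using assms
proof induction
  case (const c)
  show ?case
    by (rule exI[of _ "[:const_poly c:]"]) (auto simp: coeff_pCons poly_in.const poly_in_0 split: nat.split)
next
  case (var i)
  show ?case
  proof (cases "i = k")
    case True
    then show ?thesis
      by (intro exI[of _ "[:0, 1:]"]) (auto simp: coeff_pCons poly_in_0 poly_in_1 split: nat.split)
  next
    case False
    then show ?thesis using var
      by (intro exI[of _ "[:var i:]"]) (auto simp: coeff_pCons poly_in_0 poly_in.var split: nat.split)
  qed
next
  case (add p q)
  then obtain P Q where "\<forall>n. coeff P n \<in> poly_in S" "poly P (var k) = p" "\<forall>n. coeff Q n \<in> poly_in S" "poly Q (var k) = q"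
    by blast
  then show ?case by (intro exI[of _ "P + Q"]) (auto intro: poly_in.add)
next
  case (mult p q)
  then obtain P Q where "\<forall>n. coeff P n \<in> poly_in S" "poly P (var k) = p" "\<forall>n. coeff Q n \<in> poly_in S" "poly Q (var k) = q"
    by blast
  then show ?case by (intro exI[of _ "P * Q"]) (auto intro!: poly_in_sum poly_in.mult simp: coeff_mult)
qed

section \<open>Pseudo-remainders and the closure of a family under elimination\<close>

lemma pseudo_division:
  fixes f g :: "'e::finite rpoly poly"
  assumes "0 < degree g"
  shows "\<exists>r. degree r < degree g \<and> (\<exists>n Q. smult (lead_coeff g ^ n) f = Q * g + r) \<and>
    (\<forall>S. (\<forall>n. coeff f n \<in> poly_in S) \<longrightarrow> (\<forall>n. coeff g n \<in> poly_in S) \<longrightarrow> (\<forall>n. coeff r n \<in> poly_in S))"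
proof (induction "degree f" arbitrary: f rule: less_induct)
  case less
  show ?case
  proof (cases "degree f < degree g")
    case True
    have "smult (lead_coeff g ^ 0) f = 0 * g + f" by simp
    then show ?thesis using True by blast
  next
    case False
    define m where "m = monom (lead_coeff f) (degree f - degree g)"
    \<comment> \<open>Multiplying \<open>f\<close> by the leading coefficient of \<open>g\<close>
      lets its top term be cancelled without a division.\<close>
    define f1 where "f1 = smult (lead_coeff g) f - m * g"
    have "degree f1 < degree f"
    proof -
      have "coeff f1 k = 0" if "k \<ge> degree f" for k
      proof (cases "k = degree f")
        case True
        then show ?thesis using False by (simp add: f1_def m_def coeff_monom_mult)
      next
        case False
        then show ?thesis using that \<open>\<not> degree f < degree g\<close>
          by (simp add: f1_def m_def coeff_monom_mult coeff_eq_0)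
      qed
      moreover have "degree f > 0" using False assms by simp
      ultimately show ?thesis by (metis degree_0 leading_coeff_0_iff not_le)
    qed
    from less[OF this] obtain r n Q where r: "degree r < degree g" "smult (lead_coeff g ^ n) f1 = Q * g + r"
      and coeffs: "\<And>S. (\<forall>n. coeff f1 n \<in> poly_in S) \<Longrightarrow> (\<forall>n. coeff g n \<in> poly_in S) \<Longrightarrow> (\<forall>n. coeff r n \<in> poly_in S)"
      by blast
    have "smult (lead_coeff g ^ Suc n) f = smult (lead_coeff g ^ n) (f1 + m * g)"
      by (simp add: f1_def mult.commute)
    also have "\<dots> = (Q + smult (lead_coeff g ^ n) m) * g + r"
      by (simp add: smult_add_right r(2) algebra_simps)
    finally have "\<exists>n Q. smult (lead_coeff g ^ n) f = Q * g + r" by blast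
    moreover have "coeff r n \<in> poly_in S" if "\<forall>n. coeff f n \<in> poly_in S" "\<forall>n. coeff g n \<in> poly_in S" for S n
    proof -
      have "coeff f1 k \<in> poly_in S" for k
        using that by (auto simp: f1_def m_def coeff_monom_mult poly_in_0 intro!: poly_in_diff poly_in.mult poly_in_uminus)
      then show ?thesis using coeffs that by blast
    qed
    ultimately show ?thesis using r(1) by blast
  qed
qed

text \<open>The clause on \<open>S\<close> sits inside the choice so that one fixed remainder serves
  all variable sets at once.\<close>

definition pseudo_rem :: "'e::finite rpoly poly \<Rightarrow> 'e rpoly poly \<Rightarrow> 'e rpoly poly" where
  "pseudo_rem f g = (SOME r. degree r < degree g \<and> (\<exists>n Q. smult (lead_coeff g ^ n) f = Q * g + r) \<and>
    (\<forall>S. (\<forall>n. coeff f n \<in> poly_in S) \<longrightarrow> (\<forall>n. coeff g n \<in> poly_in S) \<longrightarrow> (\<forall>n. coeff r n \<in> poly_in S)))"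

lemma pseudo_rem:
  assumes "0 < degree g"
  shows "degree (pseudo_rem f g) < degree g"
    and "\<exists>n Q. smult (lead_coeff g ^ n) f = Q * g + pseudo_rem f g"
    and "(\<And>n. coeff f n \<in> poly_in S) \<Longrightarrow> (\<And>n. coeff g n \<in> poly_in S) \<Longrightarrow> coeff (pseudo_rem f g) n \<in> poly_in S"
  using someI_ex[OF pseudo_division[OF assms, of f]] unfolding pseudo_rem_def by blast+

text \<open>A specialisation that kills the leading coefficient does not distinguish
  \<open>f\<close> from its truncation. Keeping truncations in the family makes it possible to
  follow drops in degree.\<close>

definition truncation :: "'e::finite rpoly poly \<Rightarrow> 'e rpoly poly" where
  "truncation f = f - monom (lead_coeff f) (degree f)"

lemma degree_truncation: "0 < degree f \<Longrightarrow> degree (truncation f) < degree f"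
proof -
  assume "0 < degree f"
  moreover have "coeff (truncation f) k = 0" if "k \<ge> degree f" for k
    using that by (cases "k = degree f") (auto simp: truncation_def coeff_eq_0)
  ultimately show ?thesis by (metis degree_0 leading_coeff_0_iff not_le)
qed

text \<open>The library derivative \<^const>\<open>pderiv\<close> needs coefficients without zero divisors.\<close>

definition formal_deriv :: "'a::comm_ring_1 poly \<Rightarrow> 'a poly" where
  "formal_deriv f = (\<Sum>k\<le>degree f. monom (of_nat (Suc k) * coeff f (Suc k)) k)"

lemma coeff_formal_deriv: "coeff (formal_deriv f) n = of_nat (Suc n) * coeff f (Suc n)"
  by (auto simp: formal_deriv_def Polynomial.coeff_sum coeff_eq_0 if_distrib cong: if_cong)

inductive_set elimination_closure :: "'e::finite rpoly poly set \<Rightarrow> 'e rpoly poly set" for \<Psi> where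
  base: "f \<in> \<Psi> \<Longrightarrow> f \<in> elimination_closure \<Psi>"
| zero: "0 \<in> elimination_closure \<Psi>"
| trunc: "f \<in> elimination_closure \<Psi> \<Longrightarrow> 0 < degree f \<Longrightarrow> truncation f \<in> elimination_closure \<Psi>"
| deriv: "f \<in> elimination_closure \<Psi> \<Longrightarrow> 0 < degree f \<Longrightarrow> formal_deriv f \<in> elimination_closure \<Psi>"
| rem: "f \<in> elimination_closure \<Psi> \<Longrightarrow> g \<in> elimination_closure \<Psi> \<Longrightarrow> 0 < degree g \<Longrightarrow> degree g \<le> degree f \<Longrightarrow>
    pseudo_rem f g \<in> elimination_closure \<Psi>"

lemma degree_formal_deriv_less:
  fixes f :: "'a::comm_ring_1 poly"
  shows "0 < degree f \<Longrightarrow> degree (formal_deriv f) < degree f"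
proof -
  assume "0 < degree f"
  moreover have "coeff (formal_deriv f) k = 0" if "k \<ge> degree f" for k
    using that by (simp add: coeff_formal_deriv coeff_eq_0)
  ultimately show ?thesis by (metis degree_0 leading_coeff_0_iff not_le)
qed

text \<open>Every operation lowers the degree, so the closure is finite: the elements of degree at least \<open>n\<close>
  are obtained from those of degree greater than \<open>n\<close>.\<close>

lemma finite_elimination_closure:
  assumes "finite \<Psi>"
  shows "finite (elimination_closure \<Psi>)"
proof -
  define N where "N = Max (insert 0 (degree ` \<Psi>))"
  have N: "degree f \<le> N" if "f \<in> \<Psi>" for f
    unfolding N_def using assms that by (intro Max_ge) auto
  have bound: "degree f \<le> N" if "f \<in> elimination_closure \<Psi>" for f
    using that
  proof induction
    case (trunc f)
    then show ?case using degree_truncation[of f] by simp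
  next
    case (deriv f)
    then show ?case using degree_formal_deriv_less[of f] by simp
  next
    case (rem f g)
    then show ?case using pseudo_rem(1)[of g f] by simp
  qed (use N in auto)
  have "finite {f \<in> elimination_closure \<Psi>. N < degree f + m}" for m
  proof (induction m)
    case 0
    have empty: "{f \<in> elimination_closure \<Psi>. N < degree f + 0} = {}" using bound by force
    show ?case unfolding empty by simp
  next
    case (Suc m)
    define A where "A = {f \<in> elimination_closure \<Psi>. N < degree f + m}"
    have "{f \<in> elimination_closure \<Psi>. N < degree f + Suc m} \<subseteq>
      insert 0 \<Psi> \<union> truncation ` A \<union> formal_deriv ` A \<union> (\<lambda>(f, g). pseudo_rem f g) ` (A \<times> A)"
    proof
      fix f assume "f \<in> {f \<in> elimination_closure \<Psi>. N < degree f + Suc m}"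
      then have f: "f \<in> elimination_closure \<Psi>" "N < degree f + Suc m" by simp_all
      from f(1) show "f \<in> insert 0 \<Psi> \<union> truncation ` A \<union> formal_deriv ` A \<union> (\<lambda>(f, g). pseudo_rem f g) ` (A \<times> A)"
      proof cases
        case (trunc g)
        then have "g \<in> A" using degree_truncation[of g] f(2) by (simp add: A_def)
        then show ?thesis using trunc by blast
      next
        case (deriv g)
        then have "g \<in> A" using degree_formal_deriv_less[of g] f(2) by (simp add: A_def)
        then show ?thesis using deriv by blast
      next
        case (rem g h)
        then have "(g, h) \<in> A \<times> A" using pseudo_rem(1)[of h g] f(2) by (simp add: A_def)
        then show ?thesis using rem by force
      qed auto
    qed
    moreover have "finite A" using Suc by (simp add: A_def)
    ultimately show ?case using assms by (blast intro: finite_subset)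
  qed
  from this[of "Suc N"] show ?thesis by simp
qed

lemma elimination_closure_coeffs:
  assumes "f \<in> elimination_closure \<Psi>" "\<And>f n. f \<in> \<Psi> \<Longrightarrow> coeff f n \<in> poly_in S"
  shows "coeff f n \<in> poly_in S"
  using assms(1)
proof (induction arbitrary: n)
  case (trunc f)
  then show ?case by (auto simp: truncation_def poly_in_0 intro: poly_in_diff)
next
  case (deriv f)
  then show ?case using poly_in.mult[OF poly_in_of_nat[of "Suc n" S]] by (simp add: coeff_formal_deriv)
next
  case (rem f g)
  then show ?case by (intro pseudo_rem(3)) auto
qed (use assms(2) in \<open>auto simp: poly_in_0\<close>)

lemma map_poly_truncation:
  assumes "comm_ring_hom e" "e (lead_coeff f) = 0"
  shows "map_poly e (truncation f) = map_poly e f"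
proof -
  interpret comm_ring_hom e by fact
  show ?thesis
    by (intro poly_eqI) (auto simp: coeff_map_poly hom_zero truncation_def hom_diff assms(2))
qed

lemma map_poly_formal_deriv:
  fixes e :: "'a::comm_ring_1 \<Rightarrow> 'b::idom"
  assumes "comm_ring_hom e"
  shows "map_poly e (formal_deriv f) = pderiv (map_poly e f)"
proof -
  interpret comm_ring_hom e by fact
  have "e (of_nat n) = of_nat n" for n by (induction n) (simp_all add: hom_zero hom_one hom_add)
  then show ?thesis
    by (intro poly_eqI) (simp only: coeff_map_poly[of e, OF hom_zero] coeff_formal_deriv coeff_pderiv hom_mult)
qed

text \<open>Two specialisations \<open>e\<close>, \<open>e'\<close> of the coefficients that agree in sign on all coefficients occurring
  in the closure yield parallel families of polynomials in one variable.\<close>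

lemma specialisation_transfer:
  fixes e :: "'e::finite rpoly \<Rightarrow> 'k::real_closed_field" and e' :: "'e rpoly \<Rightarrow> 'l::real_closed_field"
  assumes hom: "comm_ring_hom e" "comm_ring_hom e'" and fin: "finite \<Psi>"
    and signs: "\<And>f n. f \<in> elimination_closure \<Psi> \<Longrightarrow> same_sign (e (coeff f n)) (e' (coeff f n))"
  shows "\<exists>y'. \<forall>f\<in>\<Psi>. same_sign (poly (map_poly e f) y) (poly (map_poly e' f) y')"
proof -
  interpret e: comm_ring_hom e by fact
  interpret e': comm_ring_hom e' by fact
  define C where "C = elimination_closure \<Psi>"
  \<comment> \<open>Only members whose leading coefficient survives are kept, so specialisation
    preserves their degrees. Every other member is replaced, through \<open>reduce\<close>, by an
    iterated truncation with the same two images.\<close>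
  define I where "I = {f \<in> C. f = 0 \<or> e (lead_coeff f) \<noteq> 0}"
  have zero_iff: "e (coeff f n) = 0 \<longleftrightarrow> e' (coeff f n) = 0" if "f \<in> C" for f n
    using same_sign_zero_iff[OF signs] that by (simp add: C_def)
  have reduce: "\<exists>f'\<in>I. degree f' \<le> degree f \<and> map_poly e f' = map_poly e f \<and> map_poly e' f' = map_poly e' f"
    if "f \<in> C" for f
    using that
  proof (induction "degree f" arbitrary: f rule: less_induct)
    case less
    show ?case
    proof (cases "f \<in> I")
      case False
      then have z: "e (lead_coeff f) = 0" "e' (lead_coeff f) = 0" "f \<noteq> 0" using less(2) zero_iff by (auto simp: I_def)
      have eq: "map_poly e (truncation f) = map_poly e f" "map_poly e' (truncation f) = map_poly e' f"
        using map_poly_truncation hom z by blast+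
      show ?thesis
      proof (cases "degree f = 0")
        case True
        then obtain c where "f = [:c:]" by (rule degree_eq_zeroE)
        then have "truncation f = 0" by (simp add: truncation_def monom_0)
        moreover have "0 \<in> I" by (simp add: I_def C_def elimination_closure.zero)
        ultimately show ?thesis using eq by (intro bexI[of _ 0]) auto
      next
        case False
        then have "truncation f \<in> C" "degree (truncation f) < degree f"
          using less(2) degree_truncation by (auto simp: C_def intro: elimination_closure.trunc)
        then obtain f' where "f' \<in> I" "degree f' \<le> degree (truncation f)"
          "map_poly e f' = map_poly e (truncation f)" "map_poly e' f' = map_poly e' (truncation f)"
          using less(1) by blast
        then show ?thesis using eq \<open>degree (truncation f) < degree f\<close> by (intro bexI[of _ f']) auto
      qed
    qed auto
  qed
  have deg: "degree (map_poly e f) = degree f" "degree (map_poly e' f) = degree f" if "f \<in> I" for f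
  proof -
    have "f = 0 \<or> e (lead_coeff f) \<noteq> 0" "f = 0 \<or> e' (lead_coeff f) \<noteq> 0" using that zero_iff by (auto simp: I_def)
    then show "degree (map_poly e f) = degree f" "degree (map_poly e' f) = degree f"
      using map_poly_degree_eq[of e f] map_poly_degree_eq[of e' f] by auto
  qed
  interpret parallel_families I "map_poly e" "map_poly e'"
  proof
    show "finite I" using finite_elimination_closure[OF fin] by (simp add: I_def C_def)
    show "degree (map_poly e' f) = degree (map_poly e f)" if "f \<in> I" for f
      using deg that by simp
    show "same_sign (lead_coeff (map_poly e f)) (lead_coeff (map_poly e' f))" if "f \<in> I" for f
      using that deg[OF that] signs[of f "degree f"] by (simp add: coeff_map_poly e.hom_zero e'.hom_zero I_def C_def)
    show "\<exists>j\<in>I. map_poly e j = pderiv (map_poly e f) \<and> map_poly e' j = pderiv (map_poly e' f)"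
      if f: "f \<in> I" "0 < degree (map_poly e f)" for f
    proof -
      have "formal_deriv f \<in> C" using f deg by (auto simp: I_def C_def intro: elimination_closure.deriv)
      then show ?thesis using reduce[of "formal_deriv f"] hom by (auto simp: map_poly_formal_deriv)
    qed
    show "\<exists>j\<in>I. degree (map_poly e j) < degree (map_poly e g) \<and> (\<exists>c c' Q Q'. same_sign c c' \<and> c \<noteq> 0 \<and>
         smult c (map_poly e f) = Q * map_poly e g + map_poly e j \<and>
         smult c' (map_poly e' f) = Q' * map_poly e' g + map_poly e' j)"
      if fg: "f \<in> I" "g \<in> I" "0 < degree (map_poly e g)" "degree (map_poly e g) \<le> degree (map_poly e f)" for f g
    proof -
      have g: "0 < degree g" "degree g \<le> degree f" "g \<in> C" "f \<in> C" "e (lead_coeff g) \<noteq> 0"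
        using fg deg by (auto simp: I_def)
      then have "pseudo_rem f g \<in> C" by (simp add: C_def elimination_closure.rem)
      then obtain j where j: "j \<in> I" "degree j \<le> degree (pseudo_rem f g)"
        "map_poly e j = map_poly e (pseudo_rem f g)" "map_poly e' j = map_poly e' (pseudo_rem f g)"
        using reduce by blast
      obtain n Q where Q: "smult (lead_coeff g ^ n) f = Q * g + pseudo_rem f g"
        using pseudo_rem(2)[OF g(1)] by blast
      have "smult (e (lead_coeff g) ^ n) (map_poly e f) = map_poly e Q * map_poly e g + map_poly e j"
        using arg_cong[OF Q, of "map_poly e"] j(3)
        by (simp add: e.map_poly_hom_smult e.map_poly_hom_add e.map_poly_hom_mult e.hom_power)
      moreover have "smult (e' (lead_coeff g) ^ n) (map_poly e' f) = map_poly e' Q * map_poly e' g + map_poly e' j"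
        using arg_cong[OF Q, of "map_poly e'"] j(4)
        by (simp add: e'.map_poly_hom_smult e'.map_poly_hom_add e'.map_poly_hom_mult e'.hom_power)
      moreover have "same_sign (e (lead_coeff g) ^ n) (e' (lead_coeff g) ^ n)"
        using signs[of g "degree g"] g(3) by (intro same_sign_power) (simp add: C_def)
      moreover have "degree (map_poly e j) < degree (map_poly e g)"
        using deg[OF j(1)] deg[OF fg(2)] j(2) pseudo_rem(1)[OF g(1), of f] by simp
      ultimately show ?thesis using j(1) g(5) power_not_zero by blast
    qed
  qed
  obtain y' where y': "same_signs_on I y y'" using same_signs_transfer by blast
  have "same_sign (poly (map_poly e f) y) (poly (map_poly e' f) y')" if f: "f \<in> \<Psi>" for f
  proof -
    have "f \<in> C" using f by (simp add: C_def elimination_closure.base)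
    then obtain f' where "f' \<in> I" "map_poly e f' = map_poly e f" "map_poly e' f' = map_poly e' f" using reduce by blast
    moreover from y' \<open>f' \<in> I\<close> have "same_sign (poly (map_poly e f') y) (poly (map_poly e' f') y')"
      unfolding same_signs_on_def by (rule bspec)
    ultimately show ?thesis by (simp only:)
  qed
  then show ?thesis by blast
qed

text \<open>To add the variable \<open>k\<close>, read the polynomials as univariate in it, apply
  the induction hypothesis to all coefficients of their elimination closure, and let
  \<open>specialisation_transfer\<close> choose the value of the new coordinate.\<close>

theorem real_point_same_signs:
  fixes e :: "'e::finite rpoly \<Rightarrow> 'k::real_closed_field"
  assumes "comm_ring_hom e" and const: "\<And>c. same_sign (e (const_poly c)) c"
    and "finite S" "finite \<Phi>" "\<Phi> \<subseteq> poly_in S"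
  shows "\<exists>a. \<forall>\<phi>\<in>\<Phi>. same_sign (e \<phi>) (poly_eval \<phi> a)"
  using assms(3-)
proof (induction S arbitrary: \<Phi> rule: finite_induct)
  case empty
  have "\<exists>c. p = const_poly c" if "p \<in> poly_in {}" for p :: "'e rpoly"
    using that by (induction) (auto simp: const_poly_simps)
  then have "same_sign (e \<phi>) (poly_eval \<phi> 0)" if "\<phi> \<in> \<Phi>" for \<phi>
    using empty that const poly_eval_const by (metis subsetD)
  then show ?case by blast
next
  case (insert k S)
  interpret e: comm_ring_hom e by fact
  have "\<forall>\<phi>\<in>\<Phi>. \<exists>P. (\<forall>n. coeff P n \<in> poly_in S) \<and> poly P (var k) = \<phi>"
    using insert.prems poly_in_insert_expand by blast
  then obtain P where P: "\<And>\<phi> n. \<phi> \<in> \<Phi> \<Longrightarrow> coeff (P \<phi>) n \<in> poly_in S" "\<And>\<phi>. \<phi> \<in> \<Phi> \<Longrightarrow> poly (P \<phi>) (var k) = \<phi>"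
    by metis
  define C where "C = elimination_closure (P ` \<Phi>)"
  have coeffs: "coeff f n \<in> poly_in S" if "f \<in> C" for f n
    using elimination_closure_coeffs[of f "P ` \<Phi>" S] that P(1) by (auto simp: C_def)
  have "finite C" unfolding C_def using insert.prems by (intro finite_elimination_closure) simp
  define \<Gamma> where "\<Gamma> = (\<Union>f\<in>C. (\<lambda>n. coeff f n) ` {..Suc (degree f)})"
  have "finite \<Gamma>" "\<Gamma> \<subseteq> poly_in S" using \<open>finite C\<close> coeffs by (auto simp: \<Gamma>_def)
  from insert.IH[OF this] obtain a where a: "\<And>c. c \<in> \<Gamma> \<Longrightarrow> same_sign (e c) (poly_eval c a)" by blast
  have "same_sign (e (coeff f n)) (poly_eval (coeff f n) a)" if "f \<in> C" for f n
  proof (cases "n \<le> degree f")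
    case True
    then have "coeff f n \<in> \<Gamma>" unfolding \<Gamma>_def by (intro UN_I[OF that] imageI) simp
    then show ?thesis by (rule a)
  next
    case False
    then show ?thesis by (simp add: coeff_eq_0 e.hom_zero poly_eval_zero same_sign_zero)
  qed
  then obtain y' where y': "\<And>f. f \<in> P ` \<Phi> \<Longrightarrow>
      same_sign (poly (map_poly e f) (e (var k))) (poly (map_poly (\<lambda>p. poly_eval p a) f) y')"
    using specialisation_transfer[OF assms(1) poly_eval_hom, of "P ` \<Phi>" a "e (var k)"] insert.prems(1)
    unfolding C_def by blast
  define b where "b = (\<chi> i. if i = k then y' else a $ i)"
  have "same_sign (e \<phi>) (poly_eval \<phi> b)" if \<phi>: "\<phi> \<in> \<Phi>" for \<phi>
  proof -
    have "map_poly (\<lambda>p. poly_eval p a) (P \<phi>) = map_poly (\<lambda>p. poly_eval p b) (P \<phi>)"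
    proof (intro poly_eqI)
      fix n
      have "poly_eval (coeff (P \<phi>) n) a = poly_eval (coeff (P \<phi>) n) b"
        using P(1)[OF \<phi>] insert.hyps(2) by (intro poly_eval_cong_on[where S = S]) (auto simp: b_def)
      then show "coeff (map_poly (\<lambda>p. poly_eval p a) (P \<phi>)) n = coeff (map_poly (\<lambda>p. poly_eval p b) (P \<phi>)) n"
        by (simp add: coeff_map_poly poly_eval_zero)
    qed
    moreover have "poly_eval (var k) b = y'" by (simp add: poly_eval_var b_def)
    ultimately have "poly (map_poly (\<lambda>p. poly_eval p a) (P \<phi>)) y' = poly_eval \<phi> b"
      using poly_eval.poly_map_poly_hom[of b "P \<phi>" "var k"] P(2)[OF \<phi>] by simp
    moreover have "poly (map_poly e (P \<phi>)) (e (var k)) = e \<phi>"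
      using e.poly_map_poly_hom[of "P \<phi>" "var k"] P(2)[OF \<phi>] by simp
    ultimately show ?thesis using y'[of "P \<phi>"] \<phi> by simp
  qed
  then show ?case by blast
qed

subsection \<open>Maximal preorderings\<close>

definition ring_preordering :: "'a::comm_ring_1 set \<Rightarrow> bool" where
  "ring_preordering P \<longleftrightarrow> (\<forall>x\<in>P. \<forall>y\<in>P. x + y \<in> P \<and> x * y \<in> P) \<and> (\<forall>x. x\<^sup>2 \<in> P) \<and> - 1 \<notin> P"

lemma preorderingD:
  assumes "ring_preordering P"
  shows "x \<in> P \<Longrightarrow> y \<in> P \<Longrightarrow> x + y \<in> P" "x \<in> P \<Longrightarrow> y \<in> P \<Longrightarrow> x * y \<in> P" "x\<^sup>2 \<in> P" "- 1 \<notin> P"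
    "0 \<in> P" "1 \<in> P"
proof -
  show "x \<in> P \<Longrightarrow> y \<in> P \<Longrightarrow> x + y \<in> P" "x \<in> P \<Longrightarrow> y \<in> P \<Longrightarrow> x * y \<in> P" "- 1 \<notin> P"
    using assms by (simp_all add: ring_preordering_def)
  have sq: "z\<^sup>2 \<in> P" for z using assms by (simp add: ring_preordering_def)
  show "x\<^sup>2 \<in> P" "0 \<in> P" "1 \<in> P" using sq[of x] sq[of 0] sq[of 1] by simp_all
qed

definition maximal_preordering :: "'a::comm_ring_1 set \<Rightarrow> bool" where
  "maximal_preordering P \<longleftrightarrow> ring_preordering P \<and> (\<forall>P'. ring_preordering P' \<longrightarrow> P \<subseteq> P' \<longrightarrow> P' = P)"

lemma maximal_preordering_imp: "maximal_preordering P \<Longrightarrow> ring_preordering P"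
  by (simp add: maximal_preordering_def)

lemma maximal_preordering_ex:
  assumes "ring_preordering T"
  shows "\<exists>P. maximal_preordering P \<and> T \<subseteq> P"
proof -
  let ?A = "{P. ring_preordering P \<and> T \<subseteq> P}"
  have "\<Union>C \<in> ?A" if "C \<noteq> {}" and chain: "subset.chain ?A C" for C
  proof -
    have cone: "ring_preordering A" "T \<subseteq> A" if "A \<in> C" for A
      using chain that by (auto simp: subset.chain_def)
    have "x + y \<in> \<Union>C \<and> x * y \<in> \<Union>C" if xy: "x \<in> \<Union>C" "y \<in> \<Union>C" for x y
    proof -
      obtain A where "A \<in> C" "x \<in> A" "y \<in> A"
        using xy chain unfolding subset_chain_def by blast
      then show ?thesis using preorderingD(1,2)[OF cone(1)] by blast
    qed
    moreover obtain B where "B \<in> C" using \<open>C \<noteq> {}\<close> by blast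
    then have "x\<^sup>2 \<in> \<Union>C" for x using preorderingD(3)[OF cone(1)] by blast
    moreover have "- 1 \<notin> \<Union>C" using preorderingD(4)[OF cone(1)] by blast
    ultimately have "ring_preordering (\<Union>C)" unfolding ring_preordering_def by (intro conjI ballI allI) auto
    moreover have "T \<subseteq> \<Union>C" using cone(2) \<open>C \<noteq> {}\<close> by blast
    ultimately show ?thesis by blast
  qed
  moreover have "?A \<noteq> {}" using assms by blast
  ultimately obtain P where "P \<in> ?A" "\<forall>B\<in>?A. P \<subseteq> B \<longrightarrow> B = P"
    using subset_Zorn_nonempty[of ?A] by blast
  then have "maximal_preordering P \<and> T \<subseteq> P" unfolding maximal_preordering_def by blast
  then show ?thesis by blast
qed

text \<open>Otherwise the elements \<open>p + a * q\<close> with \<open>p\<close>, \<open>q\<close>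
  in \<open>P\<close> would form a strictly larger preordering.\<close>

lemma maximal_preordering_witness:
  assumes "maximal_preordering P" "a \<notin> P"
  shows "\<exists>p\<in>P. \<exists>q\<in>P. - a * q = 1 + p"
proof (rule ccontr)
  assume n: "\<not> ?thesis"
  have P: "ring_preordering P" using assms by (simp add: maximal_preordering_def)
  note D = preorderingD[OF P]
  define P' where "P' = {p + a * q |p q. p \<in> P \<and> q \<in> P}"
  have "ring_preordering P'"
    unfolding ring_preordering_def
  proof (intro conjI ballI allI)
    fix x y assume "x \<in> P'" "y \<in> P'"
    then obtain p q p' q' where xy: "x = p + a * q" "y = p' + a * q'" and pq: "p \<in> P" "q \<in> P" "p' \<in> P" "q' \<in> P"
      unfolding P'_def by blast
    have "x + y = (p + p') + a * (q + q')" "x * y = (p * p' + a\<^sup>2 * (q * q')) + a * (p * q' + q * p')"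
        unfolding xy by (simp_all add: algebra_simps power2_eq_square)
    moreover have "p + p' \<in> P" "q + q' \<in> P" "p * p' + a\<^sup>2 * (q * q') \<in> P" "p * q' + q * p' \<in> P"
      using pq D(1-3) by simp_all
    ultimately show "x + y \<in> P'" "x * y \<in> P'" unfolding P'_def by blast+
  next
    fix x
    have "x\<^sup>2 = x\<^sup>2 + a * 0" by simp
    then show "x\<^sup>2 \<in> P'" using D(3,5) unfolding P'_def by blast
  next
    show "- 1 \<notin> P'"
    proof
      assume "- 1 \<in> P'"
      then obtain p q where "- 1 = p + a * q" "p \<in> P" "q \<in> P" unfolding P'_def by blast
      moreover then have "- a * q = 1 + p" by (simp add: algebra_simps eq_neg_iff_add_eq_0 minus_equation_iff)
      ultimately show False using n by blast
    qed
  qed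
  moreover have "P \<subseteq> P'"
  proof
    fix x assume "x \<in> P"
    moreover have "x = x + a * 0" by simp
    ultimately show "x \<in> P'" using D(5) unfolding P'_def by blast
  qed
  ultimately have "P' = P" using assms(1) by (simp add: maximal_preordering_def)
  moreover have "a \<in> P'"
  proof -
    have "a = 0 + a * 1" by simp
    then show ?thesis using D(5,6) unfolding P'_def by blast
  qed
  ultimately show False using assms(2) by blast
qed

text \<open>If both signs were missing, multiplying the witness identities for \<open>a\<close> and
  \<open>- a\<close> would write \<open>- (a\<^sup>2 * (q * q'))\<close> as one plus an element of
  \<open>P\<close>, which puts \<open>- 1\<close> into \<open>P\<close>.\<close>

lemma maximal_preordering_total:
  assumes "maximal_preordering P"
  shows "a \<in> P \<or> - a \<in> P"
proof (rule ccontr)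
  assume "\<not> ?thesis"
  then obtain p q p' q' where eq: "- a * q = 1 + p" "- (- a) * q' = 1 + p'"
    and pq: "p \<in> P" "q \<in> P" "p' \<in> P" "q' \<in> P"
    using maximal_preordering_witness[OF assms, of a] maximal_preordering_witness[OF assms, of "- a"] by blast
  have P: "ring_preordering P" using assms by (simp add: maximal_preordering_def)
  have "(- a * q) * (- (- a) * q') = (1 + p) * (1 + p')" using eq by simp
  moreover have "(- a * q) * (- (- a) * q') = - (a\<^sup>2 * (q * q'))" by (simp add: power2_eq_square mult_ac)
  moreover have "(1 + p) * (1 + p') = 1 + (p + p' + p * p')" by (simp add: algebra_simps)
  ultimately have "- 1 = p + p' + p * p' + a\<^sup>2 * (q * q')"
    by (metis add.commute add.inverse_inverse add.left_commute add_minus_cancel minus_add_distrib uminus_add_conv_diff)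
  moreover have "p + p' + p * p' + a\<^sup>2 * (q * q') \<in> P"
    by (intro preorderingD(1-3)[OF P] pq)
  ultimately show False using preorderingD(4)[OF P] by simp
qed

text \<open>The support \<open>P \<inter> - P\<close> of a maximal preordering is a prime ideal.\<close>

lemma maximal_preordering_prime:
  assumes "maximal_preordering P" "a * b \<in> P" "- (a * b) \<in> P"
  shows "a \<in> P \<and> - a \<in> P \<or> b \<in> P \<and> - b \<in> P"
proof (rule ccontr)
  assume n: "\<not> ?thesis"
  have P: "ring_preordering P" using assms by (simp add: maximal_preordering_def)
  note D = preorderingD[OF P]
  have ideal: "x * c \<in> P \<and> - (x * c) \<in> P" if x: "x \<in> P" "- x \<in> P" for x c
  proof -
    have "c \<in> P \<or> - c \<in> P" using maximal_preordering_total[OF assms(1)] .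
    then show ?thesis
      using D(2)[OF x(1), of c] D(2)[OF x(2), of c] D(2)[OF x(1), of "- c"] D(2)[OF x(2), of "- c"] by auto
  qed
  \<comment> \<open>Outside the support every element divides some \<open>1 + p\<close> with
    \<open>p\<close> in \<open>P\<close>. If this held for both factors, their product, being in the
    support, would divide an element of the same kind, which is impossible.\<close>
  have unit: "\<exists>p\<in>P. \<exists>q. x * q = 1 + p" if "\<not> (x \<in> P \<and> - x \<in> P)" for x
  proof -
    consider "x \<notin> P" | "- x \<notin> P" using \<open>\<not> (x \<in> P \<and> - x \<in> P)\<close> by blast
    then show ?thesis
    proof cases
      case 1
      then obtain p q where "p \<in> P" "- x * q = 1 + p" using maximal_preordering_witness[OF assms(1)] by blast
      then show ?thesis by (intro bexI[of _ p] exI[of _ "- q"]) auto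
    next
      case 2
      then obtain p q where "p \<in> P" "- (- x) * q = 1 + p" using maximal_preordering_witness[OF assms(1)] by blast
      then show ?thesis by (intro bexI[of _ p] exI[of _ "q"]) auto
    qed
  qed
  obtain p q where p: "p \<in> P" "a * q = 1 + p" using unit[of a] n by blast
  obtain p' q' where p': "p' \<in> P" "b * q' = 1 + p'" using unit[of b] n by blast
  have "(a * b) * (q * q') = (a * q) * (b * q')" by (simp add: mult_ac)
  also have "\<dots> = 1 + (p + p' + p * p')" unfolding p p' by (simp add: algebra_simps)
  finally have "- (1 + (p + p' + p * p')) \<in> P" using ideal[OF assms(2,3), of "q * q'"] by simp
  moreover have "p + p' + p * p' \<in> P" by (intro D(1,2) p(1) p'(1))
  ultimately have "- (1 + (p + p' + p * p')) + (p + p' + p * p') \<in> P" by (rule D(1))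
  then show False using D(4) by simp
qed

text \<open>A type cannot depend on a locally fixed preordering. The theorem below is therefore proved for one
  globally chosen preordering, picked as a counterexample if there is any.\<close>

definition realized :: "'e::finite rpoly set \<Rightarrow> bool" where
  "realized P \<longleftrightarrow> (\<forall>\<Phi>\<subseteq>P. finite \<Phi> \<longrightarrow> (\<exists>a. \<forall>\<phi>\<in>\<Phi>. 0 \<le> poly_eval \<phi> a))"

definition critical_preordering :: "'e::finite rpoly set" where
  "critical_preordering = (SOME P. maximal_preordering P \<and>
     ((\<exists>P' :: 'e rpoly set. maximal_preordering P' \<and> \<not> realized P') \<longrightarrow> \<not> realized P))"

lemma preordering_at_point: "ring_preordering {p. 0 \<le> poly_eval p a}"
  by (simp add: ring_preordering_def poly_eval.hom_add poly_eval.hom_mult poly_eval.hom_power poly_eval.hom_minus poly_eval_one)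

lemma critical_preordering:
  fixes P :: "'e::finite rpoly set"
  shows "maximal_preordering (critical_preordering :: 'e rpoly set)"
    and "maximal_preordering P \<Longrightarrow> \<not> realized P \<Longrightarrow> \<not> realized (critical_preordering :: 'e rpoly set)"
proof -
  let ?Q = "\<lambda>P :: 'e rpoly set. maximal_preordering P \<and>
     ((\<exists>P' :: 'e rpoly set. maximal_preordering P' \<and> \<not> realized P') \<longrightarrow> \<not> realized P)"
  have "\<exists>P. ?Q P"
    using maximal_preordering_ex[OF preordering_at_point] by blast
  then have "?Q critical_preordering" unfolding critical_preordering_def by (rule someI_ex)
  then show "maximal_preordering (critical_preordering :: 'e rpoly set)"
    "maximal_preordering P \<Longrightarrow> \<not> realized P \<Longrightarrow> \<not> realized (critical_preordering :: 'e rpoly set)"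
    by blast+
qed

lemma preordering_critical: "ring_preordering critical_preordering"
  by (rule maximal_preordering_imp[OF critical_preordering(1)])

lemmas critical_preorderingD = preorderingD[OF preordering_critical]

section \<open>The residue ring of the chosen preordering as an ordered domain\<close>

definition residue_rel :: "'e::finite rpoly \<Rightarrow> 'e rpoly \<Rightarrow> bool" where
  "residue_rel a b \<longleftrightarrow> a - b \<in> critical_preordering \<and> b - a \<in> critical_preordering"

lemma support_add:
  assumes "x \<in> critical_preordering \<and> - x \<in> critical_preordering" "y \<in> critical_preordering \<and> - y \<in> critical_preordering"
  shows "x + y \<in> critical_preordering \<and> - (x + y) \<in> critical_preordering"
  using assms critical_preorderingD(1)[of x y] critical_preorderingD(1)[of "- x" "- y"] by simp

lemma support_mult:
  assumes "x \<in> critical_preordering \<and> - x \<in> critical_preordering"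
  shows "x * c \<in> critical_preordering \<and> - (x * c) \<in> critical_preordering"
  using maximal_preordering_total[OF critical_preordering(1), of c] assms
    critical_preorderingD(2)[of x c] critical_preorderingD(2)[of "- x" c]
    critical_preorderingD(2)[of x "- c"] critical_preorderingD(2)[of "- x" "- c"] by auto

lemma residue_rel_iff: "residue_rel a b \<longleftrightarrow> a - b \<in> critical_preordering \<and> - (a - b) \<in> critical_preordering"
  by (simp add: residue_rel_def)

lemma equivp_residue_rel: "equivp residue_rel"
proof (rule equivpI)
  show "reflp residue_rel" by (simp add: reflp_def residue_rel_def critical_preorderingD(5))
  show "symp residue_rel" by (simp add: symp_def residue_rel_def)
  show "transp residue_rel"
  proof (rule transpI)
    fix x y z assume "residue_rel x y" "residue_rel y z"
    then show "residue_rel x z" unfolding residue_rel_iff using support_add[of "x - y" "y - z"] by simp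
  qed
qed

quotient_type (overloaded) 'e residue = "'e::finite rpoly" / residue_rel
  morphisms rep_residue residue_of
  by (rule equivp_residue_rel)

lemma residue_rel_add:
  assumes "residue_rel a b" "residue_rel c d"
  shows "residue_rel (a + c) (b + d)"
  using assms support_add[of "a - b" "c - d"] unfolding residue_rel_iff by (simp add: algebra_simps)

lemma residue_rel_uminus: "residue_rel a b \<Longrightarrow> residue_rel (- a) (- b)"
  unfolding residue_rel_def by simp

lemma residue_rel_mult:
  assumes "residue_rel a b" "residue_rel c d"
  shows "residue_rel (a * c) (b * d)"
proof -
  have "a * c - b * d = (a - b) * c + (c - d) * b" by (simp add: algebra_simps)
  then show ?thesis using assms support_add support_mult unfolding residue_rel_iff by metis
qed

lemma residue_rel_nonneg:
  assumes "residue_rel a b" "residue_rel c d"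
  shows "c - a \<in> critical_preordering \<longleftrightarrow> d - b \<in> critical_preordering"
proof -
  have "d - b = (c - a) + ((d - c) + (a - b))" "c - a = (d - b) + ((c - d) + (b - a))" by (simp_all add: algebra_simps)
  then show ?thesis using assms critical_preorderingD(1) unfolding residue_rel_def by metis
qed

instantiation residue :: (finite) linordered_idom
begin

lift_definition zero_residue :: "'a residue" is 0 .
lift_definition one_residue :: "'a residue" is 1 .
lift_definition plus_residue :: "'a residue \<Rightarrow> 'a residue \<Rightarrow> 'a residue" is "(+)"
  by (rule residue_rel_add)
lift_definition uminus_residue :: "'a residue \<Rightarrow> 'a residue" is uminus
  by (rule residue_rel_uminus)
lift_definition minus_residue :: "'a residue \<Rightarrow> 'a residue \<Rightarrow> 'a residue" is "(-)"
  subgoal for a b c d using residue_rel_add[OF _ residue_rel_uminus, of a b c d] by simp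
  done
lift_definition times_residue :: "'a residue \<Rightarrow> 'a residue \<Rightarrow> 'a residue" is "(*)"
  by (rule residue_rel_mult)
lift_definition less_eq_residue :: "'a residue \<Rightarrow> 'a residue \<Rightarrow> bool" is "\<lambda>a b. b - a \<in> critical_preordering"
  by (rule residue_rel_nonneg)
definition "x < y \<longleftrightarrow> x \<le> y \<and> \<not> y \<le> (x :: 'a residue)"
definition "abs x = (if x < 0 then - x else x :: 'a residue)"
definition "sgn x = (if x = 0 then 0 else if 0 < x then 1 else - 1 :: 'a residue)"

instance
proof
  fix x y z :: "'a residue"
  have refl: "residue_rel a a" for a :: "'a rpoly" by (simp add: residue_rel_def critical_preorderingD(5))
  show "x * y * z = x * (y * z)" by transfer (simp add: mult.assoc refl)
  show "x * y = y * x" by transfer (simp add: mult.commute refl)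
  show "1 * x = x" by transfer (simp add: refl)
  show "x + y + z = x + (y + z)" by transfer (simp add: add.assoc refl)
  show "x + y = y + x" by transfer (simp add: add.commute refl)
  show "0 + x = x" by transfer (simp add: refl)
  show "- x + x = 0" by transfer (simp add: refl)
  show "x - y = x + - y" by transfer (simp add: refl)
  show "x + y - x = y" by transfer (simp add: refl)
  show "x - y - z = x - (y + z)" by transfer (simp add: diff_diff_eq refl)
  show "0 * x = 0" "x * 0 = 0" by (transfer, simp add: refl)+
  show "(x + y) * z = x * z + y * z" by transfer (simp add: distrib_right refl)
  show "0 \<noteq> (1 :: 'a residue)" by transfer (simp add: residue_rel_def critical_preorderingD(4))
  show "x < y \<longleftrightarrow> x \<le> y \<and> \<not> y \<le> x" by (rule less_residue_def)
  show "x \<le> x" by transfer (simp add: critical_preorderingD(5))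
  show "x \<le> y \<Longrightarrow> y \<le> z \<Longrightarrow> x \<le> z"
  proof transfer
    fix x y z :: "'a rpoly"
    assume "y - x \<in> critical_preordering" "z - y \<in> critical_preordering"
    then show "z - x \<in> critical_preordering" using critical_preorderingD(1)[of "y - x" "z - y"] by simp
  qed
  have anti: "x \<le> y \<Longrightarrow> y \<le> x \<Longrightarrow> x = y" for x y :: "'a residue"
    by transfer (simp add: residue_rel_def)
  show "x \<le> y \<Longrightarrow> y \<le> x \<Longrightarrow> x = y" by (rule anti)
  show "x \<le> y \<or> y \<le> x"
    by transfer (metis maximal_preordering_total[OF critical_preordering(1)] minus_diff_eq)
  show "x \<le> y \<Longrightarrow> z + x \<le> z + y" by transfer (simp add: add_diff_add)
  show "\<bar>x\<bar> = (if x < 0 then - x else x)" by (rule abs_residue_def)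
  show "sgn x = (if x = 0 then 0 else if 0 < x then 1 else - 1)" by (rule sgn_residue_def)
  have nzd: "x = 0 \<or> y = 0" if "x * y = 0" for x y :: "'a residue"
    using that by transfer (simp add: residue_rel_def maximal_preordering_prime[OF critical_preordering(1)])
  have mono: "x \<le> y \<Longrightarrow> 0 \<le> z \<Longrightarrow> z * x \<le> z * y" for x y z :: "'a residue"
  proof transfer
    fix x y z :: "'a rpoly"
    assume "y - x \<in> critical_preordering" "z - 0 \<in> critical_preordering"
    then show "z * y - z * x \<in> critical_preordering"
      using critical_preorderingD(2)[of z "y - x"] by (simp add: right_diff_distrib)
  qed
  show "x < y \<Longrightarrow> 0 < z \<Longrightarrow> z * x < z * y"
  proof -
    assume xy: "x < y" "0 < z"
    then have le: "z * x \<le> z * y" using mono by (simp add: less_residue_def)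
    have "z * x \<noteq> z * y"
    proof
      assume "z * x = z * y"
      then have "z * (x - y) = 0" by transfer (simp add: residue_rel_def right_diff_distrib)
      moreover have "z \<noteq> 0" using xy(2) by (auto simp: less_residue_def)
      ultimately have "x - y = 0" using nzd by blast
      then have "x = y" by transfer (simp add: residue_rel_def)
      then show False using xy(1) by (simp add: less_residue_def)
    qed
    then show "z * x < z * y" using le anti unfolding less_residue_def by blast
  qed
qed

end

theorem maximal_preordering_realized:
  fixes P :: "'e::finite rpoly set"
  assumes "maximal_preordering P"
  shows "realized P"
proof -
  define e where "e p = to_rc (Fract (residue_of p) 1)" for p :: "'e rpoly"
  interpret to_rc: comm_ring_hom to_rc by (rule to_rc_hom)
  have one: "residue_of 1 = (1 :: 'e residue)" by (simp add: one_residue_def)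
  have hom: "comm_ring_hom e"
  proof
    fix x y :: "'e rpoly"
    have "Fract (residue_of (x + y)) 1 = Fract (residue_of x) 1 + Fract (residue_of y) 1"
      by (simp add: plus_residue.abs_eq[symmetric])
    then show "e (x + y) = e x + e y" by (simp only: e_def to_rc.hom_add)
    have "Fract (residue_of (x * y)) 1 = Fract (residue_of x) 1 * Fract (residue_of y) 1"
      by (simp add: times_residue.abs_eq[symmetric])
    then show "e (x * y) = e x * e y" by (simp only: e_def to_rc.hom_mult)
    show "e 1 = 1" by (simp add: e_def one to_rc.hom_one flip: One_fract_def)
  qed
  interpret e: comm_ring_hom e by (rule hom)
  have nonneg: "0 \<le> e p" if "p \<in> critical_preordering" for p
    unfolding e_def using that
    by (intro to_rc_nonneg) (simp add: Fraction_Field.zero_le_Fract_iff, simp add: zero_residue_def less_eq_residue.abs_eq)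
  have "same_sign (e (const_poly c)) c" for c
  proof -
    \<comment> \<open>A positive real constant is the square of a constant polynomial, hence maps to
      a nonnegative element; its inverse constant shows that the image is not zero.\<close>
    have pos: "0 < e (const_poly c)" if "0 < c" for c
    proof -
      have "const_poly c = (const_poly (sqrt c))\<^sup>2" using that by (simp add: power2_eq_square const_poly_simps)
      then have "0 \<le> e (const_poly c)" using nonneg critical_preorderingD(3) by metis
      moreover have "e (const_poly c) * e (const_poly (1 / c)) = 1"
        using that by (simp add: const_poly_simps e.hom_one flip: e.hom_mult)
      then have "e (const_poly c) \<noteq> 0" by auto
      ultimately show ?thesis by simp
    qed
    show ?thesis
    proof (cases c "0 :: real" rule: linorder_cases)
      case less
      then have "0 < e (const_poly (- c))" using pos by simp
      moreover have "e (const_poly (- c)) = - e (const_poly c)" by (simp add: e.hom_minus flip: const_poly_simps(5))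
      ultimately show ?thesis using less by (simp add: same_sign_def)
    next
      case equal
      then show ?thesis by (simp add: const_poly_simps e.hom_zero same_sign_zero)
    next
      case greater
      then show ?thesis using pos[of c] by (simp add: same_sign_def)
    qed
  qed
  then have "realized (critical_preordering :: 'e rpoly set)"
    unfolding realized_def
  proof (intro allI impI)
    fix \<Phi> :: "'e rpoly set" assume \<Phi>: "\<Phi> \<subseteq> critical_preordering" "finite \<Phi>"
    obtain a where a: "\<And>\<phi>. \<phi> \<in> \<Phi> \<Longrightarrow> same_sign (e \<phi>) (poly_eval \<phi> a)"
      using real_point_same_signs[OF hom \<open>\<And>c. same_sign (e (const_poly c)) c\<close> finite[of UNIV] \<Phi>(2)] poly_in_UNIV by blast
    have "0 \<le> poly_eval \<phi> a" if "\<phi> \<in> \<Phi>" for \<phi>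
      using a[OF that] nonneg[of \<phi>] \<Phi>(1) that by (auto simp: same_sign_def not_less[symmetric])
    then show "\<exists>a. \<forall>\<phi>\<in>\<Phi>. 0 \<le> poly_eval \<phi> a" by blast
  qed
  then show ?thesis using critical_preordering(2)[OF assms] by blast
qed

subsection \<open>Certificates for positive polynomials and positive definite matrices\<close>

lemma sum_squares_0: "0 \<in> sum_squares"
  unfolding sum_squares_def by (intro CollectI exI[of _ 0]) simp

lemma sum_squares_add_square: 
  assumes "s \<in> sum_squares"
  shows "s + g\<^sup>2 \<in> sum_squares"
proof -
  obtain k :: nat and f where "s = (\<Sum>i<k. (f i)\<^sup>2)" using assms unfolding sum_squares_def by auto
  then have "s + g\<^sup>2 = (\<Sum>i<Suc k. ((f(k := g)) i)\<^sup>2)" by simp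
  then show ?thesis unfolding sum_squares_def by blast
qed

lemma sum_squares_induct [consumes 1, case_names zero add]:
  assumes "s \<in> sum_squares" "P 0" "\<And>s g. s \<in> sum_squares \<Longrightarrow> P s \<Longrightarrow> P (s + g\<^sup>2)"
  shows "P s"
proof -
  obtain k :: nat and f where s: "s = (\<Sum>i<k. (f i)\<^sup>2)" using assms(1) unfolding sum_squares_def by auto
  have "(\<Sum>i<n. (f i)\<^sup>2) \<in> sum_squares \<and> P (\<Sum>i<n. (f i)\<^sup>2)" for n
    by (induction n) (simp_all add: sum_squares_0 sum_squares_add_square assms(2,3))
  then show ?thesis unfolding s by blast
qed

lemma sum_squares_square: "g\<^sup>2 \<in> sum_squares"
  using sum_squares_add_square[OF sum_squares_0] by simp

lemma sum_squares_add:
  assumes "s \<in> sum_squares" "t \<in> sum_squares"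
  shows "s + t \<in> sum_squares"
  using assms(2,1)
  by (induction t rule: sum_squares_induct) (simp_all add: sum_squares_add_square flip: add.assoc)

lemma sum_squares_mult_square: "s \<in> sum_squares \<Longrightarrow> s * g\<^sup>2 \<in> sum_squares"
  by (induction s rule: sum_squares_induct)
    (simp_all add: sum_squares_0 distrib_right sum_squares_add_square flip: power_mult_distrib)

lemma sum_squares_mult:
  assumes "s \<in> sum_squares" "t \<in> sum_squares"
  shows "s * t \<in> sum_squares"
  using assms(2,1)
  by (induction t rule: sum_squares_induct)
    (simp_all add: sum_squares_0 distrib_left sum_squares_add sum_squares_mult_square)

lemma sum_squares_1: "1 \<in> sum_squares" and sum_squares_2: "2 \<in> sum_squares"
  using sum_squares_square[of 1] sum_squares_add_square[OF sum_squares_square, of 1 1] by simp_all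

lemma sum_squares_sum: "(\<And>x. x \<in> A \<Longrightarrow> f x \<in> sum_squares) \<Longrightarrow> sum f A \<in> sum_squares"
  by (induction A rule: infinite_finite_induct) (simp_all add: sum_squares_0 sum_squares_add)

lemmas sum_squares_intros = sum_squares_0 sum_squares_1 sum_squares_2 sum_squares_square sum_squares_add
  sum_squares_mult sum_squares_sum

lemma poly_eval_sum_squares: "s \<in> sum_squares \<Longrightarrow> 0 \<le> poly_eval s a"
  by (induction s rule: sum_squares_induct) (simp_all add: poly_eval_zero poly_eval_add poly_eval.hom_power)

text \<open>\<open>T\<close> consists of the combinations of \<open>1\<close> and \<open>- f\<close>
  with sum of squares coefficients. Were it a preordering, a maximal extension would be realised at
  a point where \<open>f\<close> is at most zero. Hence \<open>- 1\<close> lies in \<open>T\<close>,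
  that is \<open>f * q = 1 + p\<close>.\<close>

lemma strict_positivstellensatz:
  fixes f :: "'e::finite rpoly"
  assumes pos: "\<And>a. 0 < poly_eval f a"
  shows "\<exists>s\<in>sum_squares. \<exists>t\<in>sum_squares. (1 + s) * f = 1 + t"
proof -
  define T where "T = {p - f * q |p q. p \<in> sum_squares \<and> q \<in> sum_squares}"
  have mem: "p - f * q \<in> T" if "p \<in> sum_squares" "q \<in> sum_squares" for p q
    unfolding T_def using that by blast
  have "\<not> ring_preordering T"
  proof
    assume "ring_preordering T"
    then obtain P where P: "maximal_preordering P" "T \<subseteq> P" using maximal_preordering_ex by blast
    have "- f \<in> P" using mem[of 0 1] P(2) sum_squares_intros by auto
    then have "{- f} \<subseteq> P" "finite {- f}" by simp_all
    then obtain a where "0 \<le> poly_eval (- f) a"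
      using maximal_preordering_realized[OF P(1)] unfolding realized_def by blast
    then show False using pos[of a] by (simp add: poly_eval.hom_minus)
  qed
  moreover have "x + y \<in> T \<and> x * y \<in> T" if xyT: "x \<in> T" "y \<in> T" for x y
  proof -
    obtain p q p' q' where xy: "x = p - f * q" "y = p' - f * q'"
      and pq: "p \<in> sum_squares" "q \<in> sum_squares" "p' \<in> sum_squares" "q' \<in> sum_squares"
      using xyT unfolding T_def by blast
    have "x + y = (p + p') - f * (q + q')" "x * y = (p * p' + f\<^sup>2 * (q * q')) - f * (p * q' + q * p')"
      unfolding xy by (simp_all add: algebra_simps power2_eq_square)
    moreover have "(p + p') - f * (q + q') \<in> T" "(p * p' + f\<^sup>2 * (q * q')) - f * (p * q' + q * p') \<in> T"
      by (intro mem sum_squares_intros pq)+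
    ultimately show ?thesis by simp
  qed
  moreover have "x\<^sup>2 \<in> T" for x using mem[of "x\<^sup>2" 0] sum_squares_intros by auto
  ultimately have "- 1 \<in> T" unfolding ring_preordering_def by blast
  then obtain p q where pq: "p \<in> sum_squares" "q \<in> sum_squares" and "- 1 = p - f * q" unfolding T_def by blast
  then have fq: "f * q = 1 + p" by (simp add: algebra_simps eq_diff_eq)
  \<comment> \<open>The multiplier \<open>q\<close> need not have the form \<open>1 + s\<close>.
    Adding \<open>1 + p\<close> to it repairs this, because \<open>f * (1 + p)\<close> equals
    \<open>f\<^sup>2 * q\<close> and \<open>f * q\<close> contributes the constant 1.\<close>
  have "(1 + (p + q)) * f = f * (1 + p) + f * q" by (simp add: algebra_simps)
  also have "\<dots> = 1 + (p + f\<^sup>2 * q)" unfolding fq[symmetric] by (simp add: fq power2_eq_square mult.assoc)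
  finally have "(1 + (p + q)) * f = 1 + (p + f\<^sup>2 * q)" .
  moreover have "p + q \<in> sum_squares" "p + f\<^sup>2 * q \<in> sum_squares" by (intro sum_squares_intros pq)+
  ultimately show ?thesis by blast
qed

section \<open>Matrix squares and Gaussian elimination\<close>

lemma mat_smult_component: "mat_smult c A $ i $ j = c * A $ i $ j"
  by (simp add: mat_smult_def)

lemma transpose_component: "transpose A $ i $ j = A $ j $ i"
  by (simp add: transpose_def)

lemma matrix_mult_component: "(A ** B) $ i $ j = (\<Sum>k\<in>UNIV. A $ i $ k * B $ k $ j)"
  by (simp add: matrix_matrix_mult_def)

definition outer_square :: "'a::comm_ring_1 ^ 'n \<Rightarrow> 'a ^ 'n ^ 'n" where
  "outer_square w = (\<chi> i j. w $ i * w $ j)"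

lemma mat_sum_squares_0: "0 \<in> mat_sum_squares"
  unfolding mat_sum_squares_def by (intro CollectI exI[of _ 0]) simp

lemma mat_sum_squares_add_square:
  fixes S K :: "'a::comm_ring_1 ^ 'n ^ 'n"
  assumes "S \<in> mat_sum_squares"
  shows "S + transpose K ** K \<in> mat_sum_squares"
proof -
  obtain k :: nat and H :: "nat \<Rightarrow> 'a ^ 'n ^ 'n" where "S = (\<Sum>i<k. transpose (H i) ** H i)" using assms unfolding mat_sum_squares_def by auto
  then have "S + transpose K ** K = (\<Sum>i<Suc k. transpose ((H(k := K)) i) ** (H(k := K)) i)" by simp
  then show ?thesis unfolding mat_sum_squares_def by blast
qed

lemma mat_sum_squares_induct [consumes 1, case_names zero add]:
  fixes S :: "'a::comm_ring_1 ^ 'n ^ 'n"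
  assumes "S \<in> mat_sum_squares" "P 0"
    and "\<And>S (H :: 'a ^ 'n ^ 'n). S \<in> mat_sum_squares \<Longrightarrow> P S \<Longrightarrow> P (S + transpose H ** H)"
  shows "P S"
proof -
  obtain k :: nat and H :: "nat \<Rightarrow> 'a ^ 'n ^ 'n" where S: "S = (\<Sum>i<k. transpose (H i) ** H i)"
    using assms(1) unfolding mat_sum_squares_def by auto
  have "(\<Sum>i<n. transpose (H i) ** H i) \<in> mat_sum_squares \<and> P (\<Sum>i<n. transpose (H i) ** H i)" for n
    by (induction n) (simp_all add: mat_sum_squares_0 mat_sum_squares_add_square assms(2,3))
  then show ?thesis unfolding S by blast
qed

lemma mat_sum_squares_add:
  assumes "S \<in> mat_sum_squares" "T \<in> mat_sum_squares"
  shows "S + T \<in> mat_sum_squares"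
  using assms(2,1)
  by (induction T rule: mat_sum_squares_induct) (simp_all add: mat_sum_squares_add_square flip: add.assoc)

lemma mat_sum_squares_sum: "(\<And>x. x \<in> A \<Longrightarrow> f x \<in> mat_sum_squares) \<Longrightarrow> sum f A \<in> mat_sum_squares"
  by (induction A rule: infinite_finite_induct) (simp_all add: mat_sum_squares_0 mat_sum_squares_add)

lemma outer_square_sum_squares: "outer_square (w :: 'a::comm_ring_1 ^ 'n::finite) \<in> mat_sum_squares"
proof -
  define r :: 'n where "r = undefined"
  define H :: "'a ^ 'n ^ 'n" where "H = (\<chi> i j. if i = r then w $ j else 0)"
  have "(transpose H ** H) $ i $ j = w $ i * w $ j" for i j
  proof -
    have "(transpose H ** H) $ i $ j = (\<Sum>k\<in>UNIV. if k = r then w $ i * w $ j else 0)"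
      unfolding matrix_mult_component transpose_component H_def by (intro sum.cong) auto
    then show ?thesis by simp
  qed
  then have "outer_square w = 0 + transpose H ** H"
    by (simp add: outer_square_def vec_eq_iff)
  then show ?thesis using mat_sum_squares_add_square[OF mat_sum_squares_0] by metis
qed

lemma mat_smult_square:
  fixes S :: "'a::comm_ring_1 ^ 'n ^ 'n"
  assumes "S \<in> mat_sum_squares"
  shows "mat_smult (c\<^sup>2) S \<in> mat_sum_squares"
  using assms
proof (induction S rule: mat_sum_squares_induct)
  case zero
  have "mat_smult (c\<^sup>2) 0 = (0 :: 'a ^ 'n ^ 'n)" by (simp add: vec_eq_iff mat_smult_component)
  then show ?case by (simp add: mat_sum_squares_0)
next
  case (add S H)
  have "mat_smult (c\<^sup>2) (S + transpose H ** H) = mat_smult (c\<^sup>2) S + transpose (mat_smult c H) ** mat_smult c H"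
    by (simp add: vec_eq_iff mat_smult_component matrix_mult_component transpose_component distrib_left sum_distrib_left
        power2_eq_square mult_ac)
  then show ?case using mat_sum_squares_add_square[OF add.IH] by simp
qed

lemma mat_smult_sum_squares:
  fixes S :: "'a::comm_ring_1 ^ 'n ^ 'n"
  assumes "s \<in> sum_squares" "S \<in> mat_sum_squares"
  shows "mat_smult s S \<in> mat_sum_squares"
  using assms(1)
proof (induction s rule: sum_squares_induct)
  case zero
  have "mat_smult 0 S = 0" by (simp add: vec_eq_iff mat_smult_component)
  then show ?case by (simp add: mat_sum_squares_0)
next
  case (add s g)
  have "mat_smult (s + g\<^sup>2) S = mat_smult s S + mat_smult (g\<^sup>2) S"
    by (simp add: vec_eq_iff mat_smult_component distrib_right)
  then show ?case using mat_sum_squares_add[OF add.IH mat_smult_square[OF assms(2)]] by simp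
qed

definition diag_on :: "'n set \<Rightarrow> 'a::comm_ring_1 ^ 'n ^ 'n" where
  "diag_on U = (\<chi> i j. if i = j \<and> i \<in> U then 1 else 0)"

lemma diag_on_sum_squares: "(diag_on U :: 'a::comm_ring_1 ^ 'n::finite ^ 'n) \<in> mat_sum_squares"
proof -
  have "(diag_on U :: 'a ^ 'n ^ 'n) = (\<Sum>k\<in>U. outer_square (axis k 1))"
  proof (simp only: vec_eq_iff sum_component, intro allI)
    fix i j :: 'n
    have "(\<Sum>k\<in>U. outer_square (axis k (1 :: 'a)) $ i $ j) = (\<Sum>k\<in>U. if k = i then (if i = j then 1 else 0) else 0)"
      by (intro sum.cong) (auto simp: outer_square_def axis_def)
    then show "(diag_on U :: 'a ^ 'n ^ 'n) $ i $ j = (\<Sum>k\<in>U. outer_square (axis k 1) $ i $ j)"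
      by (simp add: diag_on_def)
  qed
  then show ?thesis by (simp add: mat_sum_squares_sum outer_square_sum_squares)
qed

text \<open>Lagrange's identity, certifying the Cauchy--Schwarz inequality
  \<open>c c\<^sup>T \<le> \<bar>c\<bar>\<^sup>2 I\<close> on the coordinates in \<open>U\<close>.\<close>

lemma lagrange_identity:
  fixes c :: "'a::comm_ring_1 ^ 'n::finite"
  assumes "\<And>i. i \<notin> U \<Longrightarrow> c $ i = 0"
  shows "(\<Sum>i\<in>U. \<Sum>j\<in>U. outer_square (c $ i *s axis j 1 - c $ j *s axis i 1)) $ p $ q
    = 2 * (\<Sum>i\<in>U. (c $ i)\<^sup>2) * diag_on U $ p $ q - 2 * (c $ p * c $ q)"
proof -
  have entry: "outer_square (c $ i *s axis j 1 - c $ j *s axis i 1) $ p $ q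
      = (c $ i)\<^sup>2 * (if j = p then (if p = q then 1 else 0) else 0)
        - (if i = q then (if j = p then c $ p * c $ q else 0) else 0)
        - (if i = p then (if j = q then c $ p * c $ q else 0) else 0)
        + (if i = p then (if p = q then (c $ j)\<^sup>2 else 0) else 0)" for i j
    by (auto simp: outer_square_def axis_def power2_eq_square algebra_simps)
  have double: "(\<Sum>i\<in>U. \<Sum>j\<in>U. if i = x then (if j = y then z else 0) else 0) = (if x \<in> U \<and> y \<in> U then z else 0)"
    for x y and z :: 'a
  proof -
    have "(\<Sum>i\<in>U. \<Sum>j\<in>U. if i = x then (if j = y then z else 0) else 0)
        = (\<Sum>i\<in>U. if i = x then (\<Sum>j\<in>U. if j = y then z else 0) else 0)"
      by (intro sum.cong) auto
    then show ?thesis by simp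
  qed
  have "(\<Sum>i\<in>U. \<Sum>j\<in>U. outer_square (c $ i *s axis j 1 - c $ j *s axis i 1)) $ p $ q
     = (\<Sum>i\<in>U. \<Sum>j\<in>U. (c $ i)\<^sup>2 * (if j = p then (if p = q then 1 else 0) else 0))
       - (\<Sum>i\<in>U. \<Sum>j\<in>U. if i = q then (if j = p then c $ p * c $ q else 0) else 0)
       - (\<Sum>i\<in>U. \<Sum>j\<in>U. if i = p then (if j = q then c $ p * c $ q else 0) else 0)
       + (\<Sum>i\<in>U. \<Sum>j\<in>U. if i = p then (if p = q then (c $ j)\<^sup>2 else 0) else 0)"
    by (simp only: sum_component entry sum.distrib sum_subtractf)
  also have "(\<Sum>i\<in>U. \<Sum>j\<in>U. (c $ i)\<^sup>2 * (if j = p then (if p = q then 1 else 0) else 0))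
      = (\<Sum>i\<in>U. (c $ i)\<^sup>2) * diag_on U $ p $ q"
    by (simp add: diag_on_def sum_distrib_right flip: sum_distrib_left)
  also have "(\<Sum>i\<in>U. \<Sum>j\<in>U. if i = q then (if j = p then c $ p * c $ q else 0) else 0) = c $ p * c $ q"
    using assms by (auto simp: double)
  also have "(\<Sum>i\<in>U. \<Sum>j\<in>U. if i = p then (if j = q then c $ p * c $ q else 0) else 0) = c $ p * c $ q"
    using assms by (auto simp: double)
  also have "(\<Sum>i\<in>U. \<Sum>j\<in>U. if i = p then (if p = q then (c $ j)\<^sup>2 else 0) else 0)
      = (\<Sum>i\<in>U. (c $ i)\<^sup>2) * diag_on U $ p $ q"
  proof -
    have "(\<Sum>i\<in>U. \<Sum>j\<in>U. if i = p then (if p = q then (c $ j)\<^sup>2 else 0) else 0)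
        = (\<Sum>i\<in>U. if i = p then (\<Sum>j\<in>U. if p = q then (c $ j)\<^sup>2 else 0) else 0)"
      by (intro sum.cong) auto
    then show ?thesis by (simp add: diag_on_def)
  qed
  finally show ?thesis by (simp add: algebra_simps)
qed


lemma mat_smult_add: "mat_smult c (A + B) = mat_smult c A + mat_smult c B" for c :: "'a::comm_ring_1"
  by (simp add: vec_eq_iff mat_smult_component algebra_simps)

text \<open>One step of Gaussian elimination: the Schur complement, cleared of its denominator \<open>A $ k $ k\<close>.\<close>

definition schur :: "'n \<Rightarrow> 'a::comm_ring_1 ^ 'n ^ 'n \<Rightarrow> 'a ^ 'n ^ 'n" where
  "schur k A = (\<chi> i j. A $ k $ k * A $ i $ j - A $ i $ k * A $ j $ k)"

text \<open>The test vector \<open>u\<close> is chosen so that its value under the form of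
  \<open>A\<close> is \<open>A $ k $ k\<close> times the value of \<open>v\<close> under the Schur
  complement. Off \<open>k\<close> it vanishes wherever \<open>v\<close> does, so definiteness on
  vectors of restricted support suffices.\<close>

lemma schur_pos:
  fixes A :: "real ^ 'n::finite ^ 'n" and v :: "real ^ 'n"
  assumes sym: "transpose A = A" and v: "v \<noteq> 0" "v $ k = 0" and "0 < A $ k $ k"
    and pos: "\<And>u. u \<noteq> 0 \<Longrightarrow> (\<And>i. i \<noteq> k \<Longrightarrow> v $ i = 0 \<Longrightarrow> u $ i = 0) \<Longrightarrow> 0 < u \<bullet> (A *v u)"
  shows "0 < v \<bullet> (schur k A *v v)"
proof -
  define f where "f = A $ k $ k"
  define b where "b = (\<chi> i. A $ i $ k)"
  have symc: "A $ i $ j = A $ j $ i" for i j using sym by (metis transpose_component)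
  define u where "u = f *\<^sub>R v - (b \<bullet> v) *\<^sub>R axis k 1"
  have Ae: "A *v axis k 1 = b" by (simp add: b_def vec_eq_iff matrix_vector_mult_def axis_def if_distrib cong: if_cong)
  have eb: "axis k 1 \<bullet> b = f" by (simp add: inner_axis' b_def f_def)
  have eAv: "axis k 1 \<bullet> (A *v v) = b \<bullet> v"
  proof -
    have "axis k 1 \<bullet> (A *v v) = (A *v v) $ k" by (simp add: inner_axis')
    also have "\<dots> = b \<bullet> v" by (simp add: matrix_vector_mult_def b_def inner_vec_def symc[of k])
    finally show ?thesis .
  qed
  have Au: "A *v u = f *\<^sub>R (A *v v) - (b \<bullet> v) *\<^sub>R b"
    by (simp add: u_def matrix_vector_mult_diff_distrib matrix_vector_mult_scaleR Ae)
  have "u \<bullet> (A *v u) = f * (f * (v \<bullet> (A *v v)) - (b \<bullet> v) * (v \<bullet> b)) - (b \<bullet> v) * (f * (b \<bullet> v) - (b \<bullet> v) * f)"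
    unfolding Au unfolding u_def inner_diff_left inner_diff_right inner_scaleR_left inner_scaleR_right eAv eb
    by (simp add: algebra_simps)
  also have "\<dots> = f * (f * (v \<bullet> (A *v v)) - (b \<bullet> v)\<^sup>2)" by (simp add: power2_eq_square inner_commute)
  also have "f * (v \<bullet> (A *v v)) - (b \<bullet> v)\<^sup>2 = v \<bullet> (schur k A *v v)"
  proof -
    have "(schur k A *v v) $ i = f * (A *v v) $ i - b $ i * (b \<bullet> v)" for i
      by (simp add: matrix_vector_mult_def schur_def f_def b_def inner_vec_def sum_distrib_left algebra_simps
          sum_subtractf)
    then have "schur k A *v v = f *\<^sub>R (A *v v) - (b \<bullet> v) *\<^sub>R b" by (simp add: vec_eq_iff mult.commute)
    then show ?thesis by (simp add: inner_diff_right inner_commute power2_eq_square)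
  qed
  finally have eq: "u \<bullet> (A *v u) = f * (v \<bullet> (schur k A *v v))" .
  obtain i where i: "v $ i \<noteq> 0" using v(1) by (auto simp: vec_eq_iff)
  then have "i \<noteq> k" using v(2) by auto
  then have "u $ i = f * v $ i" by (simp add: u_def axis_def)
  then have "u \<noteq> 0" using i assms(4) by (auto simp: f_def)
  moreover have "u $ j = 0" if "j \<noteq> k" "v $ j = 0" for j using that by (simp add: u_def axis_def)
  ultimately have "0 < f * (v \<bullet> (schur k A *v v))" using pos eq by metis
  then show ?thesis using assms(4) by (simp add: f_def zero_less_mult_iff)
qed

text \<open>The certificate for \<open>F\<close> is assembled from the one for the Schur complement and the one for the pivot.
  The vector \<open>b + b'\<close> comes from \<open>f\<^sup>2 e e\<^sup>T = (b - b') (b - b')\<^sup>T = 2 b b\<^sup>T + 2 b' b'\<^sup>T - (b + b') (b + b')\<^sup>T\<close>.\<close>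

lemma pivot_certificate:
  fixes F :: "'a::comm_ring_1 ^ 'n::finite ^ 'n"
  assumes sym: "transpose F = F" and supp: "\<And>i j. i \<notin> insert k U \<or> j \<notin> insert k U \<Longrightarrow> F $ i $ j = 0" and "k \<notin> U"
    and s: "s \<in> sum_squares" "s\<^sub>1 \<in> sum_squares" "t\<^sub>1 \<in> sum_squares"
    and piv: "(1 + s\<^sub>1) * F $ k $ k = 1 + t\<^sub>1"
    and cert: "mat_smult (1 + s) (schur k F) - diag_on U \<in> mat_sum_squares"
  shows "\<exists>r\<in>sum_squares. mat_smult (1 + r) F - diag_on (insert k U) \<in> mat_sum_squares"
proof -
  define f where "f = F $ k $ k"
  define b where "b = (\<chi> i. F $ i $ k)"
  define b' where "b' = (\<chi> i. if i \<in> U then b $ i else 0)"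
  define \<beta> where "\<beta> = (\<Sum>i\<in>U. (b' $ i)\<^sup>2)"
  define E :: "'a ^ 'n ^ 'n" where "E = diag_on {k}"
  define R where "R = outer_square (b + b') + (\<Sum>i\<in>U. \<Sum>j\<in>U. outer_square (b' $ i *s axis j 1 - b' $ j *s axis i 1))"
  define S where "S = mat_smult (1 + s) (schur k F) - diag_on U"
  \<comment> \<open>Subtracting the pivot entry \<open>E\<close> costs
    \<open>(1 + s\<^sub>1)\<^sup>2 * f\<^sup>2\<close> times \<open>E\<close>, up to the square
    multiple \<open>2 * t\<^sub>1 + t\<^sub>1\<^sup>2\<close> of \<open>E\<close>. By
    \<open>R_entry\<close>, \<open>f\<^sup>2\<close> times \<open>E\<close> is
    \<open>2 b b^T + 2 \<beta> diag_on U\<close> minus \<open>R\<close>; \<open>c\<close> is large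
    enough to cover both terms.\<close>
  define c where "c = 2 * (1 + s\<^sub>1)\<^sup>2 * (1 + \<beta>)"
  \<comment> \<open>The factor \<open>1 + t\<^sub>1\<close> equals
    \<open>(1 + s\<^sub>1) * f\<close>, and \<open>f\<close> times \<open>F\<close> is the Schur
    complement plus \<open>b b^T\<close>. This is how \<open>cert\<close> enters.\<close>
  define r where "r = (1 + c) * ((1 + s) * (1 + t\<^sub>1)) - 1"
  have bF: "F $ i $ k = b $ i" "b $ k = f" for i by (simp_all add: b_def f_def)
  have b_split: "b $ i = b' $ i + (if i = k then f else 0)" for i
    using supp[of i k] \<open>k \<notin> U\<close> by (auto simp: b'_def b_def f_def)
  have "\<beta> \<in> sum_squares" unfolding \<beta>_def by (intro sum_squares_intros)
  have sq: "(1 + s\<^sub>1)\<^sup>2 \<in> sum_squares" "c \<in> sum_squares" unfolding c_def by (intro sum_squares_intros \<open>\<beta> \<in> sum_squares\<close>)+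
  have "r = c + (s + t\<^sub>1 + s * t\<^sub>1) + c * (s + t\<^sub>1 + s * t\<^sub>1)" by (simp add: r_def algebra_simps)
  then have r: "r \<in> sum_squares" using s sq by (simp add: sum_squares_intros)
  have R: "R \<in> mat_sum_squares"
    unfolding R_def by (intro mat_sum_squares_add mat_sum_squares_sum outer_square_sum_squares)
  have R_entry: "R $ p $ q = 2 * (b $ p * b $ q) + 2 * \<beta> * diag_on U $ p $ q - f\<^sup>2 * E $ p $ q" for p q
  proof -
    have b'0: "b' $ i = 0" if "i \<notin> U" for i using that by (simp add: b'_def)
    have sq: "(b $ p + b' $ p) * (b $ q + b' $ q) = 2 * (b' $ p * b' $ q) + 2 * (b $ p * b $ q) - f\<^sup>2 * E $ p $ q"
      unfolding b_split by (auto simp: E_def diag_on_def algebra_simps power2_eq_square)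
    have lagrange: "(\<Sum>i\<in>U. \<Sum>j\<in>U. outer_square (b' $ i *s axis j 1 - b' $ j *s axis i 1)) $ p $ q
        = 2 * \<beta> * diag_on U $ p $ q - 2 * (b' $ p * b' $ q)"
      unfolding \<beta>_def by (rule lagrange_identity[OF b'0])
    have outer: "outer_square (b + b') $ p $ q = (b $ p + b' $ p) * (b $ q + b' $ q)"
      by (simp add: outer_square_def)
    show ?thesis
      unfolding R_def vector_add_component lagrange outer sq by simp
  qed
  have key: "mat_smult (1 + r) F - diag_on (insert k U)
    = mat_smult (1 + c) (mat_smult (1 + s\<^sub>1) S + mat_smult s\<^sub>1 (diag_on U) + mat_smult (s\<^sub>1 + s + s\<^sub>1 * s) (outer_square b))
      + (mat_smult ((1 + s\<^sub>1)\<^sup>2) R + mat_smult (2 * t\<^sub>1 + t\<^sub>1\<^sup>2) E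
         + mat_smult (1 + 2 * (1 + s\<^sub>1)\<^sup>2 * \<beta>) (outer_square b) + mat_smult (2 * (1 + s\<^sub>1)\<^sup>2) (diag_on U))"
  proof (simp only: vec_eq_iff, intro allI)
    fix p q
    define x u e y where "x = F $ p $ q" and "u = (diag_on U :: 'a ^ 'n ^ 'n) $ p $ q" and "e = E $ p $ q" and "y = b $ p * b $ q"
    have S: "S $ p $ q = (1 + s) * (f * x - y) - u"
      by (simp add: S_def mat_smult_component schur_def x_def u_def y_def bF flip: f_def)
    have D: "diag_on (insert k U) $ p $ q = u + e"
      using \<open>k \<notin> U\<close> by (auto simp: diag_on_def u_def e_def E_def)
    have t: "t\<^sub>1 = (1 + s\<^sub>1) * f - 1" using piv by (simp add: f_def)
    show "(mat_smult (1 + r) F - diag_on (insert k U)) $ p $ q =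
      (mat_smult (1 + c) (mat_smult (1 + s\<^sub>1) S + mat_smult s\<^sub>1 (diag_on U) + mat_smult (s\<^sub>1 + s + s\<^sub>1 * s) (outer_square b))
      + (mat_smult ((1 + s\<^sub>1)\<^sup>2) R + mat_smult (2 * t\<^sub>1 + t\<^sub>1\<^sup>2) E
         + mat_smult (1 + 2 * (1 + s\<^sub>1)\<^sup>2 * \<beta>) (outer_square b) + mat_smult (2 * (1 + s\<^sub>1)\<^sup>2) (diag_on U))) $ p $ q"
      unfolding vector_add_component vector_minus_component mat_smult_component S D R_entry
        x_def[symmetric] u_def[symmetric] e_def[symmetric]
      unfolding outer_square_def vec_lambda_beta y_def[symmetric] r_def c_def t
      by (simp add: algebra_simps power2_eq_square)
  qed
  have "mat_smult (1 + r) F - diag_on (insert k U) \<in> mat_sum_squares"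
    unfolding key
    by (intro mat_sum_squares_add mat_smult_sum_squares sum_squares_intros s sq R diag_on_sum_squares
        outer_square_sum_squares \<open>\<beta> \<in> sum_squares\<close>) (use cert diag_on_sum_squares in \<open>simp_all add: S_def E_def\<close>)
  then show ?thesis using r by blast
qed

lemma mat_eval_component: "mat_eval A a $ i $ j = poly_eval (A $ i $ j) a"
  by (simp add: mat_eval_def)

lemma mat_eval_add: "mat_eval (A + B) a = mat_eval A a + mat_eval B a"
  and mat_eval_zero: "mat_eval 0 a = 0"
  and mat_eval_transpose: "mat_eval (transpose C) a = transpose (mat_eval C a)"
  and mat_eval_schur: "mat_eval (schur k D) a = schur k (mat_eval D a)"
  by (simp_all add: vec_eq_iff mat_eval_component transpose_component schur_def poly_eval_add poly_eval_zero
      poly_eval_mult poly_eval.hom_diff)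

lemma mat_eval_mult: "mat_eval (A ** B) a = mat_eval A a ** mat_eval B a"
  by (simp add: vec_eq_iff mat_eval_component matrix_mult_component poly_eval_sum poly_eval_mult)

lemma mat_eval_smult: "mat_eval (mat_smult c A) a = poly_eval c a *\<^sub>R mat_eval A a"
  by (simp add: vec_eq_iff mat_eval_component mat_smult_component poly_eval_mult)

lemma mat_eval_one: "mat_eval (mat 1) a = mat 1"
  by (simp add: vec_eq_iff mat_eval_component mat_def poly_eval_one poly_eval_zero)

text \<open>The matrix size is fixed by the type, so elimination shrinks the set \<open>U\<close> of
  active coordinates: for symmetric \<open>F\<close>, row and column \<open>k\<close> of
  \<open>schur k F\<close> vanish. Testing with a unit vector shows that each pivot is a positive
  polynomial.\<close>

lemma positive_definite_certificate_on:
  fixes F :: "'d::finite rpoly ^ 'n::finite ^ 'n"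
  assumes "transpose F = F" "\<And>i j. i \<notin> U \<or> j \<notin> U \<Longrightarrow> F $ i $ j = 0"
    and "\<And>a v. v \<noteq> 0 \<Longrightarrow> (\<And>i. i \<notin> U \<Longrightarrow> v $ i = 0) \<Longrightarrow> 0 < v \<bullet> (mat_eval F a *v v)"
  shows "\<exists>s\<in>sum_squares. mat_smult (1 + s) F - diag_on U \<in> mat_sum_squares"
  using finite[of U] assms
proof (induction U arbitrary: F rule: finite_induct)
  case empty
  have "mat_smult (1 + 0) F - diag_on {} = 0"
    using empty(2) by (simp add: vec_eq_iff mat_smult_component diag_on_def)
  then show ?case using sum_squares_0 mat_sum_squares_0 by metis
next
  case (insert k U)
  note pd = insert.prems(3)
  have symc: "F $ i $ j = F $ j $ i" for i j using insert.prems(1) by (metis transpose_component)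
  have piv: "0 < poly_eval (F $ k $ k) a" for a
  proof -
    have "0 < axis k 1 \<bullet> (mat_eval F a *v axis k 1)"
      by (rule pd) (auto simp: axis_def vec_eq_iff)
    also have "\<dots> = (mat_eval F a *v axis k 1) $ k" by (simp add: inner_axis')
    also have "\<dots> = poly_eval (F $ k $ k) a"
      by (simp add: matrix_vector_mult_def axis_def if_distrib mat_eval_component cong: if_cong)
    finally show ?thesis .
  qed
  obtain s\<^sub>1 t\<^sub>1 where st: "s\<^sub>1 \<in> sum_squares" "t\<^sub>1 \<in> sum_squares" "(1 + s\<^sub>1) * F $ k $ k = 1 + t\<^sub>1"
    using strict_positivstellensatz[OF piv] by blast
  have "\<exists>s\<in>sum_squares. mat_smult (1 + s) (schur k F) - diag_on U \<in> mat_sum_squares"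
  proof (rule insert.IH)
    show "transpose (schur k F) = schur k F"
      by (simp add: vec_eq_iff transpose_component schur_def symc mult.commute)
    show "schur k F $ i $ j = 0" if "i \<notin> U \<or> j \<notin> U" for i j
    proof -
      consider "i = k" | "j = k" | "i \<notin> insert k U" | "j \<notin> insert k U" using \<open>i \<notin> U \<or> j \<notin> U\<close> by blast
      then show ?thesis
        by cases (use insert.prems(2) symc[of i k] symc[of j k] in \<open>simp_all add: schur_def mult.commute\<close>)
    qed
    show "0 < v \<bullet> (mat_eval (schur k F) a *v v)" if v: "v \<noteq> 0" "\<And>i. i \<notin> U \<Longrightarrow> v $ i = 0" for a v
      unfolding mat_eval_schur
    proof (rule schur_pos)
      show "transpose (mat_eval F a) = mat_eval F a" using insert.prems(1) by (metis mat_eval_transpose)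
      show "v \<noteq> 0" "v $ k = 0" using v insert.hyps by auto
      show "0 < mat_eval F a $ k $ k" using piv by (simp add: mat_eval_component)
      show "0 < u \<bullet> (mat_eval F a *v u)" if "u \<noteq> 0" "\<And>i. i \<noteq> k \<Longrightarrow> v $ i = 0 \<Longrightarrow> u $ i = 0" for u
        by (rule pd[OF that(1)]) (use that(2) v(2) in blast)
    qed
  qed
  then obtain s where "s \<in> sum_squares" "mat_smult (1 + s) (schur k F) - diag_on U \<in> mat_sum_squares" by blast
  then show ?case
    using pivot_certificate[OF insert.prems(1,2) insert.hyps(2) _ st(1,2,3)] by blast
qed

theorem positive_definite_certificate:
  fixes F :: "'d::finite rpoly ^ 'n::finite ^ 'n"
  assumes "transpose F = F" "\<And>a v. v \<noteq> 0 \<Longrightarrow> 0 < v \<bullet> (mat_eval F a *v v)"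
  shows "\<exists>s\<in>sum_squares. \<exists>S\<in>mat_sum_squares. mat_smult (1 + s) F = mat 1 + S"
proof -
  obtain s where s: "s \<in> sum_squares" "mat_smult (1 + s) F - diag_on UNIV \<in> mat_sum_squares"
    using positive_definite_certificate_on[of F UNIV] assms by auto
  have "mat_smult (1 + s) F = mat 1 + (mat_smult (1 + s) F - diag_on UNIV)"
    by (simp add: vec_eq_iff diag_on_def mat_def)
  then show ?thesis using s by metis
qed

subsection \<open>The vanishing conditions\<close>

definition join :: "real ^ 'd \<Rightarrow> real ^ 'n \<Rightarrow> real ^ ('d + 'n)" where
  "join a v = (\<chi> k. case k of Inl i \<Rightarrow> a $ i | Inr j \<Rightarrow> v $ j)"

lemma join_component: "join a v $ Inl i = a $ i" "join a v $ Inr j = v $ j"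
  by (simp_all add: join_def)

lemma join_surj: "z = join (\<chi> i. z $ Inl i) (\<chi> j. z $ Inr j)"
  by (simp add: vec_eq_iff join_def split: sum.split)

text \<open>The forms to be compared depend polynomially on \<open>a\<close> and \<open>v\<close>
  jointly. Describing them as functions avoids a substitution map from polynomials in
  \<open>a\<close> to polynomials in all coordinates.\<close>

definition polynomial_in :: "(real ^ 'd::finite \<Rightarrow> real ^ 'n::finite \<Rightarrow> real) \<Rightarrow> bool" where
  "polynomial_in h \<longleftrightarrow> (\<exists>g. \<forall>a v. poly_eval g (join a v) = h a v)"

lemma polynomial_in_const: "polynomial_in (\<lambda>a v. c)"
  unfolding polynomial_in_def using poly_eval_const by blast

lemma polynomial_in_var: "polynomial_in (\<lambda>a v. a $ i)" "polynomial_in (\<lambda>a v. v $ j)"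
  unfolding polynomial_in_def by (metis poly_eval_var join_component)+

lemma polynomial_in_add: "polynomial_in h \<Longrightarrow> polynomial_in h' \<Longrightarrow> polynomial_in (\<lambda>a v. h a v + h' a v)"
  unfolding polynomial_in_def by (metis poly_eval_add)

lemma polynomial_in_mult: "polynomial_in h \<Longrightarrow> polynomial_in h' \<Longrightarrow> polynomial_in (\<lambda>a v. h a v * h' a v)"
  unfolding polynomial_in_def by (metis poly_eval_mult)

lemma polynomial_in_sum: "(\<And>x. x \<in> A \<Longrightarrow> polynomial_in (h x)) \<Longrightarrow> polynomial_in (\<lambda>a v. \<Sum>x\<in>A. h x a v)"
  by (induction A rule: infinite_finite_induct) (simp_all add: polynomial_in_const polynomial_in_add)

lemma polynomial_in_poly_eval: "polynomial_in (\<lambda>a v. poly_eval p a)"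
  using poly_in_UNIV[of p]
  by induction (simp_all add: poly_eval_const poly_eval_var poly_eval_add poly_eval_mult
      polynomial_in_const polynomial_in_var polynomial_in_add polynomial_in_mult)

lemma polynomial_in_apply: "polynomial_in (\<lambda>a v. (mat_eval A a *v v) $ i)"
  unfolding matrix_vector_mult_def mat_eval_component vec_lambda_beta
  by (intro polynomial_in_sum polynomial_in_mult polynomial_in_poly_eval polynomial_in_var)

lemma polynomial_in_inner:
  assumes "\<And>i. polynomial_in (\<lambda>a v. h a v $ i)" "\<And>i. polynomial_in (\<lambda>a v. h' a v $ i)"
  shows "polynomial_in (\<lambda>a v. h a v \<bullet> h' a v)"
  unfolding inner_vec_def inner_real_def by (intro polynomial_in_sum polynomial_in_mult assms)

abbreviation weight :: "real ^ 'd::finite \<Rightarrow> real" where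
  "weight a \<equiv> 1 + a \<bullet> a"

lemma weight_ge_1: "1 \<le> weight a"
  by simp

text \<open>Restricting \<open>v\<close> to the unit sphere leaves only growth in \<open>a\<close>,
  so that a power of the weight bounds both the witness \<open>q\<close> and the form of
  \<open>F\<close> in \<open>finsler_multiplier\<close>.\<close>

lemma polynomial_growth:
  fixes g :: "('d::finite + 'n::finite) rpoly"
  shows "\<exists>C K. 0 < C \<and> (\<forall>a v. norm v = 1 \<longrightarrow> \<bar>poly_eval g (join a v)\<bar> \<le> C * weight a ^ K)"
  using poly_in_UNIV[of g]
proof induction
  case (const c)
  show ?case
    by (intro exI[of _ "\<bar>c\<bar> + 1"] exI[of _ 0]) (auto simp: poly_eval_const)
next
  case (var k)
  have "\<bar>join a v $ k\<bar> \<le> weight a" if "norm v = 1" for a :: "real ^ 'd" and v :: "real ^ 'n"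
  proof (cases k)
    case (Inl i)
    have "\<bar>a $ i\<bar> \<le> norm a" by (rule component_le_norm_cart)
    also have "\<dots> \<le> weight a"
    proof -
      have "0 \<le> (norm a - 1)\<^sup>2 + (norm a)\<^sup>2" by simp
      then show ?thesis by (simp add: dot_square_norm power2_eq_square algebra_simps)
    qed
    finally show ?thesis by (simp add: Inl join_component)
  next
    case (Inr j)
    have "\<bar>v $ j\<bar> \<le> 1" using component_le_norm_cart[of v j] that by simp
    from order_trans[OF this weight_ge_1] show ?thesis by (simp add: Inr join_component)
  qed
  then show ?case by (intro exI[of _ 1]) (auto simp: poly_eval_var intro!: exI[of _ 1])
next
  case (add p q)
  then obtain C K C' K' where CK: "0 < C" "0 < C'"
    "\<And>a v. norm (v :: real ^ 'n) = 1 \<Longrightarrow> \<bar>poly_eval p (join a v)\<bar> \<le> C * weight a ^ K"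
    "\<And>a v. norm (v :: real ^ 'n) = 1 \<Longrightarrow> \<bar>poly_eval q (join a v)\<bar> \<le> C' * weight a ^ K'" by blast
  have "\<bar>poly_eval (p + q) (join a v)\<bar> \<le> (C + C') * weight a ^ (K + K')" if "norm v = 1" for a :: "real ^ 'd" and v :: "real ^ 'n"
  proof -
    have "weight a ^ K \<le> weight a ^ (K + K')" "weight a ^ K' \<le> weight a ^ (K + K')"
      by (intro power_increasing weight_ge_1; simp)+
    then have "C * weight a ^ K + C' * weight a ^ K' \<le> C * weight a ^ (K + K') + C' * weight a ^ (K + K')"
      using CK(1,2) by (intro add_mono mult_left_mono) auto
    then show ?thesis using CK(3,4)[OF that, of a] by (simp add: poly_eval_add distrib_right)
  qed
  then show ?case using CK(1,2) by (intro exI[of _ "C + C'"] exI[of _ "K + K'"]) auto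
next
  case (mult p q)
  then obtain C K C' K' where CK: "0 < C" "0 < C'"
    "\<And>a v. norm (v :: real ^ 'n) = 1 \<Longrightarrow> \<bar>poly_eval p (join a v)\<bar> \<le> C * weight a ^ K"
    "\<And>a v. norm (v :: real ^ 'n) = 1 \<Longrightarrow> \<bar>poly_eval q (join a v)\<bar> \<le> C' * weight a ^ K'" by blast
  have "\<bar>poly_eval (p * q) (join a v)\<bar> \<le> (C * C') * weight a ^ (K + K')" if "norm v = 1" for a :: "real ^ 'd" and v :: "real ^ 'n"
  proof -
    have "\<bar>poly_eval p (join a v)\<bar> * \<bar>poly_eval q (join a v)\<bar> \<le> (C * weight a ^ K) * (C' * weight a ^ K')"
      using CK(1) by (intro mult_mono CK(3,4) that) (auto intro!: mult_nonneg_nonneg zero_le_power)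
    then show ?thesis by (simp add: poly_eval_mult abs_mult power_add mult_ac)
  qed
  then show ?case using CK(1,2) by (intro exI[of _ "C * C'"] exI[of _ "K + K'"]) auto
qed

text \<open>If no multiple \<open>N w\<^sup>N\<close> worked, the polynomials that are eventually nonnegative along a sequence of
  counterexamples would form a preordering. In a maximal extension of it, \<open>\<Sum>i. \<bar>G\<^sub>i v\<bar>\<^sup>2\<close> is smaller than
  every \<open>1 / (C w\<^sup>K)\<close>; by maximality it then vanishes there, which a real point would contradict.\<close>

lemma finsler_multiplier:
  fixes F :: "'d::finite rpoly ^ 'n::finite ^ 'n" and G :: "nat \<Rightarrow> 'd rpoly ^ 'n ^ 'n"
  assumes pos: "\<And>a v. v \<noteq> 0 \<Longrightarrow> (\<forall>i\<in>I. mat_eval (G i) a *v v = 0) \<Longrightarrow> 0 < v \<bullet> (mat_eval F a *v v)"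
    and "finite I"
  shows "\<exists>N::nat. \<forall>a v. v \<noteq> 0 \<longrightarrow>
    0 < v \<bullet> (mat_eval F a *v v) + real N * weight a ^ N * (\<Sum>i\<in>I. (mat_eval (G i) a *v v) \<bullet> (mat_eval (G i) a *v v))"
proof (rule ccontr)
  define qF :: "real ^ 'd \<Rightarrow> real ^ 'n \<Rightarrow> real" where "qF a v = v \<bullet> (mat_eval F a *v v)" for a v
  define qQ :: "real ^ 'd \<Rightarrow> real ^ 'n \<Rightarrow> real"
    where "qQ a v = (\<Sum>i\<in>I. (mat_eval (G i) a *v v) \<bullet> (mat_eval (G i) a *v v))" for a v
  assume "\<not> ?thesis"
  then have "\<forall>N. \<exists>a v. v \<noteq> 0 \<and> qF a v + real N * weight a ^ N * qQ a v \<le> 0"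
    unfolding qF_def qQ_def by (simp add: not_less)
  then obtain a u where u: "\<And>N. u N \<noteq> 0" "\<And>N. qF (a N) (u N) + real N * weight (a N) ^ N * qQ (a N) (u N) \<le> 0"
    by metis
  define v where "v N = (1 / norm (u N)) *\<^sub>R u N" for N
  have v: "norm (v N) = 1" for N using u(1) by (simp add: v_def)
  have Qnn: "0 \<le> qQ b x" for b x by (simp add: qQ_def sum_nonneg)
  have fail: "qF (a N) (v N) + real N * weight (a N) ^ N * qQ (a N) (v N) \<le> 0" for N
  proof -
    have "qF (a N) (v N) = (1 / norm (u N))\<^sup>2 * qF (a N) (u N)" "qQ (a N) (v N) = (1 / norm (u N))\<^sup>2 * qQ (a N) (u N)"
      unfolding qF_def qQ_def v_def by (simp_all add: matrix_vector_mult_scaleR power2_eq_square sum_distrib_left)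
    then have "qF (a N) (v N) + real N * weight (a N) ^ N * qQ (a N) (v N)
      = (1 / norm (u N))\<^sup>2 * (qF (a N) (u N) + real N * weight (a N) ^ N * qQ (a N) (u N))"
      by (simp add: algebra_simps)
    then show ?thesis using u(2)[of N] by (simp add: mult_nonneg_nonpos)
  qed
  have "polynomial_in qF" unfolding qF_def
    by (intro polynomial_in_inner polynomial_in_var polynomial_in_apply)
  then obtain gF where gF: "\<And>a v. poly_eval gF (join a v) = qF a v" unfolding polynomial_in_def by blast
  have "polynomial_in qQ" unfolding qQ_def
    by (intro polynomial_in_sum polynomial_in_inner polynomial_in_apply)
  then obtain gQ where gQ: "\<And>a v. poly_eval gQ (join a v) = qQ a v" unfolding polynomial_in_def by blast
  have "polynomial_in (\<lambda>(a :: real ^ 'd) (v :: real ^ 'n). v \<bullet> v + - 1)"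
    by (intro polynomial_in_add polynomial_in_inner polynomial_in_var polynomial_in_const)
  then obtain gn :: "('d + 'n) rpoly" where gn: "\<And>a v. poly_eval gn (join a v) = v \<bullet> v - 1"
    unfolding polynomial_in_def by auto
  have "polynomial_in (\<lambda>(a :: real ^ 'd) (v :: real ^ 'n). weight a)"
    by (intro polynomial_in_add polynomial_in_inner polynomial_in_var polynomial_in_const)
  then obtain gw :: "('d + 'n) rpoly" where gw: "\<And>a v. poly_eval gw (join a v) = weight a"
    unfolding polynomial_in_def by auto
  define T where "T = {g. \<forall>\<^sub>F N in sequentially. 0 \<le> poly_eval g (join (a N) (v N))}"
  have "ring_preordering T"
    unfolding ring_preordering_def
  proof (intro conjI ballI allI)
    fix x y assume "x \<in> T" "y \<in> T"
    then have "\<forall>\<^sub>F N in sequentially. 0 \<le> poly_eval x (join (a N) (v N)) \<and> 0 \<le> poly_eval y (join (a N) (v N))"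
      unfolding T_def by (simp add: eventually_conj)
    then show "x + y \<in> T" "x * y \<in> T"
      unfolding T_def mem_Collect_eq by (eventually_elim, simp add: poly_eval_add poly_eval_mult)+
  next
    show "x\<^sup>2 \<in> T" for x by (simp add: T_def poly_eval.hom_power)
    show "- 1 \<notin> T" by (simp add: T_def poly_eval.hom_minus poly_eval_one)
  qed
  then obtain P where P: "maximal_preordering P" "T \<subseteq> P" using maximal_preordering_ex by blast
  note D = preorderingD[OF maximal_preordering_imp[OF P(1)]]
  have TP: "g \<in> P" if "\<And>N. N \<ge> M \<Longrightarrow> 0 \<le> poly_eval g (join (a N) (v N))" for g M
    using P(2) that unfolding T_def eventually_sequentially by blast
  have QP: "gQ \<in> P" by (rule TP[of 0]) (simp add: gQ Qnn)
  show False
  \<comment> \<open>If \<open>gQ\<close> is in the support, a real point realises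
    \<open>gQ = 0\<close> on the unit sphere with the form of \<open>F\<close> at most zero, against
    \<open>pos\<close>. Otherwise maximality provides \<open>q\<close> with
    \<open>gQ * q = 1 + p\<close>, and bounding \<open>q\<close> by \<open>h\<close> forces
    \<open>gQ * h\<close> to be at least 1, while the failing inequalities make it at most one
    half.\<close>
  proof (cases "- gQ \<in> P")
    case True
    have "gn \<in> P" "- gn \<in> P" by (rule TP[of 0]; simp add: gn poly_eval.hom_minus dot_square_norm v)+
    moreover have "- gF \<in> P"
    proof (rule TP[of 0])
      fix N
      have "0 \<le> real N * weight (a N) ^ N * qQ (a N) (v N)" using Qnn by simp
      then show "0 \<le> poly_eval (- gF) (join (a N) (v N))" using fail[of N] by (simp add: gF poly_eval.hom_minus)
    qed
    ultimately have "{- gQ, gn, - gn, - gF} \<subseteq> P" using True by simp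
    then obtain z where z: "\<forall>\<phi>\<in>{- gQ, gn, - gn, - gF}. 0 \<le> poly_eval \<phi> z"
      using maximal_preordering_realized[OF P(1)] unfolding realized_def by (meson finite.intros)
    obtain b x where "z = join b x" using join_surj by blast
    then have bx: "qQ b x \<le> 0" "x \<bullet> x = 1" "qF b x \<le> 0"
      using z by (simp_all add: gQ gn gF poly_eval.hom_minus)
    then have "qQ b x = 0" using Qnn[of b x] by simp
    then have "\<forall>i\<in>I. mat_eval (G i) b *v x = 0"
      unfolding qQ_def using \<open>finite I\<close> by (simp add: sum_nonneg_eq_0_iff)
    moreover have "x \<noteq> 0" using bx(2) by auto
    ultimately show False using pos[of x b] bx(3) by (simp add: qF_def)
  next
    case False
    then obtain p q where pq: "p \<in> P" "q \<in> P" "gQ * q = 1 + p"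
      using maximal_preordering_witness[OF P(1)] by fastforce
    obtain C K where C: "0 < C" "\<And>b x. norm (x :: real ^ 'n) = 1 \<Longrightarrow> \<bar>poly_eval q (join b x)\<bar> \<le> C * weight b ^ K"
      using polynomial_growth[of q] by blast
    obtain C' K' where C': "0 < C'" "\<And>b x. norm (x :: real ^ 'n) = 1 \<Longrightarrow> \<bar>poly_eval gF (join b x)\<bar> \<le> C' * weight b ^ K'"
      using polynomial_growth[of gF] by blast
    define h where "h = const_poly C * gw ^ K"
    have "h - q \<in> P"
      by (rule TP[of 0]) (use C(2) v in \<open>auto simp: h_def poly_eval.hom_diff poly_eval_mult poly_eval.hom_power poly_eval_const gw intro: order_trans[OF abs_ge_self]\<close>)
    then have "gQ * (h - q) + p \<in> P" using D(1,2) QP pq by blast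
    moreover have "gQ * (h - q) + p = gQ * h - 1" using pq(3) by (simp add: right_diff_distrib)
    ultimately have 1: "gQ * h - 1 \<in> P" by simp
    have 2: "const_poly (1/2) - gQ * h \<in> P"
    proof (rule TP)
      \<comment> \<open>The summand \<open>K + K'\<close> allows the power of \<open>w\<close> to be
        raised to \<open>N\<close>, the rounded \<open>2 * C * C'\<close> yields the constant one
        half, and the final 1 makes \<open>N\<close> positive so that it can be cancelled.\<close>
      fix N assume N: "K + K' + nat \<lceil>2 * C * C'\<rceil> + 1 \<le> N"
      define w where "w = weight (a N)"
      define Q where "Q = qQ (a N) (v N)"
      have w: "1 \<le> w" and Q: "0 \<le> Q" using Qnn by (simp_all add: w_def Q_def)
      have "real N * w ^ (K + K') * Q \<le> real N * w ^ N * Q"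
        using N w Q by (intro mult_right_mono mult_left_mono power_increasing) auto
      also have "\<dots> \<le> - qF (a N) (v N)" using fail[of N] by (simp add: w_def Q_def)
      also have "\<dots> \<le> C' * w ^ K'" using C'(2)[OF v, of "a N" N] by (simp add: gF w_def)
      finally have "(real N * w ^ K * Q) * w ^ K' \<le> C' * w ^ K'" by (simp add: power_add mult_ac)
      then have "real N * (w ^ K * Q) \<le> C'" using w by (simp add: mult_le_cancel_right mult_ac)
      then have "C * (real N * (w ^ K * Q)) \<le> C * C'" using C(1) by simp
      moreover have "2 * C * C' \<le> real N" using N by linarith
      ultimately have "2 * (real N * (C * (w ^ K * Q))) \<le> real N" by (simp add: mult_ac)
      then have "2 * (C * (w ^ K * Q)) \<le> 1" using N by (simp add: mult.left_commute[of 2])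
      then show "0 \<le> poly_eval (const_poly (1/2) - gQ * h) (join (a N) (v N))"
        by (simp add: h_def poly_eval.hom_diff poly_eval_mult poly_eval.hom_power poly_eval_const gw gQ w_def Q_def mult_ac)
    qed
    have "(gQ * h - 1) + (const_poly (1/2) - gQ * h) \<in> P" by (rule D(1)[OF 1 2])
    then have half: "const_poly (1/2) - 1 \<in> P" by simp
    have "(const_poly (1/2) - 1) + (const_poly (1/2) - 1) \<in> P" by (rule D(1)[OF half half])
    moreover have "const_poly (1/2) + const_poly (1/2) = (1 :: ('d + 'n) rpoly)" by (simp add: const_poly_simps)
    then have "(const_poly (1/2) - 1) + (const_poly (1/2) - 1) = (- 1 :: ('d + 'n) rpoly)" by (simp add: algebra_simps)
    ultimately show False using D(4) by metis
  qed
qed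

section \<open>From certificates to positivity and back\<close>

lemma mat_left_ideal_hull: "mat_left_ideal (mat_left_ideal hull M)"
  by (rule hull_in) (auto simp: mat_left_ideal_def)

lemma inner_vector_matrix_mult: "v \<bullet> (w v* A) = (A *v v) \<bullet> w" for A :: "real ^ 'n ^ 'n"
  by (metis dot_lmul_matrix inner_commute)

lemma mat_sum_squares_nonneg:
  fixes S :: "'d::finite rpoly ^ 'n::finite ^ 'n"
  assumes "S \<in> mat_sum_squares"
  shows "0 \<le> v \<bullet> (mat_eval S a *v v)"
  using assms
proof (induction S rule: mat_sum_squares_induct)
  case (add S H)
  have "v \<bullet> (mat_eval (transpose H ** H) a *v v) = (mat_eval H a *v v) \<bullet> (mat_eval H a *v v)"
    unfolding mat_eval_mult mat_eval_transpose matrix_vector_mul_assoc[symmetric]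
    by (simp add: inner_vector_matrix_mult)
  then show ?case using add.IH
    by (simp add: mat_eval_add matrix_vector_mult_add_rdistrib inner_add_right)
qed (simp add: mat_eval_zero)

text \<open>The matrices whose value at \<open>a\<close> annihilates \<open>v\<close> form a left
  ideal, so everything in the hull annihilates \<open>v\<close>. The transposed summand disappears
  too, since moving it to the other side of the inner product brings back \<open>A'\<close> applied
  to \<open>v\<close>.\<close>

lemma certificate_imp_positive:
  fixes F :: "'d::finite rpoly ^ 'n::finite ^ 'n"
  assumes "s \<in> sum_squares" "S \<in> mat_sum_squares"
    and A: "A \<in> mat_left_ideal hull M" "A' \<in> mat_left_ideal hull M"
    and eq: "mat_smult (1 + s) F = mat 1 + S + A + transpose A'"
    and v: "v \<noteq> 0" "\<And>B. B \<in> M \<Longrightarrow> mat_eval B a *v v = 0"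
  shows "0 < v \<bullet> (mat_eval F a *v v)"
proof -
  have vanish: "mat_eval B a *v v = 0" if "B \<in> mat_left_ideal hull M" for B
  proof -
    have "mat_left_ideal {B. mat_eval B a *v v = 0}"
      by (auto simp: mat_left_ideal_def mat_eval_zero mat_eval_add mat_eval_mult matrix_vector_mult_add_rdistrib
          simp flip: matrix_vector_mul_assoc)
    then have "mat_left_ideal hull M \<subseteq> {B. mat_eval B a *v v = 0}"
      using v(2) by (intro hull_minimal) auto
    then show ?thesis using that by blast
  qed
  have "(1 + poly_eval s a) * (v \<bullet> (mat_eval F a *v v)) = v \<bullet> (mat_eval (mat_smult (1 + s) F) a *v v)"
    by (simp add: mat_eval_smult poly_eval_add poly_eval_one scaleR_matrix_vector_assoc[symmetric])
  also have "\<dots> = v \<bullet> v + v \<bullet> (mat_eval S a *v v)"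
    unfolding eq using vanish[OF A(1)] vanish[OF A(2)]
    by (simp add: mat_eval_add mat_eval_one mat_eval_transpose matrix_vector_mult_add_rdistrib inner_add_right
        inner_vector_matrix_mult)
  also have "\<dots> > 0" using mat_sum_squares_nonneg[OF assms(2), of v a] v(1) by (simp add: add_pos_nonneg)
  finally show ?thesis using poly_eval_sum_squares[OF assms(1), of a] by (simp add: zero_less_mult_iff)
qed

theorem theorem4p1:
  fixes G :: "nat \<Rightarrow> 'd::finite rpoly ^ 'n ^ 'n"
    and m :: nat
    and J :: "('d rpoly ^ 'n ^ 'n) set"
    and F :: "'d rpoly ^ 'n ^ 'n"
  assumes J: "J = mat_left_ideal hull (G ` {1..m})"
    and F: "transpose F = F"
  shows "(\<forall>(a :: real ^ 'd) (v :: real ^ 'n).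
            v \<noteq> 0 \<and> (\<forall>i\<in>{1..m}. mat_eval (G i) a *v v = 0)
              \<longrightarrow> v \<bullet> (mat_eval F a *v v) > 0)
         \<longleftrightarrow>
         (\<exists>s\<in>sum_squares.
            mat_smult (1 + s) F \<in> {mat 1} + mat_sum_squares + J + transpose ` J)"
proof
  assume pos: "\<forall>(a :: real ^ 'd) (v :: real ^ 'n).
      v \<noteq> 0 \<and> (\<forall>i\<in>{1..m}. mat_eval (G i) a *v v = 0) \<longrightarrow> v \<bullet> (mat_eval F a *v v) > 0"
  obtain N :: nat where N: "\<And>a v. v \<noteq> 0 \<Longrightarrow> 0 < v \<bullet> (mat_eval F a *v v) + real N * weight a ^ N *
      (\<Sum>i\<in>{1..m}. (mat_eval (G i) a *v v) \<bullet> (mat_eval (G i) a *v v))"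
    using finsler_multiplier[of "{1..m}" G F] pos by auto
  \<comment> \<open>The polynomial whose value at \<open>a\<close> is \<open>N\<close> times the
    \<open>N\<close>-th power of the weight.\<close>
  define c where "c = const_poly (real N) * (1 + (\<Sum>i\<in>UNIV. (var i :: 'd rpoly)\<^sup>2)) ^ N"
  define Q where "Q = (\<Sum>i\<in>{1..m}. transpose (G i) ** G i)"
  have c: "poly_eval c a = real N * weight a ^ N" for a
    by (simp add: c_def poly_eval_mult poly_eval.hom_power poly_eval_add poly_eval_one poly_eval_const poly_eval_sum
        poly_eval_var inner_vec_def power2_eq_square)
  have evQ: "v \<bullet> (mat_eval Q a *v v) = (\<Sum>i\<in>{1..m}. (mat_eval (G i) a *v v) \<bullet> (mat_eval (G i) a *v v))" for a v
  proof -
    have "v \<bullet> (mat_eval (\<Sum>i\<in>A. transpose (G i) ** G i) a *v v)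
        = (\<Sum>i\<in>A. (mat_eval (G i) a *v v) \<bullet> (mat_eval (G i) a *v v))" if "finite A" for A
      using that
      by induction (simp_all add: mat_eval_zero mat_eval_add matrix_vector_mult_add_rdistrib inner_add_right
          mat_eval_mult mat_eval_transpose inner_vector_matrix_mult flip: matrix_vector_mul_assoc)
    then show ?thesis by (simp add: Q_def)
  qed
  have symQ: "Q $ i $ j = Q $ j $ i" for i j
    by (simp add: Q_def sum_component matrix_mult_component transpose_component mult.commute)
  have "transpose (F + mat_smult c Q) = F + mat_smult c Q"
    using F symQ by (simp add: vec_eq_iff transpose_component mat_smult_component)
  moreover have "0 < v \<bullet> (mat_eval (F + mat_smult c Q) a *v v)" if "v \<noteq> 0" for a v
    using N[OF that, of a]
    by (simp add: mat_eval_add mat_eval_smult matrix_vector_mult_add_rdistrib inner_add_right evQ c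
        scaleR_matrix_vector_assoc[symmetric])
  ultimately obtain s S where s: "s \<in> sum_squares" "S \<in> mat_sum_squares" "mat_smult (1 + s) (F + mat_smult c Q) = mat 1 + S"
    using positive_definite_certificate by blast
  define A where "A = - mat_smult (1 + s) (mat_smult c Q)"
  have ideal: "mat_left_ideal J" unfolding J by (rule mat_left_ideal_hull)
  \<comment> \<open>The scalar and the transposed generator go into the left factor, which a left
    ideal absorbs.\<close>
  have "(\<Sum>i\<in>B. (- mat_smult ((1 + s) * c) (transpose (G i))) ** G i) \<in> J" if "finite B" "B \<subseteq> {1..m}" for B
    using that
  proof induction
    case empty
    then show ?case using ideal by (simp add: mat_left_ideal_def)
  next
    case (insert i B)
    have "G i \<in> J" unfolding J using insert by (intro hull_inc) auto
    then have "(- mat_smult ((1 + s) * c) (transpose (G i))) ** G i \<in> J" using ideal by (simp add: mat_left_ideal_def)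
    then show ?case using insert ideal by (simp add: mat_left_ideal_def)
  qed
  moreover have "A = (\<Sum>i\<in>{1..m}. (- mat_smult ((1 + s) * c) (transpose (G i))) ** G i)"
    by (simp add: A_def Q_def vec_eq_iff mat_smult_component matrix_mult_component sum_component sum_distrib_left
        mult.assoc sum_negf)
  ultimately have "A \<in> J" by simp
  have "mat_smult (1 + s) F = (mat_smult (1 + s) F + mat_smult (1 + s) (mat_smult c Q)) + A"
    by (simp add: A_def)
  also have "\<dots> = mat 1 + S + A + transpose 0"
    using s(3) by (simp add: mat_smult_add) (simp add: transpose_def zero_vec_def)
  finally have eq: "mat_smult (1 + s) F = mat 1 + S + A + transpose 0" .
  have "transpose 0 \<in> transpose ` J" using ideal by (auto simp: mat_left_ideal_def)
  then have "mat_smult (1 + s) F \<in> {mat 1} + mat_sum_squares + J + transpose ` J"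
    unfolding eq using s(2) \<open>A \<in> J\<close> by (intro set_plus_intro) auto
  then show "\<exists>s\<in>sum_squares. mat_smult (1 + s) F \<in> {mat 1} + mat_sum_squares + J + transpose ` J"
    using s(1) by blast
next
  assume "\<exists>s\<in>sum_squares. mat_smult (1 + s) F \<in> {mat 1} + mat_sum_squares + J + transpose ` J"
  then obtain s S A A' where s: "s \<in> sum_squares" "S \<in> mat_sum_squares" "A \<in> J" "A' \<in> J"
    "mat_smult (1 + s) F = mat 1 + S + A + transpose A'"
    by (auto elim!: set_plus_elim)
  show "\<forall>(a :: real ^ 'd) (v :: real ^ 'n).
      v \<noteq> 0 \<and> (\<forall>i\<in>{1..m}. mat_eval (G i) a *v v = 0) \<longrightarrow> v \<bullet> (mat_eval F a *v v) > 0"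
  proof (intro allI impI)
    fix a :: "real ^ 'd" and v :: "real ^ 'n"
    assume v: "v \<noteq> 0 \<and> (\<forall>i\<in>{1..m}. mat_eval (G i) a *v v = 0)"
    show "v \<bullet> (mat_eval F a *v v) > 0"
      by (rule certificate_imp_positive[OF s(1,2) s(3,4)[unfolded J] s(5)]) (use v in auto)
  qed
qed

end
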